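(* Let $\mathcal{A}=\mathcal{A}_n^{\bar q,\Lambda}(\mathbb{K})$ and assume no $q_i$ is a root of unity. Then $\mathcal{A}$ is universally cancellative; consequently it is strongly cancellative and cancellative.
   Context: Let $\mathbb{K}$ be a field, $n\ge 1$, $\bar q=(q_1,\dots,q_n)\in(\mathbb{K}^* )^n$, and $\Lambda=(\lambda_{ij})$ an $n\times n$ matrix over $\mathbb{K}^*$ with $\lambda_{ij}=\lambda_{ji}^{-1}$, $\lambda_{ii}=1$. $\mathcal{A}_n^{\bar q,\Lambda}(\mathbb{K})$ is the $\mathbb{K}$-algebra generated by $x_1,y_1,\dots,x_n,y_n$ with relations: for $1\le i<j\le n$, $x_ix_j=\lambda_{ij}x_jx_i$, $y_jy_i=\lambda_{ji}y_iy_j$, $x_iy_j=\lambda_{ji}y_jx_i$, $x_jy_i=\lambda_{ij}y_ix_j$; and $x_iy_i-q_iy_ix_i=1$ for all $i$. A $\mathbb{K}$-algebra $A$ is cancellative if $A[t]\cong B[t]$ for a $\mathbb{K}$-algebra $B$ implies $A\cong B$; strongly cancellative if for every $d\ge1$, $A[t_1,\dots,t_d]\cong B[t_1,\dots,t_d]$ implies $A\cong B$; universally cancellative if for every finitely generated commutative $\mathbb{K}$-algebra $R$ that is a domain with $R/I\cong\mathbb{K}$ for some ideal $I$, and every $\mathbb{K}$-algebra $B$, $A\otimes_{\mathbb{K}} R\cong B\otimes_{\mathbb{K}} R$ implies $A\cong B$. *)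

theory Defs
  imports "HOL-Algebra.Algebra"
begin

definition kalgebra :: "('k::field, 'a) module \<Rightarrow> bool" where
  "kalgebra A \<longleftrightarrow> ring A \<and>
     (\<forall>c. \<forall>a\<in>carrier A. c \<odot>\<^bsub>A\<^esub> a \<in> carrier A) \<and>
     (\<forall>c d. \<forall>a\<in>carrier A. (c + d) \<odot>\<^bsub>A\<^esub> a = (c \<odot>\<^bsub>A\<^esub> a) \<oplus>\<^bsub>A\<^esub> (d \<odot>\<^bsub>A\<^esub> a)) \<and>
     (\<forall>c. \<forall>a\<in>carrier A. \<forall>b\<in>carrier A.
        c \<odot>\<^bsub>A\<^esub> (a \<oplus>\<^bsub>A\<^esub> b) = (c \<odot>\<^bsub>A\<^esub> a) \<oplus>\<^bsub>A\<^esub> (c \<odot>\<^bsub>A\<^esub> b)) \<and>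
     (\<forall>c d. \<forall>a\<in>carrier A. (c * d) \<odot>\<^bsub>A\<^esub> a = c \<odot>\<^bsub>A\<^esub> (d \<odot>\<^bsub>A\<^esub> a)) \<and>
     (\<forall>a\<in>carrier A. 1 \<odot>\<^bsub>A\<^esub> a = a) \<and>
     (\<forall>c. \<forall>a\<in>carrier A. \<forall>b\<in>carrier A.
        c \<odot>\<^bsub>A\<^esub> (a \<otimes>\<^bsub>A\<^esub> b) = (c \<odot>\<^bsub>A\<^esub> a) \<otimes>\<^bsub>A\<^esub> b \<and>
        c \<odot>\<^bsub>A\<^esub> (a \<otimes>\<^bsub>A\<^esub> b) = a \<otimes>\<^bsub>A\<^esub> (c \<odot>\<^bsub>A\<^esub> b))"

definition kalg_hom :: "('k::field, 'a) module \<Rightarrow> ('k, 'b) module \<Rightarrow> ('a \<Rightarrow> 'b) set" where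
  "kalg_hom A B = {f. f \<in> ring_hom A B \<and>
     (\<forall>c. \<forall>a\<in>carrier A. f (c \<odot>\<^bsub>A\<^esub> a) = c \<odot>\<^bsub>B\<^esub> f a)}"

definition kalg_isomorphic :: "('k::field, 'a) module \<Rightarrow> ('k, 'b) module \<Rightarrow> bool" where
  "kalg_isomorphic A B \<longleftrightarrow> (\<exists>f\<in>kalg_hom A B. bij_betw f (carrier A) (carrier B))"

definition K_alg :: "('k::field, 'k) module" where
  "K_alg = \<lparr>carrier = UNIV, monoid.mult = (*), one = 1, ring.zero = 0, ring.add = (+), smult = (*)\<rparr>"

definition mring :: "('k::field, 'c) module \<Rightarrow> 'm set \<Rightarrow> ('m \<Rightarrow> 'm \<Rightarrow> 'm) \<Rightarrow> 'm
     \<Rightarrow> ('k, 'm \<Rightarrow> 'c) module" where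
  "mring C M op e =
    \<lparr>carrier = {f. (\<forall>m. f m \<in> carrier C) \<and> (\<forall>m. m \<notin> M \<longrightarrow> f m = \<zero>\<^bsub>C\<^esub>)
                   \<and> finite {m. f m \<noteq> \<zero>\<^bsub>C\<^esub>}},
     monoid.mult = (\<lambda>f g m. finsum C (\<lambda>(u, v). f u \<otimes>\<^bsub>C\<^esub> g v)
                {(u, v). u \<in> M \<and> v \<in> M \<and> f u \<noteq> \<zero>\<^bsub>C\<^esub> \<and> g v \<noteq> \<zero>\<^bsub>C\<^esub> \<and> op u v = m}),
     one = (\<lambda>m. if m = e then \<one>\<^bsub>C\<^esub> else \<zero>\<^bsub>C\<^esub>),
     ring.zero = (\<lambda>m. \<zero>\<^bsub>C\<^esub>),
     ring.add = (\<lambda>f g m. f m \<oplus>\<^bsub>C\<^esub> g m),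
     smult = (\<lambda>c f m. c \<odot>\<^bsub>C\<^esub> f m)\<rparr>"

definition delta :: "'m \<Rightarrow> 'm \<Rightarrow> 'k::field" where
  "delta m = (\<lambda>x. if x = m then 1 else 0)"

definition kquot :: "('k::field, 'a) module \<Rightarrow> 'a set \<Rightarrow> ('k, 'a set) module" where
  "kquot A I =
    \<lparr>carrier = carrier (A Quot I), monoid.mult = monoid.mult (A Quot I), one = one (A Quot I),
     ring.zero = ring.zero (A Quot I), ring.add = ring.add (A Quot I),
     smult = (\<lambda>c Cs. \<Union>x\<in>Cs. a_r_coset A I (c \<odot>\<^bsub>A\<^esub> x))\<rparr>"

definition polyring :: "('k::field, 'c) module \<Rightarrow> nat \<Rightarrow> ('k, (nat \<Rightarrow> nat) \<Rightarrow> 'c) module" where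
  "polyring C d = mring C {e. \<forall>i\<ge>d. e i = 0} (\<lambda>e f i. e i + f i) (\<lambda>i. 0)"

text \<open>Tensor product A \<otimes>_K R of K-algebras: the monoid algebra K[A \<times> R] (multiplicative
  monoid) modulo the ideal generated by the K-bilinearity relations.\<close>

definition tensor_pre :: "('k::field, 'a) module \<Rightarrow> ('k, 'r) module \<Rightarrow> ('k, 'a \<times> 'r \<Rightarrow> 'k) module" where
  "tensor_pre A R = mring K_alg (carrier A \<times> carrier R)
      (\<lambda>(a, r) (b, s). (a \<otimes>\<^bsub>A\<^esub> b, r \<otimes>\<^bsub>R\<^esub> s)) (\<one>\<^bsub>A\<^esub>, \<one>\<^bsub>R\<^esub>)"

definition tensor_rels :: "('k::field, 'a) module \<Rightarrow> ('k, 'r) module \<Rightarrow> ('a \<times> 'r \<Rightarrow> 'k) set" where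
  "tensor_rels A R =
     {delta (a \<oplus>\<^bsub>A\<^esub> a', r) \<ominus>\<^bsub>tensor_pre A R\<^esub> delta (a, r) \<ominus>\<^bsub>tensor_pre A R\<^esub> delta (a', r)
        | a a' r. a \<in> carrier A \<and> a' \<in> carrier A \<and> r \<in> carrier R}
   \<union> {delta (a, r \<oplus>\<^bsub>R\<^esub> r') \<ominus>\<^bsub>tensor_pre A R\<^esub> delta (a, r) \<ominus>\<^bsub>tensor_pre A R\<^esub> delta (a, r')
        | a r r'. a \<in> carrier A \<and> r \<in> carrier R \<and> r' \<in> carrier R}
   \<union> {delta (c \<odot>\<^bsub>A\<^esub> a, r) \<ominus>\<^bsub>tensor_pre A R\<^esub> (c \<odot>\<^bsub>tensor_pre A R\<^esub> delta (a, r))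
        | c a r. a \<in> carrier A \<and> r \<in> carrier R}
   \<union> {delta (a, c \<odot>\<^bsub>R\<^esub> r) \<ominus>\<^bsub>tensor_pre A R\<^esub> (c \<odot>\<^bsub>tensor_pre A R\<^esub> delta (a, r))
        | c a r. a \<in> carrier A \<and> r \<in> carrier R}"

definition tensor :: "('k::field, 'a) module \<Rightarrow> ('k, 'r) module \<Rightarrow> ('k, ('a \<times> 'r \<Rightarrow> 'k) set) module" where
  "tensor A R = kquot (tensor_pre A R) (genideal (tensor_pre A R) (tensor_rels A R))"

definition kalg_fin_gen :: "('k::field, 'a) module \<Rightarrow> bool" where
  "kalg_fin_gen R \<longleftrightarrow> (\<exists>S. finite S \<and> S \<subseteq> carrier R \<and>
     (\<forall>T. S \<subseteq> T \<and> T \<subseteq> carrier R \<and> \<one>\<^bsub>R\<^esub> \<in> T \<and>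
          (\<forall>x\<in>T. \<forall>y\<in>T. x \<oplus>\<^bsub>R\<^esub> y \<in> T \<and> x \<otimes>\<^bsub>R\<^esub> y \<in> T) \<and>
          (\<forall>c. \<forall>x\<in>T. c \<odot>\<^bsub>R\<^esub> x \<in> T) \<longrightarrow> T = carrier R))"

datatype gen = GX nat | GY nat

definition gens :: "nat \<Rightarrow> gen set" where
  "gens n = {g. \<exists>i\<in>{1..n}. g = GX i \<or> g = GY i}"

definition free_alg :: "nat \<Rightarrow> ('k::field, gen list \<Rightarrow> 'k) module" where
  "free_alg n = mring K_alg (lists (gens n)) (@) []"

definition qw_rels :: "nat \<Rightarrow> (nat \<Rightarrow> 'k::field) \<Rightarrow> (nat \<Rightarrow> nat \<Rightarrow> 'k) \<Rightarrow> (gen list \<Rightarrow> 'k) set" where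
  "qw_rels n q \<Lambda> =
     {delta [GX i, GX j] \<ominus>\<^bsub>free_alg n\<^esub> (\<Lambda> i j \<odot>\<^bsub>free_alg n\<^esub> delta [GX j, GX i]) | i j. 1 \<le> i \<and> i < j \<and> j \<le> n}
   \<union> {delta [GY j, GY i] \<ominus>\<^bsub>free_alg n\<^esub> (\<Lambda> j i \<odot>\<^bsub>free_alg n\<^esub> delta [GY i, GY j]) | i j. 1 \<le> i \<and> i < j \<and> j \<le> n}
   \<union> {delta [GX i, GY j] \<ominus>\<^bsub>free_alg n\<^esub> (\<Lambda> j i \<odot>\<^bsub>free_alg n\<^esub> delta [GY j, GX i]) | i j. 1 \<le> i \<and> i < j \<and> j \<le> n}
   \<union> {delta [GX j, GY i] \<ominus>\<^bsub>free_alg n\<^esub> (\<Lambda> i j \<odot>\<^bsub>free_alg n\<^esub> delta [GY i, GX j]) | i j. 1 \<le> i \<and> i < j \<and> j \<le> n}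
   \<union> {delta [GX i, GY i] \<ominus>\<^bsub>free_alg n\<^esub> (q i \<odot>\<^bsub>free_alg n\<^esub> delta [GY i, GX i])
          \<ominus>\<^bsub>free_alg n\<^esub> delta [] | i. 1 \<le> i \<and> i \<le> n}"

definition qweyl :: "nat \<Rightarrow> (nat \<Rightarrow> 'k::field) \<Rightarrow> (nat \<Rightarrow> nat \<Rightarrow> 'k) \<Rightarrow> ('k, (gen list \<Rightarrow> 'k) set) module" where
  "qweyl n q \<Lambda> = kquot (free_alg n) (genideal (free_alg n) (qw_rels n q \<Lambda>))"

text \<open>Since the notions quantify over all K-algebras B (of arbitrary type), they are
  expressed for a given B; the theorem then quantifies over B (and its type) universally.\<close>

definition cancels_with :: "('k::field, 'a) module \<Rightarrow> ('k, 'b) module \<Rightarrow> bool" where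
  "cancels_with A B \<longleftrightarrow>
     (kalgebra B \<and> kalg_isomorphic (polyring A 1) (polyring B 1) \<longrightarrow> kalg_isomorphic A B)"

definition strongly_cancels_with :: "('k::field, 'a) module \<Rightarrow> ('k, 'b) module \<Rightarrow> bool" where
  "strongly_cancels_with A B \<longleftrightarrow> (\<forall>d\<ge>1.
     kalgebra B \<and> kalg_isomorphic (polyring A d) (polyring B d) \<longrightarrow> kalg_isomorphic A B)"

definition universally_cancels_with ::
    "('k::field, 'a) module \<Rightarrow> ('k, 'b) module \<Rightarrow> ('k, 'r) module \<Rightarrow> bool" where
  "universally_cancels_with A B R \<longleftrightarrow>
     (kalgebra R \<and> domain R \<and> kalg_fin_gen R \<and>
      (\<exists>I. ideal I R \<and> kalg_isomorphic (kquot R I) (K_alg :: ('k, 'k) module)) \<and>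
      kalgebra B \<and> kalg_isomorphic (tensor A R) (tensor B R) \<longrightarrow> kalg_isomorphic A B)"

end

theory Submission
  imports Defs
begin

text \<open>Let \<open>A\<close> be the quantum Weyl algebra. It acts on monomials \<open>Y\<^sup>m\<close>, with \<open>y\<^sub>i\<close> multiplying and
  \<open>x\<^sub>i\<close> a twisted \<open>q\<^sub>i\<close>-derivative; since no \<open>q\<^sub>i\<close> is a root of unity, the ordered words
  spanning \<open>A\<close> act independently, so the action is faithful. The element \<open>x\<^sub>iy\<^sub>i - y\<^sub>ix\<^sub>i\<close> acts
  on \<open>Y\<^sup>m\<close> by \<open>q\<^sub>i\<close> to the power \<open>m\<^sub>i\<close>, so a central element acts diagonally, and commuting
  with the \<open>y\<^sub>i\<close> it acts as a scalar: the center of \<open>A\<close> is \<open>K\<close>.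

  Hence \<open>A \<otimes> R\<close> has center \<open>R\<close>. An isomorphism with \<open>B \<otimes> R\<close> embeds both the center \<open>Z\<close> of \<open>B\<close>
  and, if some \<open>z\<close> in \<open>Z\<close> is transcendental, the polynomial ring \<open>R[z]\<close> into \<open>R\<close>. The latter is
  impossible for growth reasons when \<open>R\<close> is finitely generated. So \<open>Z\<close> is algebraic over \<open>K\<close>,
  and as a domain with an augmentation to \<open>K\<close> it equals \<open>K\<close>. The isomorphism therefore restricts
  to an automorphism of \<open>R\<close>, and specializing along an augmentation of \<open>R\<close> and along its transport
  by this automorphism yields mutually inverse homomorphisms between \<open>A\<close> and \<open>B\<close>.\<close>

section \<open>Algebras over a field\<close>

text \<open>The given isomorphism from A \<otimes> R to B \<otimes> R need not be R-linear. It maps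
  center to center, but while the center Z of B is unknown this yields only an injective
  endomorphism \<open>\<psi>\<close> of R, perhaps not onto. Hence the growth argument must treat an
  element transcendental over the image of \<open>\<psi>\<close>, and surjectivity of
  \<open>\<psi>\<close> becomes available only after Z = K.

  Growth is measured by counting monomials. With s generators of R, a fixed list of s + 1 elements
  has (N+1)^(s+1) monomials with exponents at most N, all in a space of dimension at most (CN+1)^s
  with C fixed, so for large N they are dependent.

  The augmentation of R serves twice. It shifts a central element to augmentation 0, where a
  polynomial relation over a domain forces the element to vanish; and it specializes tensor
  products. A is specialized along \<open>\<epsilon>\<close> but B along \<open>\<epsilon>\<close>
  after \<open>\<psi>\<close>, so that the isomorphism matches the two specializations.

  The argument runs over an abstract tensor product \<open>tens\<close>, of which both
  \<open>tensor\<close> and \<open>polyring\<close> are instances.\<close>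

definition additive_map :: "('a, 'm) ring_scheme \<Rightarrow> ('b, 'n) ring_scheme \<Rightarrow> ('a \<Rightarrow> 'b) \<Rightarrow> bool" where
  "additive_map A B L \<longleftrightarrow> L \<in> carrier A \<rightarrow> carrier B \<and>
     (\<forall>x\<in>carrier A. \<forall>y\<in>carrier A. L (x \<oplus>\<^bsub>A\<^esub> y) = L x \<oplus>\<^bsub>B\<^esub> L y)"

lemma additive_map_abelian_group_hom:
  assumes "abelian_group A" "abelian_group B" "additive_map A B L"
  shows "abelian_group_hom A B L"
  using assms
  by (intro abelian_group_homI)
     (auto simp: additive_map_def hom_def Pi_def
       intro!: group_hom.intro group_hom_axioms.intro abelian_group.a_group)

lemma additive_map_zero:
  assumes "abelian_group A" "abelian_group B" "additive_map A B L"
  shows "L \<zero>\<^bsub>A\<^esub> = \<zero>\<^bsub>B\<^esub>"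
  using abelian_group_hom.hom_zero[OF additive_map_abelian_group_hom[OF assms]] .

lemma additive_map_finsum:
  assumes "abelian_group A" "abelian_group B" "additive_map A B L" "f \<in> F \<rightarrow> carrier A"
  shows "L (finsum A f F) = finsum B (\<lambda>i. L (f i)) F"
proof -
  interpret A: abelian_group A by fact
  interpret B: abelian_group B by fact
  note z = additive_map_zero[OF assms(1-3)]
  show ?thesis using assms(4)
  proof (induction F rule: infinite_finite_induct)
    case (insert x F)
    then have "(\<lambda>i. L (f i)) \<in> F \<rightarrow> carrier B" "L (f x) \<in> carrier B"
      using assms(3) by (auto simp: additive_map_def Pi_def)
    moreover have "f x \<in> carrier A" "f \<in> F \<rightarrow> carrier A" using insert.prems by auto
    ultimately show ?case using insert assms(3) A.finsum_closed[of f F]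
      by (simp add: additive_map_def)
  qed (simp_all add: z)
qed

context abelian_group begin

lemma finsum_swap:
  assumes "finite I" "finite J" "\<And>i j. i \<in> I \<Longrightarrow> j \<in> J \<Longrightarrow> f i j \<in> carrier G"
  shows "(\<Oplus>i\<in>I. \<Oplus>j\<in>J. f i j) = (\<Oplus>j\<in>J. \<Oplus>i\<in>I. f i j)"
  using assms(1,3)
proof (induction I rule: finite_induct)
  case empty
  then show ?case by simp
next
  case (insert x F)
  have "(\<Oplus>j\<in>J. \<Oplus>i\<in>insert x F. f i j) = (\<Oplus>j\<in>J. f x j \<oplus> (\<Oplus>i\<in>F. f i j))"
    using insert by (intro finsum_cong') (auto simp: Pi_def)
  also have "\<dots> = (\<Oplus>j\<in>J. f x j) \<oplus> (\<Oplus>j\<in>J. \<Oplus>i\<in>F. f i j)"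
    using insert by (intro finsum_addf) (auto simp: Pi_def)
  finally show ?case using insert by (simp add: Pi_def)
qed

lemma finsum_Times:
  assumes "finite I" "finite J" "\<And>i j. i \<in> I \<Longrightarrow> j \<in> J \<Longrightarrow> f (i, j) \<in> carrier G"
  shows "finsum G f (I \<times> J) = (\<Oplus>i\<in>I. \<Oplus>j\<in>J. f (i, j))"
  using assms(1,3)
proof (induction I rule: finite_induct)
  case empty
  then show ?case by simp
next
  case (insert x F)
  have "insert x F \<times> J = ({x} \<times> J) \<union> (F \<times> J)" by auto
  moreover have "finsum G f (({x} \<times> J) \<union> (F \<times> J)) = finsum G f ({x} \<times> J) \<oplus> finsum G f (F \<times> J)"
    using insert assms(2) by (intro finsum_Un_disjoint) auto
  moreover have "finsum G f ({x} \<times> J) = (\<Oplus>j\<in>J. f (x, j))"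
  proof -
    have "{x} \<times> J = (\<lambda>j. (x, j)) ` J" by auto
    moreover have "finsum G f ((\<lambda>j. (x, j)) ` J) = (\<Oplus>j\<in>J. f (x, j))"
      using insert by (intro finsum_reindex) (auto simp: inj_on_def)
    ultimately show ?thesis by simp
  qed
  ultimately show ?case using insert by (simp add: Pi_def)
qed

lemma finsum_single_support:
  assumes "finite I" "i \<in> I" "f i \<in> carrier G" "\<And>j. j \<in> I \<Longrightarrow> j \<noteq> i \<Longrightarrow> f j = \<zero>"
  shows "finsum G f I = f i"
proof -
  have "f \<in> I \<rightarrow> carrier G" using assms(3,4) by (metis Pi_I zero_closed)
  then have "finsum G f I = finsum G f {i}"
    using assms by (intro add.finprod_mono_neutral_cong_right) auto
  then show ?thesis using assms by simp
qed

lemma eq_if_minus_eq_zero: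
  assumes "x \<in> carrier G" "y \<in> carrier G" "x \<ominus> y = \<zero>"
  shows "x = y"
  using assms by (metis a_minus_def add.inv_closed minus_equality minus_minus r_neg a_comm)

end

text \<open>The linear half of \<open>kalg\<close>, split off because the representation spaces
  \<open>lin_maps\<close> and \<open>fun_mod\<close> used below are vector spaces without a ring
  structure.\<close>

locale kmod = abelian_group A for A :: "('k::field, 'a) module" (structure) +
  assumes smult_closed [simp, intro]: "a \<in> carrier A \<Longrightarrow> c \<odot> a \<in> carrier A"
    and smult_l_distr: "a \<in> carrier A \<Longrightarrow> (c + d) \<odot> a = (c \<odot> a) \<oplus> (d \<odot> a)"
    and smult_r_distr: "a \<in> carrier A \<Longrightarrow> b \<in> carrier A \<Longrightarrow> c \<odot> (a \<oplus> b) = (c \<odot> a) \<oplus> (c \<odot> b)"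
    and smult_smult: "a \<in> carrier A \<Longrightarrow> c \<odot> (d \<odot> a) = (c * d) \<odot> a"
    and smult_one [simp]: "a \<in> carrier A \<Longrightarrow> 1 \<odot> a = a"

locale kalg = kmod A + ring A for A :: "('k::field, 'a) module" (structure) +
  assumes smult_mult_l: "a \<in> carrier A \<Longrightarrow> b \<in> carrier A \<Longrightarrow> (c \<odot> a) \<otimes> b = c \<odot> (a \<otimes> b)"
    and smult_mult_r: "a \<in> carrier A \<Longrightarrow> b \<in> carrier A \<Longrightarrow> a \<otimes> (c \<odot> b) = c \<odot> (a \<otimes> b)"

lemma kalgebra_iff_kalg: "kalgebra A \<longleftrightarrow> kalg A"
proof
  assume *: "kalgebra A"
  then have r: "ring A" by (simp add: kalgebra_def)
  show "kalg A"
    by (intro kalg.intro kmod.intro r kmod_axioms.intro kalg_axioms.intro ring.is_abelian_group)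
       (use * in \<open>unfold kalgebra_def, metis\<close>)+
next
  assume "kalg A"
  then interpret kalg A .
  show "kalgebra A" unfolding kalgebra_def
    by (intro conjI allI ballI ring_axioms)
       (simp_all only: smult_closed smult_l_distr smult_r_distr smult_smult smult_mult_l smult_mult_r smult_one)
qed

context kmod begin

lemma smult_additive: "additive_map A A (\<lambda>a. c \<odot> a)"
  by (auto simp: additive_map_def smult_r_distr)

lemma smult_r_zero [simp]: "c \<odot> \<zero> = \<zero>"
  using additive_map_zero[OF abelian_group_axioms abelian_group_axioms smult_additive] .

lemma smult_l_zero [simp]: "a \<in> carrier A \<Longrightarrow> 0 \<odot> a = \<zero>"
  using smult_l_distr[of a 0 0] by (metis add.r_cancel_one' add_0 smult_closed)

lemma smult_l_minus: "a \<in> carrier A \<Longrightarrow> (- c) \<odot> a = \<ominus> (c \<odot> a)"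
  using smult_l_distr[of a "- c" c] by (metis minus_equality add.left_inverse smult_closed smult_l_zero)

lemma smult_r_minus: "a \<in> carrier A \<Longrightarrow> c \<odot> (\<ominus> a) = \<ominus> (c \<odot> a)"
  using smult_r_distr[of "\<ominus> a" a c] by (metis minus_equality l_neg smult_closed smult_r_zero a_inv_closed)

lemma smult_finsum:
  "f \<in> F \<rightarrow> carrier A \<Longrightarrow> c \<odot> finsum A f F = (\<Oplus>i\<in>F. c \<odot> f i)"
  using additive_map_finsum[OF abelian_group_axioms abelian_group_axioms smult_additive] .

lemma smult_eq_zeroD:
  assumes "c \<odot> a = \<zero>" "a \<in> carrier A" "c \<noteq> 0"
  shows "a = \<zero>"
proof -
  have "inverse c \<odot> (c \<odot> a) = \<zero>" using assms by simp
  then show ?thesis using assms smult_smult[of a "inverse c" c] by simp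
qed

lemma smult_sum:
  assumes "a \<in> carrier A" "finite F"
  shows "(\<Sum>i\<in>F. c i) \<odot> a = (\<Oplus>i\<in>F. c i \<odot> a)"
  using assms(2)
  by (induction F rule: finite_induct) (use assms(1) in \<open>auto simp: smult_l_distr\<close>)

section \<open>Linear combinations, spans and independence of indexed families\<close>

definition lincomb :: "('i \<Rightarrow> 'a) \<Rightarrow> ('i \<Rightarrow> 'k) \<Rightarrow> 'i set \<Rightarrow> 'a" where
  "lincomb h c F = (\<Oplus>i\<in>F. c i \<odot> h i)"

definition lspan :: "('i \<Rightarrow> 'a) \<Rightarrow> 'i set \<Rightarrow> 'a set" where
  "lspan h P = {lincomb h c F | c F. finite F \<and> F \<subseteq> P}"

text \<open>Independence is that of a family, not of its range: equal vectors at two indices are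
  dependent. This matters for powers of an element and for monomials, where distinct exponents could
  give the same value.\<close>

definition lin_indep :: "('i \<Rightarrow> 'a) \<Rightarrow> 'i set \<Rightarrow> bool" where
  "lin_indep h P \<longleftrightarrow> (\<forall>c F. finite F \<and> F \<subseteq> P \<and> lincomb h c F = \<zero> \<longrightarrow> (\<forall>i\<in>F. c i = 0))"

lemma lincomb_closed [simp]: "h \<in> F \<rightarrow> carrier A \<Longrightarrow> lincomb h c F \<in> carrier A"
  unfolding lincomb_def by (intro finsum_closed) auto

lemma lincomb_extend:
  assumes "finite F" "F' \<subseteq> F" "h \<in> F \<rightarrow> carrier A"
  shows "lincomb h c F' = lincomb h (\<lambda>i. if i \<in> F' then c i else 0) F"
  unfolding lincomb_def using assms
  by (intro add.finprod_mono_neutral_cong_left) (auto simp: Pi_def subset_iff)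

lemma lincomb_add:
  assumes "h \<in> F \<rightarrow> carrier A"
  shows "lincomb h c F \<oplus> lincomb h d F = lincomb h (\<lambda>i. c i + d i) F"
proof -
  have "lincomb h (\<lambda>i. c i + d i) F = (\<Oplus>i\<in>F. (c i \<odot> h i) \<oplus> (d i \<odot> h i))"
    unfolding lincomb_def using assms by (intro finsum_cong') (auto simp: smult_l_distr Pi_def)
  also have "\<dots> = lincomb h c F \<oplus> lincomb h d F"
    unfolding lincomb_def using assms by (intro finsum_addf) auto
  finally show ?thesis by simp
qed

lemma lincomb_smult:
  assumes "h \<in> F \<rightarrow> carrier A"
  shows "d \<odot> lincomb h c F = lincomb h (\<lambda>i. d * c i) F"
  unfolding lincomb_def using assms
  by (subst smult_finsum) (auto simp: Pi_def smult_smult intro!: finsum_cong')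

lemma lspanE:
  assumes "x \<in> lspan h P"
  obtains c F where "finite F" "F \<subseteq> P" "x = lincomb h c F"
  using assms by (auto simp: lspan_def)

lemma lspanE_finite:
  assumes "x \<in> lspan h P" "finite P" "h \<in> P \<rightarrow> carrier A"
  obtains c where "x = lincomb h c P"
proof -
  from assms(1) obtain c F where "finite F" "F \<subseteq> P" "x = lincomb h c F" by (rule lspanE)
  then show ?thesis using that lincomb_extend[of P F h c] assms by metis
qed

lemma lspan_add:
  assumes "x \<in> lspan h P" "y \<in> lspan h P" "h \<in> P \<rightarrow> carrier A"
  shows "x \<oplus> y \<in> lspan h P"
proof -
  from assms(1) obtain c F where F: "finite F" "F \<subseteq> P" "x = lincomb h c F" by (rule lspanE)
  from assms(2) obtain d G where G: "finite G" "G \<subseteq> P" "y = lincomb h d G" by (rule lspanE)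
  have h: "h \<in> F \<union> G \<rightarrow> carrier A" using F G assms by auto
  have "x \<oplus> y = lincomb h (\<lambda>i. (if i \<in> F then c i else 0) + (if i \<in> G then d i else 0)) (F \<union> G)"
    using F G h lincomb_extend[of "F \<union> G" F h c] lincomb_extend[of "F \<union> G" G h d]
      lincomb_add[OF h] by simp
  then show ?thesis using F G unfolding lspan_def by blast
qed

lemma lspan_smult:
  assumes "x \<in> lspan h P" "h \<in> P \<rightarrow> carrier A"
  shows "c \<odot> x \<in> lspan h P"
proof -
  from assms(1) obtain d F where F: "finite F" "F \<subseteq> P" "x = lincomb h d F" by (rule lspanE)
  have "h \<in> F \<rightarrow> carrier A" using F assms by auto
  then have "c \<odot> x = lincomb h (\<lambda>i. c * d i) F" using F lincomb_smult by simp
  then show ?thesis using F unfolding lspan_def by blast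
qed

lemma lspan_zero: "\<zero> \<in> lspan h P"
  unfolding lspan_def by (auto simp: lincomb_def intro!: exI[of _ "{}"])

lemma lspan_base:
  assumes "p \<in> P" "h p \<in> carrier A"
  shows "h p \<in> lspan h P"
  unfolding lspan_def using assms
  by (auto simp: lincomb_def intro!: exI[of _ "{p}"] exI[of _ "\<lambda>_. 1"])

text \<open>An induction principle for spans. Applied to sets such as all x whose product with a
  fixed y lies in a given span, it proves statements about products one factor at a time.\<close>

lemma lspan_subset:
  assumes "\<And>p. p \<in> P \<Longrightarrow> h p \<in> S" "S \<subseteq> carrier A" "\<zero> \<in> S"
    "\<And>x y. x \<in> S \<Longrightarrow> y \<in> S \<Longrightarrow> x \<oplus> y \<in> S" "\<And>c x. x \<in> S \<Longrightarrow> c \<odot> x \<in> S"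
  shows "lspan h P \<subseteq> S"
proof
  fix x assume "x \<in> lspan h P"
  then obtain c F where F: "finite F" "F \<subseteq> P" "x = lincomb h c F" by (rule lspanE)
  have "lincomb h c F \<in> S" using F(1,2)
  proof (induction F rule: finite_induct)
    case empty
    then show ?case by (simp add: lincomb_def assms)
  next
    case (insert y F)
    have "h \<in> F \<rightarrow> carrier A" "h y \<in> S" "h y \<in> carrier A" using insert assms(1,2) by auto
    then show ?case using insert assms(4,5)
      by (simp add: lincomb_def Pi_def)
  qed
  then show "x \<in> S" using F by simp
qed

lemma lspan_closed: "h \<in> P \<rightarrow> carrier A \<Longrightarrow> lspan h P \<subseteq> carrier A"
  by (intro lspan_subset) auto

end

section \<open>Homomorphisms and isomorphisms of algebras\<close>

lemma kalg_homD:
  assumes "f \<in> kalg_hom A B"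
  shows "f \<in> ring_hom A B"
    "\<And>x. x \<in> carrier A \<Longrightarrow> f x \<in> carrier B"
    "\<And>x y. x \<in> carrier A \<Longrightarrow> y \<in> carrier A \<Longrightarrow> f (x \<oplus>\<^bsub>A\<^esub> y) = f x \<oplus>\<^bsub>B\<^esub> f y"
    "\<And>x y. x \<in> carrier A \<Longrightarrow> y \<in> carrier A \<Longrightarrow> f (x \<otimes>\<^bsub>A\<^esub> y) = f x \<otimes>\<^bsub>B\<^esub> f y"
    "f \<one>\<^bsub>A\<^esub> = \<one>\<^bsub>B\<^esub>"
    "\<And>c x. x \<in> carrier A \<Longrightarrow> f (c \<odot>\<^bsub>A\<^esub> x) = c \<odot>\<^bsub>B\<^esub> f x"
    "additive_map A B f"
  using assms by (auto simp: kalg_hom_def ring_hom_def additive_map_def)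

lemma kalg_homI:
  assumes "\<And>x. x \<in> carrier A \<Longrightarrow> f x \<in> carrier B"
    "\<And>x y. x \<in> carrier A \<Longrightarrow> y \<in> carrier A \<Longrightarrow> f (x \<oplus>\<^bsub>A\<^esub> y) = f x \<oplus>\<^bsub>B\<^esub> f y"
    "\<And>x y. x \<in> carrier A \<Longrightarrow> y \<in> carrier A \<Longrightarrow> f (x \<otimes>\<^bsub>A\<^esub> y) = f x \<otimes>\<^bsub>B\<^esub> f y"
    "f \<one>\<^bsub>A\<^esub> = \<one>\<^bsub>B\<^esub>"
    "\<And>c x. x \<in> carrier A \<Longrightarrow> f (c \<odot>\<^bsub>A\<^esub> x) = c \<odot>\<^bsub>B\<^esub> f x"
  shows "f \<in> kalg_hom A B"
  using assms by (auto simp: kalg_hom_def ring_hom_def)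

lemma kalg_hom_zero:
  assumes "kalg A" "kalg B" "f \<in> kalg_hom A B"
  shows "f \<zero>\<^bsub>A\<^esub> = \<zero>\<^bsub>B\<^esub>"
  using assms additive_map_zero kalg_homD(7) kalg.axioms(1) kmod.axioms(1) by metis

lemma kalg_hom_minus:
  assumes "kalg A" "kalg B" "f \<in> kalg_hom A B" "x \<in> carrier A" "y \<in> carrier A"
  shows "f (x \<ominus>\<^bsub>A\<^esub> y) = f x \<ominus>\<^bsub>B\<^esub> f y"
proof -
  interpret abelian_group_hom A B f
    using assms additive_map_abelian_group_hom kalg_homD(7) kalg.axioms(1) kmod.axioms(1) by metis
  show ?thesis using assms by (simp add: a_minus_def)
qed

lemma kalg_hom_finsum:
  assumes "kalg A" "kalg B" "f \<in> kalg_hom A B" "g \<in> F \<rightarrow> carrier A"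
  shows "f (finsum A g F) = finsum B (\<lambda>i. f (g i)) F"
  using assms additive_map_finsum kalg_homD(7) kalg.axioms(1) kmod.axioms(1) by metis

lemma kalg_hom_comp:
  assumes "f \<in> kalg_hom A B" "g \<in> kalg_hom B C"
  shows "(\<lambda>x. g (f x)) \<in> kalg_hom A C"
  using kalg_homD[OF assms(1)] kalg_homD[OF assms(2)] by (intro kalg_homI) auto

lemma kalg_hom_inv:
  assumes "kalg A" "f \<in> kalg_hom A B" "bij_betw f (carrier A) (carrier B)"
  shows "inv_into (carrier A) f \<in> kalg_hom B A" (is "?g \<in> _")
proof -
  interpret kalg A by fact
  note [simp] = kalg_homD(2-6)[OF assms(2)]
  have g: "?g y \<in> carrier A" "f (?g y) = y" if "y \<in> carrier B" for y
    using that assms(3) by (metis bij_betw_def inv_into_into, metis bij_betw_inv_into_right)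
  have gf: "?g (f x) = x" if "x \<in> carrier A" for x
    using that assms(3) by (metis bij_betw_inv_into_left)
  have gI: "?g y = x" if "x \<in> carrier A" "f x = y" for x y
    using gf that by auto
  show ?thesis
  proof (rule kalg_homI)
    show "?g (x \<oplus>\<^bsub>B\<^esub> y) = ?g x \<oplus>\<^bsub>A\<^esub> ?g y" if "x \<in> carrier B" "y \<in> carrier B" for x y
      using that by (intro gI) (simp_all add: g)
    show "?g (x \<otimes>\<^bsub>B\<^esub> y) = ?g x \<otimes>\<^bsub>A\<^esub> ?g y" if "x \<in> carrier B" "y \<in> carrier B" for x y
      using that by (intro gI) (simp_all add: g)
    show "?g \<one>\<^bsub>B\<^esub> = \<one>\<^bsub>A\<^esub>" by (intro gI) simp_all
    show "?g (c \<odot>\<^bsub>B\<^esub> x) = c \<odot>\<^bsub>A\<^esub> ?g x" if "x \<in> carrier B" for c x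
      using that by (intro gI) (simp_all add: g)
  qed (rule g)
qed

lemma kalg_isomorphicI:
  assumes "f \<in> kalg_hom A B" "g \<in> kalg_hom B A"
    "\<And>x. x \<in> carrier A \<Longrightarrow> g (f x) = x" "\<And>y. y \<in> carrier B \<Longrightarrow> f (g y) = y"
  shows "kalg_isomorphic A B"
proof -
  have "bij_betw f (carrier A) (carrier B)"
    using assms(3,4) kalg_homD(2)[OF assms(1)] kalg_homD(2)[OF assms(2)]
    by (intro bij_betw_byWitness[where f' = g]) blast+
  then show ?thesis using assms(1) unfolding kalg_isomorphic_def by blast
qed

context kalg begin

lemma smult_one_mult: "a \<in> carrier A \<Longrightarrow> (c \<odot> \<one>) \<otimes> a = c \<odot> a"
  by (simp add: smult_mult_l)

lemma mult_smult_one: "a \<in> carrier A \<Longrightarrow> a \<otimes> (c \<odot> \<one>) = c \<odot> a"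
  by (simp add: smult_mult_r)

lemma smult_one_eq_zero_iff: "\<one> \<noteq> \<zero> \<Longrightarrow> c \<odot> \<one> = \<zero> \<longleftrightarrow> c = 0"
  using smult_eq_zeroD[of c \<one>] by auto

end

definition kcenter :: "('k::field, 'a) module \<Rightarrow> 'a set" where
  "kcenter A = {z \<in> carrier A. \<forall>a\<in>carrier A. z \<otimes>\<^bsub>A\<^esub> a = a \<otimes>\<^bsub>A\<^esub> z}"

text \<open>The zero algebra is excluded because R does not embed into its tensor product with R;
  \<open>kappa_inj\<close> relies on this.\<close>

definition central_kalg :: "('k::field, 'a) module \<Rightarrow> bool" where
  "central_kalg A \<longleftrightarrow> \<one>\<^bsub>A\<^esub> \<noteq> \<zero>\<^bsub>A\<^esub> \<and> (\<forall>z\<in>kcenter A. \<exists>c. z = c \<odot>\<^bsub>A\<^esub> \<one>\<^bsub>A\<^esub>)"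

lemma K_alg_simps [simp]:
  "carrier K_alg = UNIV" "x \<otimes>\<^bsub>K_alg\<^esub> y = x * y" "\<one>\<^bsub>K_alg\<^esub> = 1" "\<zero>\<^bsub>K_alg\<^esub> = 0"
  "x \<oplus>\<^bsub>K_alg\<^esub> y = x + y" "c \<odot>\<^bsub>K_alg\<^esub> x = c * x"
  by (simp_all add: K_alg_def)

lemma kalg_K_alg: "kalg (K_alg :: ('k::field, 'k) module)"
proof -
  have a: "abelian_group (K_alg :: ('k, 'k) module)"
  proof (rule abelian_groupI)
    show "\<exists>y\<in>carrier K_alg. y \<oplus>\<^bsub>K_alg\<^esub> x = \<zero>\<^bsub>K_alg\<^esub>" for x :: 'k
      by (rule bexI[of _ "- x"]) simp_all
  qed (simp_all add: add.assoc add.commute)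
  have "monoid (K_alg :: ('k, 'k) module)"
    by (rule monoidI) (simp_all add: mult.assoc)
  then have r: "ring (K_alg :: ('k, 'k) module)"
    by (intro ringI a) (simp_all add: distrib_left distrib_right)
  show ?thesis
    by (intro kalg.intro kmod.intro a r kmod_axioms.intro kalg_axioms.intro)
       (simp_all add: distrib_left distrib_right mult.assoc mult.left_commute)
qed

lemma K_alg_minus [simp]: "\<ominus>\<^bsub>K_alg\<^esub> x = - x" "x \<ominus>\<^bsub>K_alg\<^esub> y = x - (y :: 'k::field)"
proof -
  have g: "abelian_group (K_alg :: ('k, 'k) module)"
    using kalg_K_alg kalg.axioms(1) kmod.axioms(1) by blast
  show *: "\<ominus>\<^bsub>K_alg\<^esub> x = - x" for x :: 'k
    by (rule abelian_group.minus_equality[OF g]) simp_all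
  show "x \<ominus>\<^bsub>K_alg\<^esub> y = x - y" by (simp add: a_minus_def *)
qed

section \<open>Monoid algebras\<close>

text \<open>Three instances are used: words under concatenation (the free algebra), exponent vectors
  under addition (polynomial rings), and pairs under componentwise product (the algebra of which
  \<open>tensor\<close> is a quotient).\<close>

locale monoid_alg = C: kalg C for C :: "('k::field, 'c) module" +
  fixes M :: "'m set" and op :: "'m \<Rightarrow> 'm \<Rightarrow> 'm" and e :: 'm
  assumes op_closed [simp, intro]: "u \<in> M \<Longrightarrow> v \<in> M \<Longrightarrow> op u v \<in> M"
    and op_assoc: "u \<in> M \<Longrightarrow> v \<in> M \<Longrightarrow> w \<in> M \<Longrightarrow> op (op u v) w = op u (op v w)"
    and e_closed [simp, intro]: "e \<in> M"
    and op_e_left [simp]: "u \<in> M \<Longrightarrow> op e u = u"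
    and op_e_right [simp]: "u \<in> M \<Longrightarrow> op u e = u"
begin

abbreviation MR where "MR \<equiv> mring C M op e"

definition supp :: "('m \<Rightarrow> 'c) \<Rightarrow> 'm set" where "supp f = {m. f m \<noteq> \<zero>\<^bsub>C\<^esub>}"

definition mono :: "'c \<Rightarrow> 'm \<Rightarrow> 'm \<Rightarrow> 'c" where
  "mono a m = (\<lambda>x. if x = m then a else \<zero>\<^bsub>C\<^esub>)"

lemma carrierD:
  assumes "f \<in> carrier MR"
  shows "f m \<in> carrier C" "supp f \<subseteq> M" "finite (supp f)" "m \<notin> supp f \<Longrightarrow> f m = \<zero>\<^bsub>C\<^esub>"
  using assms by (auto simp: mring_def supp_def)

lemma carrierI:
  assumes "\<And>m. f m \<in> carrier C" "finite F" "F \<subseteq> M" "\<And>m. m \<notin> F \<Longrightarrow> f m = \<zero>\<^bsub>C\<^esub>"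
  shows "f \<in> carrier MR"
proof -
  have "{m. f m \<noteq> \<zero>\<^bsub>C\<^esub>} \<subseteq> F" using assms(4) by auto
  then show ?thesis using assms finite_subset by (fastforce simp: mring_def)
qed

lemma mring_simps:
  "\<zero>\<^bsub>MR\<^esub> = (\<lambda>m. \<zero>\<^bsub>C\<^esub>)" "\<one>\<^bsub>MR\<^esub> = mono \<one>\<^bsub>C\<^esub> e"
  "f \<oplus>\<^bsub>MR\<^esub> g = (\<lambda>m. f m \<oplus>\<^bsub>C\<^esub> g m)" "c \<odot>\<^bsub>MR\<^esub> f = (\<lambda>m. c \<odot>\<^bsub>C\<^esub> f m)"
  by (auto simp: mring_def mono_def)

lemma mono_closed [simp, intro]: "a \<in> carrier C \<Longrightarrow> m \<in> M \<Longrightarrow> mono a m \<in> carrier MR"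
  by (rule carrierI[of _ "{m}"]) (auto simp: mono_def)

lemma supp_mono: "supp (mono a m) \<subseteq> {m}"
  by (auto simp: mono_def supp_def)

lemma mono_zero: "mono \<zero>\<^bsub>C\<^esub> m = \<zero>\<^bsub>MR\<^esub>"
  by (auto simp: mono_def mring_simps)

lemma mono_add: "a \<in> carrier C \<Longrightarrow> b \<in> carrier C \<Longrightarrow> mono a m \<oplus>\<^bsub>MR\<^esub> mono b m = mono (a \<oplus>\<^bsub>C\<^esub> b) m"
  by (auto simp: mono_def mring_simps)

lemma mono_smult: "c \<odot>\<^bsub>MR\<^esub> mono a m = mono (c \<odot>\<^bsub>C\<^esub> a) m"
  by (auto simp: mono_def mring_simps)

lemma kmod_mring: "kmod MR"
proof -
  have fin: "finite (supp f \<union> supp g)" if "f \<in> carrier MR" "g \<in> carrier MR" for f g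
    using that carrierD(3) by auto
  have "abelian_group MR"
  proof (rule abelian_groupI)
    show "x \<oplus>\<^bsub>MR\<^esub> y \<in> carrier MR" if "x \<in> carrier MR" "y \<in> carrier MR" for x y
      unfolding mring_simps using that carrierD[OF that(1)] carrierD[OF that(2)] fin[OF that]
      by (intro carrierI[of _ "supp x \<union> supp y"]) auto
    show "\<zero>\<^bsub>MR\<^esub> \<in> carrier MR" unfolding mring_simps by (rule carrierI[of _ "{}"]) auto
    show "\<exists>y\<in>carrier MR. y \<oplus>\<^bsub>MR\<^esub> x = \<zero>\<^bsub>MR\<^esub>" if x: "x \<in> carrier MR" for x
    proof (rule bexI[of _ "\<lambda>m. \<ominus>\<^bsub>C\<^esub> x m"])
      show "(\<lambda>m. \<ominus>\<^bsub>C\<^esub> x m) \<in> carrier MR" using carrierD[OF x]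
        by (intro carrierI[of _ "supp x"]) auto
      show "(\<lambda>m. \<ominus>\<^bsub>C\<^esub> x m) \<oplus>\<^bsub>MR\<^esub> x = \<zero>\<^bsub>MR\<^esub>"
        unfolding mring_simps using carrierD(1)[OF x] by (simp add: C.l_neg)
    qed
  qed (auto simp: mring_simps carrierD C.a_ac)
  then show ?thesis
  proof (intro kmod.intro kmod_axioms.intro)
    show "c \<odot>\<^bsub>MR\<^esub> x \<in> carrier MR" if x: "x \<in> carrier MR" for c x
      unfolding mring_simps using carrierD[OF x]
      by (intro carrierI[of _ "supp x"]) auto
  qed (auto simp: mring_simps carrierD C.smult_l_distr C.smult_r_distr C.smult_smult)
qed

sublocale MR: kmod MR by (rule kmod_mring)

lemma finsum_apply:
  assumes "F \<in> I \<rightarrow> carrier MR"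
  shows "finsum MR F I m = finsum C (\<lambda>i. F i m) I"
proof -
  have "additive_map MR C (\<lambda>f. f m)"
    by (auto simp: additive_map_def mring_simps carrierD)
  then show ?thesis
    using additive_map_finsum[OF MR.abelian_group_axioms C.abelian_group_axioms _ assms] by blast
qed

lemma mono_decomp:
  assumes "f \<in> carrier MR"
  shows "f = finsum MR (\<lambda>m. mono (f m) m) (supp f)"
proof
  fix x
  note f = carrierD[OF assms]
  have cl: "(\<lambda>m. mono (f m) m) \<in> supp f \<rightarrow> carrier MR" using f by auto
  show "f x = finsum MR (\<lambda>m. mono (f m) m) (supp f) x"
  proof (cases "x \<in> supp f")
    case True
    then have "finsum C (\<lambda>i. mono (f i) i x) (supp f) = f x"
      using f by (subst C.finsum_single_support[of _ x]) (auto simp: mono_def)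
    then show ?thesis by (simp add: finsum_apply[OF cl])
  next
    case False
    then have "finsum C (\<lambda>i. mono (f i) i x) (supp f) = \<zero>\<^bsub>C\<^esub>"
      by (intro C.add.finprod_one_eqI) (auto simp: mono_def)
    then show ?thesis using False f by (simp add: finsum_apply[OF cl])
  qed
qed

text \<open>Identities that are additive in each argument need to be checked only on monomials. Zero
  is no separate case, being the monomial with coefficient zero at \<open>e\<close>.\<close>

lemma mring_induct [consumes 1, case_names mono add]:
  assumes "f \<in> carrier MR"
    and mono: "\<And>a m. a \<in> carrier C \<Longrightarrow> m \<in> M \<Longrightarrow> P (mono a m)"
    and add: "\<And>f g. f \<in> carrier MR \<Longrightarrow> g \<in> carrier MR \<Longrightarrow> P f \<Longrightarrow> P g \<Longrightarrow> P (f \<oplus>\<^bsub>MR\<^esub> g)"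
  shows "P f"
proof -
  note f = carrierD[OF assms(1)]
  have "P (finsum MR (\<lambda>m. mono (f m) m) F)" if "finite F" "F \<subseteq> supp f" for F
    using that
  proof (induction F rule: finite_induct)
    case empty
    have "P (mono \<zero>\<^bsub>C\<^esub> e)" by (rule mono) auto
    then show ?case by (simp add: mono_zero)
  next
    case (insert x F)
    have cl: "(\<lambda>m. mono (f m) m) \<in> F \<rightarrow> carrier MR" "mono (f x) x \<in> carrier MR"
      using f insert by auto
    then show ?case using insert f by (auto intro!: add mono)
  qed
  then show ?thesis using mono_decomp[OF assms(1)] f by (metis order_refl)
qed

text \<open>The index rectangle may exceed the supports, so that several products can be expanded
  over a common index set when distributivity is proved.\<close>

lemma mult_eval:
  assumes "f \<in> carrier MR" "g \<in> carrier MR" "finite F" "finite G" "supp f \<subseteq> F" "supp g \<subseteq> G"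
  shows "(f \<otimes>\<^bsub>MR\<^esub> g) m = finsum C (\<lambda>(u, v). if op u v = m then f u \<otimes>\<^bsub>C\<^esub> g v else \<zero>\<^bsub>C\<^esub>) (F \<times> G)"
proof -
  note f = carrierD[OF assms(1)] note g = carrierD[OF assms(2)]
  have "(f \<otimes>\<^bsub>MR\<^esub> g) m = finsum C (\<lambda>(u, v). f u \<otimes>\<^bsub>C\<^esub> g v)
                {(u, v). u \<in> M \<and> v \<in> M \<and> f u \<noteq> \<zero>\<^bsub>C\<^esub> \<and> g v \<noteq> \<zero>\<^bsub>C\<^esub> \<and> op u v = m}"
    by (simp add: mring_def)
  also have "\<dots> = finsum C (\<lambda>(u, v). if op u v = m then f u \<otimes>\<^bsub>C\<^esub> g v else \<zero>\<^bsub>C\<^esub>) (F \<times> G)"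
  proof (rule C.add.finprod_mono_neutral_cong_left)
    show "{(u, v). u \<in> M \<and> v \<in> M \<and> f u \<noteq> \<zero>\<^bsub>C\<^esub> \<and> g v \<noteq> \<zero>\<^bsub>C\<^esub> \<and> op u v = m} \<subseteq> F \<times> G"
      using assms by (auto simp: supp_def)
    show "(case i of (u, v) \<Rightarrow> if op u v = m then f u \<otimes>\<^bsub>C\<^esub> g v else \<zero>\<^bsub>C\<^esub>) = \<zero>\<^bsub>C\<^esub>"
      if "i \<in> F \<times> G - {(u, v). u \<in> M \<and> v \<in> M \<and> f u \<noteq> \<zero>\<^bsub>C\<^esub> \<and> g v \<noteq> \<zero>\<^bsub>C\<^esub> \<and> op u v = m}" for i
    proof -
      obtain u v where [simp]: "i = (u, v)" by (cases i)
      have "f u = \<zero>\<^bsub>C\<^esub> \<or> g v = \<zero>\<^bsub>C\<^esub> \<or> op u v \<noteq> m" using that f(2) g(2) by (auto simp: supp_def)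
      then show ?thesis using f(1) g(1) by auto
    qed
  qed (use assms f g in \<open>auto simp: Pi_def\<close>)
  finally show ?thesis .
qed

lemma mult_closed:
  assumes "f \<in> carrier MR" "g \<in> carrier MR"
  shows "f \<otimes>\<^bsub>MR\<^esub> g \<in> carrier MR"
proof (rule carrierI)
  note f = carrierD[OF assms(1)] note g = carrierD[OF assms(2)]
  note ev = mult_eval[OF assms f(3) g(3) order_refl order_refl]
  show "(f \<otimes>\<^bsub>MR\<^esub> g) m \<in> carrier C" for m
    unfolding ev using f g by (intro C.finsum_closed) auto
  show "finite ((\<lambda>(u, v). op u v) ` (supp f \<times> supp g))" using f g by auto
  show "(\<lambda>(u, v). op u v) ` (supp f \<times> supp g) \<subseteq> M" using f(2) g(2) by auto
  show "(f \<otimes>\<^bsub>MR\<^esub> g) m = \<zero>\<^bsub>C\<^esub>" if "m \<notin> (\<lambda>(u, v). op u v) ` (supp f \<times> supp g)" for m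
    unfolding ev using that by (intro C.add.finprod_one_eqI) auto
qed

lemma mult_l_distr:
  assumes "f \<in> carrier MR" "g \<in> carrier MR" "h \<in> carrier MR"
  shows "(f \<oplus>\<^bsub>MR\<^esub> g) \<otimes>\<^bsub>MR\<^esub> h = (f \<otimes>\<^bsub>MR\<^esub> h) \<oplus>\<^bsub>MR\<^esub> (g \<otimes>\<^bsub>MR\<^esub> h)"
proof
  fix m
  note f = carrierD[OF assms(1)] note g = carrierD[OF assms(2)] note h = carrierD[OF assms(3)]
  let ?F = "supp f \<union> supp g"
  have s: "supp (f \<oplus>\<^bsub>MR\<^esub> g) \<subseteq> ?F" by (auto simp: mring_simps supp_def)
  have F: "finite ?F" using f g by auto
  have "((f \<oplus>\<^bsub>MR\<^esub> g) \<otimes>\<^bsub>MR\<^esub> h) m =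
      finsum C (\<lambda>(u, v). if op u v = m then (f u \<oplus>\<^bsub>C\<^esub> g u) \<otimes>\<^bsub>C\<^esub> h v else \<zero>\<^bsub>C\<^esub>) (?F \<times> supp h)"
    using mult_eval[OF MR.a_closed[OF assms(1,2)] assms(3) F h(3) s order_refl]
    by (simp only: mring_simps(3))
  also have "\<dots> = finsum C (\<lambda>p. (case p of (u, v) \<Rightarrow> if op u v = m then f u \<otimes>\<^bsub>C\<^esub> h v else \<zero>\<^bsub>C\<^esub>)
       \<oplus>\<^bsub>C\<^esub> (case p of (u, v) \<Rightarrow> if op u v = m then g u \<otimes>\<^bsub>C\<^esub> h v else \<zero>\<^bsub>C\<^esub>)) (?F \<times> supp h)"
    using f(1) g(1) h(1) by (intro C.finsum_cong') (auto simp: C.l_distr)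
  also have "\<dots> = (f \<otimes>\<^bsub>MR\<^esub> h) m \<oplus>\<^bsub>C\<^esub> (g \<otimes>\<^bsub>MR\<^esub> h) m"
    using mult_eval[OF assms(1,3) F h(3) _ order_refl] mult_eval[OF assms(2,3) F h(3) _ order_refl]
      f(1) g(1) h(1)
    by (subst C.finsum_addf) auto
  finally show "((f \<oplus>\<^bsub>MR\<^esub> g) \<otimes>\<^bsub>MR\<^esub> h) m = ((f \<otimes>\<^bsub>MR\<^esub> h) \<oplus>\<^bsub>MR\<^esub> (g \<otimes>\<^bsub>MR\<^esub> h)) m"
    by (simp add: mring_simps)
qed

lemma mult_r_distr:
  assumes "f \<in> carrier MR" "g \<in> carrier MR" "h \<in> carrier MR"
  shows "h \<otimes>\<^bsub>MR\<^esub> (f \<oplus>\<^bsub>MR\<^esub> g) = (h \<otimes>\<^bsub>MR\<^esub> f) \<oplus>\<^bsub>MR\<^esub> (h \<otimes>\<^bsub>MR\<^esub> g)"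
proof
  fix m
  note f = carrierD[OF assms(1)] note g = carrierD[OF assms(2)] note h = carrierD[OF assms(3)]
  let ?F = "supp f \<union> supp g"
  have s: "supp (f \<oplus>\<^bsub>MR\<^esub> g) \<subseteq> ?F" by (auto simp: mring_simps supp_def)
  have F: "finite ?F" using f g by auto
  have "(h \<otimes>\<^bsub>MR\<^esub> (f \<oplus>\<^bsub>MR\<^esub> g)) m =
      finsum C (\<lambda>(u, v). if op u v = m then h u \<otimes>\<^bsub>C\<^esub> (f v \<oplus>\<^bsub>C\<^esub> g v) else \<zero>\<^bsub>C\<^esub>) (supp h \<times> ?F)"
    using mult_eval[OF assms(3) MR.a_closed[OF assms(1,2)] h(3) F order_refl s]
    by (simp only: mring_simps(3))
  also have "\<dots> = finsum C (\<lambda>p. (case p of (u, v) \<Rightarrow> if op u v = m then h u \<otimes>\<^bsub>C\<^esub> f v else \<zero>\<^bsub>C\<^esub>)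
       \<oplus>\<^bsub>C\<^esub> (case p of (u, v) \<Rightarrow> if op u v = m then h u \<otimes>\<^bsub>C\<^esub> g v else \<zero>\<^bsub>C\<^esub>)) (supp h \<times> ?F)"
    using f(1) g(1) h(1) by (intro C.finsum_cong') (auto simp: C.r_distr)
  also have "\<dots> = (h \<otimes>\<^bsub>MR\<^esub> f) m \<oplus>\<^bsub>C\<^esub> (h \<otimes>\<^bsub>MR\<^esub> g) m"
    using mult_eval[OF assms(3,1) h(3) F order_refl] mult_eval[OF assms(3,2) h(3) F order_refl]
      f(1) g(1) h(1)
    by (subst C.finsum_addf) auto
  finally show "(h \<otimes>\<^bsub>MR\<^esub> (f \<oplus>\<^bsub>MR\<^esub> g)) m = ((h \<otimes>\<^bsub>MR\<^esub> f) \<oplus>\<^bsub>MR\<^esub> (h \<otimes>\<^bsub>MR\<^esub> g)) m"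
    by (simp add: mring_simps)
qed

lemma mono_mult:
  assumes "a \<in> carrier C" "b \<in> carrier C" "u \<in> M" "v \<in> M"
  shows "mono a u \<otimes>\<^bsub>MR\<^esub> mono b v = mono (a \<otimes>\<^bsub>C\<^esub> b) (op u v)"
proof
  fix m
  have "(mono a u \<otimes>\<^bsub>MR\<^esub> mono b v) m =
     finsum C (\<lambda>(x, y). if op x y = m then mono a u x \<otimes>\<^bsub>C\<^esub> mono b v y else \<zero>\<^bsub>C\<^esub>) ({u} \<times> {v})"
    using assms by (intro mult_eval supp_mono) auto
  then show "(mono a u \<otimes>\<^bsub>MR\<^esub> mono b v) m = mono (a \<otimes>\<^bsub>C\<^esub> b) (op u v) m"
    using assms by (auto simp: mono_def)
qed

lemma mult_assoc:
  assumes f: "f \<in> carrier MR" and g: "g \<in> carrier MR" and h: "h \<in> carrier MR"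
  shows "(f \<otimes>\<^bsub>MR\<^esub> g) \<otimes>\<^bsub>MR\<^esub> h = f \<otimes>\<^bsub>MR\<^esub> (g \<otimes>\<^bsub>MR\<^esub> h)"
  using f
proof (induction f rule: mring_induct)
  case f: (mono a u)
  show ?case using g
  proof (induction g rule: mring_induct)
    case g: (mono b v)
    show ?case using h
    proof (induction h rule: mring_induct)
      case (mono c w)
      then show ?case using f g by (simp add: mono_mult op_assoc C.m_assoc)
    next
      case (add h h')
      then show ?case using f g by (simp add: mult_r_distr mult_closed)
    qed
  next
    case (add g g')
    then show ?case using f h by (simp add: mult_r_distr mult_l_distr mult_closed)
  qed
next
  case (add f f')
  then show ?case using g h by (simp add: mult_l_distr mult_closed)
qed

lemma kalg_mring: "kalg MR"
proof -
  have one: "\<one>\<^bsub>MR\<^esub> \<in> carrier MR" by (auto simp: mring_simps)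
  have l1: "\<one>\<^bsub>MR\<^esub> \<otimes>\<^bsub>MR\<^esub> f = f" if "f \<in> carrier MR" for f
    using that one by (induction f rule: mring_induct) (simp_all add: mring_simps(2) mono_mult mult_r_distr)
  have r1: "f \<otimes>\<^bsub>MR\<^esub> \<one>\<^bsub>MR\<^esub> = f" if "f \<in> carrier MR" for f
    using that one by (induction f rule: mring_induct) (simp_all add: mring_simps(2) mono_mult mult_l_distr)
  have sl: "(c \<odot>\<^bsub>MR\<^esub> f) \<otimes>\<^bsub>MR\<^esub> g = c \<odot>\<^bsub>MR\<^esub> (f \<otimes>\<^bsub>MR\<^esub> g)" 
    if f: "f \<in> carrier MR" and g: "g \<in> carrier MR" for c f g
    using f
  proof (induction f rule: mring_induct)
    case f: (mono a u)
    show ?case using g f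
      by (induction g rule: mring_induct)
         (simp_all add: mono_mult mono_smult mult_r_distr mult_closed MR.smult_r_distr C.smult_mult_l)
  qed (use g in \<open>simp_all add: mult_l_distr mult_closed MR.smult_r_distr\<close>)
  have sr: "f \<otimes>\<^bsub>MR\<^esub> (c \<odot>\<^bsub>MR\<^esub> g) = c \<odot>\<^bsub>MR\<^esub> (f \<otimes>\<^bsub>MR\<^esub> g)" 
    if f: "f \<in> carrier MR" and g: "g \<in> carrier MR" for c f g
    using f
  proof (induction f rule: mring_induct)
    case f: (mono a u)
    show ?case using g f
      by (induction g rule: mring_induct)
         (simp_all add: mono_mult mono_smult mult_r_distr mult_closed MR.smult_r_distr C.smult_mult_r)
  qed (use g in \<open>simp_all add: mult_l_distr mult_closed MR.smult_r_distr\<close>)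
  have "ring MR"
    by (intro ringI MR.abelian_group_axioms monoidI)
       (simp_all add: one l1 r1 mult_closed mult_assoc mult_l_distr mult_r_distr)
  then show ?thesis
    by (intro kalg.intro kalg_axioms.intro kmod_mring sl sr)
qed

lemma mult_comm:
  assumes f: "f \<in> carrier MR" and g: "g \<in> carrier MR"
    and "\<And>a b. a \<in> carrier C \<Longrightarrow> b \<in> carrier C \<Longrightarrow> a \<otimes>\<^bsub>C\<^esub> b = b \<otimes>\<^bsub>C\<^esub> a"
    and "\<And>u v. u \<in> M \<Longrightarrow> v \<in> M \<Longrightarrow> op u v = op v u"
  shows "f \<otimes>\<^bsub>MR\<^esub> g = g \<otimes>\<^bsub>MR\<^esub> f"
  using f
proof (induction f rule: mring_induct)
  case f: (mono a u)
  show ?case using g f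
  proof (induction g rule: mring_induct)
    case (mono b v)
    then show ?case using assms(3)[of a b] assms(4)[of u v] by (simp add: mono_mult)
  qed (simp_all add: mult_r_distr mult_l_distr)
qed (use g in \<open>simp_all add: mult_l_distr mult_r_distr\<close>)

text \<open>As an additive group the monoid algebra is a direct sum of copies of C indexed by M;
  this is the map out of the direct sum assembled from its components \<open>h m\<close>.\<close>

definition lin_ext :: "('n, 'z) ring_scheme \<Rightarrow> ('m \<Rightarrow> 'c \<Rightarrow> 'n) \<Rightarrow> ('m \<Rightarrow> 'c) \<Rightarrow> 'n" where
  "lin_ext N h f = finsum N (\<lambda>m. h m (f m)) (supp f)"

lemma lin_ext:
  assumes N: "abelian_group N" and h: "\<And>m. m \<in> M \<Longrightarrow> additive_map C N (h m)"
  shows lin_ext_additive: "additive_map MR N (lin_ext N h)"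
    and lin_ext_mono: "a \<in> carrier C \<Longrightarrow> m \<in> M \<Longrightarrow> lin_ext N h (mono a m) = h m a"
proof -
  interpret N: abelian_group N by fact
  have hz: "h m \<zero>\<^bsub>C\<^esub> = \<zero>\<^bsub>N\<^esub>" if "m \<in> M" for m
    using additive_map_zero[OF C.abelian_group_axioms N h[OF that]] .
  have hc: "h m a \<in> carrier N" if "m \<in> M" "a \<in> carrier C" for m a
    using h[OF that(1)] that(2) by (auto simp: additive_map_def)
  have ext: "lin_ext N h f = finsum N (\<lambda>m. h m (f m)) F"
    if "f \<in> carrier MR" "finite F" "supp f \<subseteq> F" "F \<subseteq> M" for f F
    unfolding lin_ext_def using that carrierD[OF that(1)] hz hc
    by (intro N.add.finprod_mono_neutral_cong_left) (auto simp: Pi_def subset_iff)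
  show "additive_map MR N (lin_ext N h)"
    unfolding additive_map_def
  proof (intro conjI ballI)
    show "lin_ext N h \<in> carrier MR \<rightarrow> carrier N"
      unfolding lin_ext_def using carrierD hc by (intro Pi_I N.finsum_closed) blast
    fix f g assume fg: "f \<in> carrier MR" "g \<in> carrier MR"
    note f = carrierD[OF fg(1)] note g = carrierD[OF fg(2)]
    let ?F = "supp f \<union> supp g"
    have s: "supp (f \<oplus>\<^bsub>MR\<^esub> g) \<subseteq> ?F" by (auto simp: mring_simps supp_def)
    have F: "finite ?F" "?F \<subseteq> M" using f g by auto
    have "lin_ext N h (f \<oplus>\<^bsub>MR\<^esub> g) = finsum N (\<lambda>m. h m (f m) \<oplus>\<^bsub>N\<^esub> h m (g m)) ?F"
      unfolding ext[OF MR.a_closed[OF fg] F(1) s F(2)]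
    proof (rule N.finsum_cong')
      show "h i ((f \<oplus>\<^bsub>MR\<^esub> g) i) = h i (f i) \<oplus>\<^bsub>N\<^esub> h i (g i)" if "i \<in> ?F" for i
        using h[of i] that F(2) f(1) g(1) by (auto simp: additive_map_def mring_simps)
    qed (use F(2) f(1) g(1) hc in auto)
    also have "\<dots> = finsum N (\<lambda>m. h m (f m)) ?F \<oplus>\<^bsub>N\<^esub> finsum N (\<lambda>m. h m (g m)) ?F"
      using F(2) f(1) g(1) hc by (intro N.finsum_addf) auto
    finally show "lin_ext N h (f \<oplus>\<^bsub>MR\<^esub> g) = lin_ext N h f \<oplus>\<^bsub>N\<^esub> lin_ext N h g"
      using ext[OF fg(1) F(1) _ F(2)] ext[OF fg(2) F(1) _ F(2)] by simp
  qed
  assume a: "a \<in> carrier C" "m \<in> M"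
  have "lin_ext N h (mono a m) = finsum N (\<lambda>x. h x (mono a m x)) {m}"
    using a by (intro ext supp_mono) auto
  then show "lin_ext N h (mono a m) = h m a" using hc a by (simp add: mono_def)
qed

end

section \<open>Quotients, representations and bases\<close>

lemma (in kalg) ideal_smult:
  assumes "ideal I A" "x \<in> I"
  shows "c \<odot> x \<in> I"
proof -
  interpret I: ideal I A by fact
  have "x \<in> carrier A" using assms(2) I.a_subset by auto
  then show ?thesis using I.I_l_closed[OF assms(2), of "c \<odot> \<one>"] by (simp add: smult_one_mult)
qed

locale kalg_quotient = kalg A + I: ideal I A for A :: "('k::field, 'a) module" (structure) and I
begin

abbreviation proj where "proj \<equiv> a_r_coset A I"

lemma proj_eq_iff: "a \<in> carrier A \<Longrightarrow> b \<in> carrier A \<Longrightarrow> proj a = proj b \<longleftrightarrow> a \<ominus> b \<in> I"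
  using quotient_eq_iff_same_a_r_cos[OF I.ideal_axioms] by simp

lemma carrier_kquot: "carrier (kquot A I) = proj ` carrier A"
  by (auto simp: kquot_def FactRing_def A_RCOSETS_def')

text \<open>In \<open>kquot\<close> a scalar acts on a coset by a union over all its members. Ideals
  are stable under scalars, so every member contributes the same coset and the union
  collapses.\<close>

lemma proj_smult:
  assumes "a \<in> carrier A"
  shows "c \<odot>\<^bsub>kquot A I\<^esub> proj a = proj (c \<odot> a)"
proof -
  have "proj (c \<odot> x) = proj (c \<odot> a)" if x: "x \<in> proj a" for x
  proof -
    have xc: "x \<in> carrier A" using x a_r_coset_subset_G[OF I.a_subset assms] by blast
    have "proj x = proj a" using I.a_repr_independence'[OF x assms] by simp
    then have "c \<odot> (x \<ominus> a) \<in> I" using proj_eq_iff[OF xc assms] ideal_smult[OF I.ideal_axioms] by blast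
    then have "(c \<odot> x) \<ominus> (c \<odot> a) \<in> I"
      using xc assms by (simp add: a_minus_def smult_r_distr smult_r_minus)
    then show ?thesis using xc assms by (simp add: proj_eq_iff)
  qed
  then have "(\<Union>x\<in>proj a. proj (c \<odot> x)) = proj (c \<odot> a)"
    using I.a_rcos_self[OF assms] by blast
  then show ?thesis by (simp add: kquot_def)
qed

lemma proj_hom: "proj \<in> kalg_hom A (kquot A I)"
proof (rule kalg_homI)
  show "proj x \<in> carrier (kquot A I)" if "x \<in> carrier A" for x
    using that by (simp add: carrier_kquot)
  show "proj (x \<oplus> y) = proj x \<oplus>\<^bsub>kquot A I\<^esub> proj y" if "x \<in> carrier A" "y \<in> carrier A" for x y
    using that by (simp add: kquot_def FactRing_def I.a_rcos_sum)
  show "proj (x \<otimes> y) = proj x \<otimes>\<^bsub>kquot A I\<^esub> proj y" if "x \<in> carrier A" "y \<in> carrier A" for x y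
    using that by (simp add: kquot_def FactRing_def I.rcoset_mult_add)
  show "proj \<one> = \<one>\<^bsub>kquot A I\<^esub>" by (simp add: kquot_def FactRing_def)
  show "proj (c \<odot> x) = c \<odot>\<^bsub>kquot A I\<^esub> proj x" if "x \<in> carrier A" for c x
    using that by (simp add: proj_smult)
qed

lemma kalg_kquot: "kalg (kquot A I)"
proof -
  note p = kalg_homD[OF proj_hom]
  interpret Q: ring "A Quot I" by (rule I.quotient_is_ring)
  have s: "carrier (kquot A I) = carrier (A Quot I)" "\<zero>\<^bsub>kquot A I\<^esub> = \<zero>\<^bsub>A Quot I\<^esub>"
    "\<one>\<^bsub>kquot A I\<^esub> = \<one>\<^bsub>A Quot I\<^esub>" "x \<oplus>\<^bsub>kquot A I\<^esub> y = x \<oplus>\<^bsub>A Quot I\<^esub> y"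
    "x \<otimes>\<^bsub>kquot A I\<^esub> y = x \<otimes>\<^bsub>A Quot I\<^esub> y" for x y
    by (simp_all add: kquot_def)
  have "abelian_group (kquot A I)"
    by (rule abelian_groupI)
       (auto simp: s Q.a_ac intro: bexI[of _ "\<ominus>\<^bsub>A Quot I\<^esub> x" for x] Q.l_neg)
  then have r: "ring (kquot A I)"
    by (intro ringI monoidI) (auto simp: s Q.m_assoc Q.l_distr Q.r_distr)
  have [simp]: "proj a \<in> carrier (kquot A I)" if "a \<in> carrier A" for a using that p by simp
  show ?thesis
  proof (intro kalg.intro kmod.intro r kmod_axioms.intro kalg_axioms.intro ring.is_abelian_group)
    fix U assume "U \<in> carrier (kquot A I)"
    then obtain a where a: "a \<in> carrier A" "U = proj a" by (auto simp: carrier_kquot)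
    show "c \<odot>\<^bsub>kquot A I\<^esub> U \<in> carrier (kquot A I)"
      "(c + d) \<odot>\<^bsub>kquot A I\<^esub> U = (c \<odot>\<^bsub>kquot A I\<^esub> U) \<oplus>\<^bsub>kquot A I\<^esub> (d \<odot>\<^bsub>kquot A I\<^esub> U)"
      "c \<odot>\<^bsub>kquot A I\<^esub> (d \<odot>\<^bsub>kquot A I\<^esub> U) = (c * d) \<odot>\<^bsub>kquot A I\<^esub> U"
      "1 \<odot>\<^bsub>kquot A I\<^esub> U = U" for c d
      using a by (simp_all add: proj_smult smult_l_distr smult_smult p(3))
    fix W assume "W \<in> carrier (kquot A I)"
    then obtain b where b: "b \<in> carrier A" "W = proj b" by (auto simp: carrier_kquot)
    show "c \<odot>\<^bsub>kquot A I\<^esub> (U \<oplus>\<^bsub>kquot A I\<^esub> W) = (c \<odot>\<^bsub>kquot A I\<^esub> U) \<oplus>\<^bsub>kquot A I\<^esub> (c \<odot>\<^bsub>kquot A I\<^esub> W)"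
      "(c \<odot>\<^bsub>kquot A I\<^esub> U) \<otimes>\<^bsub>kquot A I\<^esub> W = c \<odot>\<^bsub>kquot A I\<^esub> (U \<otimes>\<^bsub>kquot A I\<^esub> W)"
      "U \<otimes>\<^bsub>kquot A I\<^esub> (c \<odot>\<^bsub>kquot A I\<^esub> W) = c \<odot>\<^bsub>kquot A I\<^esub> (U \<otimes>\<^bsub>kquot A I\<^esub> W)" for c
      using a b by (simp_all add: proj_smult smult_r_distr smult_mult_l smult_mult_r
          p(3)[symmetric] p(4)[symmetric])
  qed
qed

end

text \<open>Linear operators multiplicative on M extend to an action of the monoid algebra. Such
  actions are how elements of a quotient by generated relations are shown to be nonzero: an action
  that kills the relations descends to the quotient.\<close>

locale monoid_rep = monoid_alg "K_alg :: ('k::field, 'k) module" M op e + N: kmod N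
  for M :: "'m set" and op e and N :: "('k::field, 'n) module" +
  fixes rho :: "'m \<Rightarrow> 'n \<Rightarrow> 'n"
  assumes rho_closed: "m \<in> M \<Longrightarrow> w \<in> carrier N \<Longrightarrow> rho m w \<in> carrier N"
    and rho_add: "m \<in> M \<Longrightarrow> w \<in> carrier N \<Longrightarrow> w' \<in> carrier N \<Longrightarrow>
      rho m (w \<oplus>\<^bsub>N\<^esub> w') = rho m w \<oplus>\<^bsub>N\<^esub> rho m w'"
    and rho_smult: "m \<in> M \<Longrightarrow> w \<in> carrier N \<Longrightarrow> rho m (c \<odot>\<^bsub>N\<^esub> w) = c \<odot>\<^bsub>N\<^esub> rho m w"
    and rho_op: "u \<in> M \<Longrightarrow> v \<in> M \<Longrightarrow> w \<in> carrier N \<Longrightarrow> rho (op u v) w = rho u (rho v w)"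
begin

definition act :: "('m \<Rightarrow> 'k) \<Rightarrow> 'n \<Rightarrow> 'n" where
  "act f w = lin_ext N (\<lambda>m c. c \<odot>\<^bsub>N\<^esub> rho m w) f"

lemma delta_eq_mono: "delta m = mono 1 m"
  by (auto simp: delta_def mono_def)

lemma rho_additive:
  "m \<in> M \<Longrightarrow> w \<in> carrier N \<Longrightarrow> additive_map K_alg N (\<lambda>c. c \<odot>\<^bsub>N\<^esub> rho m w)"
  using rho_closed by (auto simp: additive_map_def N.smult_l_distr)

lemma act_additive: "w \<in> carrier N \<Longrightarrow> additive_map MR N (\<lambda>f. act f w)"
  unfolding act_def using lin_ext_additive[OF N.abelian_group_axioms rho_additive] by simp

lemma act_closed [simp]: "f \<in> carrier MR \<Longrightarrow> w \<in> carrier N \<Longrightarrow> act f w \<in> carrier N"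
  using act_additive by (auto simp: additive_map_def)

lemma act_add: "f \<in> carrier MR \<Longrightarrow> g \<in> carrier MR \<Longrightarrow> w \<in> carrier N \<Longrightarrow>
    act (f \<oplus>\<^bsub>MR\<^esub> g) w = act f w \<oplus>\<^bsub>N\<^esub> act g w"
  using act_additive by (auto simp: additive_map_def)

lemma act_mono: "m \<in> M \<Longrightarrow> w \<in> carrier N \<Longrightarrow> act (mono a m) w = a \<odot>\<^bsub>N\<^esub> rho m w"
  unfolding act_def using lin_ext_mono[OF N.abelian_group_axioms rho_additive] by simp

lemma act_delta: "m \<in> M \<Longrightarrow> w \<in> carrier N \<Longrightarrow> act (delta m) w = rho m w"
  by (simp add: delta_eq_mono act_mono rho_closed)

lemma act_smult:
  "f \<in> carrier MR \<Longrightarrow> w \<in> carrier N \<Longrightarrow> act (c \<odot>\<^bsub>MR\<^esub> f) w = c \<odot>\<^bsub>N\<^esub> act f w"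
  by (induction f rule: mring_induct)
     (simp_all add: mono_smult act_mono rho_closed N.smult_smult MR.smult_r_distr N.smult_r_distr act_add)

lemma act_minus:
  assumes "f \<in> carrier MR" "g \<in> carrier MR" "w \<in> carrier N"
  shows "act (f \<ominus>\<^bsub>MR\<^esub> g) w = act f w \<ominus>\<^bsub>N\<^esub> act g w"
proof -
  interpret abelian_group_hom MR N "\<lambda>f. act f w"
    by (intro additive_map_abelian_group_hom act_additive assms MR.abelian_group_axioms N.abelian_group_axioms)
  show ?thesis using assms by (simp add: a_minus_def)
qed

lemma act_arg_add:
  "f \<in> carrier MR \<Longrightarrow> w \<in> carrier N \<Longrightarrow> w' \<in> carrier N \<Longrightarrow>
    act f (w \<oplus>\<^bsub>N\<^esub> w') = act f w \<oplus>\<^bsub>N\<^esub> act f w'"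
  by (induction f rule: mring_induct)
     (simp_all add: act_mono act_add rho_add rho_closed N.smult_r_distr N.a_ac)

lemma act_arg_smult:
  "f \<in> carrier MR \<Longrightarrow> w \<in> carrier N \<Longrightarrow> act f (c \<odot>\<^bsub>N\<^esub> w) = c \<odot>\<^bsub>N\<^esub> act f w"
  by (induction f rule: mring_induct)
     (simp_all add: act_mono act_add rho_smult rho_closed N.smult_smult N.smult_r_distr mult.commute)

lemma act_arg_zero: "f \<in> carrier MR \<Longrightarrow> act f \<zero>\<^bsub>N\<^esub> = \<zero>\<^bsub>N\<^esub>"
  using act_arg_smult[of f "\<zero>\<^bsub>N\<^esub>" 0] by simp

lemma act_mult:
  assumes f: "f \<in> carrier MR" and g: "g \<in> carrier MR" and w: "w \<in> carrier N"
  shows "act (f \<otimes>\<^bsub>MR\<^esub> g) w = act f (act g w)"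
  using f
proof (induction f rule: mring_induct)
  case f: (mono a u)
  show ?case using g
  proof (induction g rule: mring_induct)
    case (mono b v)
    then show ?case using f w
      by (simp add: mono_mult act_mono rho_op rho_closed rho_smult N.smult_smult)
  next
    case (add g g')
    then show ?case using f w by (simp add: mult_r_distr mult_closed act_add act_arg_add)
  qed
next
  case (add f f')
  then show ?case using g w by (simp add: mult_l_distr mult_closed act_add)
qed

text \<open>Since the elements acting as zero form an ideal, checking that generators act as zero
  suffices for the whole ideal they generate.\<close>

lemma act_kernel_ideal: "ideal {f \<in> carrier MR. \<forall>w\<in>carrier N. act f w = \<zero>\<^bsub>N\<^esub>} MR" (is "ideal ?J _")
proof -
  interpret MK: kalg MR by (rule kalg_mring)
  have z: "act \<zero>\<^bsub>MR\<^esub> w = \<zero>\<^bsub>N\<^esub>" if "w \<in> carrier N" for w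
    using act_smult[of "\<zero>\<^bsub>MR\<^esub>" w 0] that by simp
  show ?thesis
  proof (rule idealI)
    show "subgroup ?J (add_monoid MR)"
    proof (rule group.subgroupI[OF MR.a_group])
      show "?J \<noteq> {}" using z by auto
      show "inv\<^bsub>add_monoid MR\<^esub> a \<in> ?J" if "a \<in> ?J" for a
        using that act_minus[of "\<zero>\<^bsub>MR\<^esub>" a] z by (auto simp: a_minus_def a_inv_def[symmetric])
    qed (auto simp: act_add)
  qed (use MK.ring_axioms in \<open>auto simp: act_mult act_arg_zero\<close>)
qed

end

section \<open>Bases and coordinate functionals\<close>

definition linear_functional :: "('k::field, 'a) module \<Rightarrow> ('a \<Rightarrow> 'k) \<Rightarrow> bool" where
  "linear_functional A \<rho> \<longleftrightarrow> (\<forall>x\<in>carrier A. \<forall>y\<in>carrier A. \<rho> (x \<oplus>\<^bsub>A\<^esub> y) = \<rho> x + \<rho> y) \<and>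
     (\<forall>c. \<forall>x\<in>carrier A. \<rho> (c \<odot>\<^bsub>A\<^esub> x) = c * \<rho> x)"

context kmod begin

definition is_basis :: "'a set \<Rightarrow> bool" where
  "is_basis E \<longleftrightarrow> E \<subseteq> carrier A \<and> lin_indep (\<lambda>x. x) E \<and> lspan (\<lambda>x. x) E = carrier A"

lemma lin_indepI_finite:
  assumes "finite P" "h \<in> P \<rightarrow> carrier A"
    "\<And>c. lincomb h c P = \<zero> \<Longrightarrow> \<forall>i\<in>P. c i = 0"
  shows "lin_indep h P"
  unfolding lin_indep_def
proof (intro allI impI ballI; elim conjE)
  fix c F i assume F: "F \<subseteq> P" "lincomb h c F = \<zero>" "i \<in> F"
  have "lincomb h (\<lambda>i. if i \<in> F then c i else 0) P = \<zero>"
    using lincomb_extend[OF assms(1) F(1) assms(2), of c] F(2) by simp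
  from assms(3)[OF this] show "c i = 0" using F by (auto split: if_splits)
qed

lemma lin_indep_unique:
  assumes "lin_indep h P" "finite F" "F \<subseteq> P" "h \<in> P \<rightarrow> carrier A" "lincomb h c F = lincomb h d F" "i \<in> F"
  shows "c i = d i"
proof -
  have h: "h \<in> F \<rightarrow> carrier A" using assms by auto
  have "lincomb h (\<lambda>i. c i + (- 1) * d i) F = lincomb h c F \<oplus> (- 1) \<odot> lincomb h d F"
    by (simp only: lincomb_smult[OF h] lincomb_add[OF h])
  also have "\<dots> = \<zero>" using h assms(5) by (simp add: smult_l_minus r_neg)
  finally show ?thesis using assms unfolding lin_indep_def by fastforce
qed

lemma ex_basis: "\<exists>E. is_basis E"
proof -
  let ?X = "{E. E \<subseteq> carrier A \<and> lin_indep (\<lambda>x. x) E}"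
  have "\<exists>E\<in>?X. \<forall>E'\<in>?X. E \<subseteq> E' \<longrightarrow> E' = E"
  proof (rule subset_Zorn_nonempty)
    have "{} \<in> ?X" by (auto simp: lin_indep_def)
    then show "?X \<noteq> {}" by blast
    fix \<C> assume C: "\<C> \<noteq> {}" "subset.chain ?X \<C>"
    \<comment> \<open>A relation involves finitely many vectors, so within the union of a chain it
      already lives in one member.\<close>
    have "\<forall>i\<in>F. c i = 0" if F: "finite F" "F \<subseteq> \<Union>\<C>" "lincomb (\<lambda>x. x) c F = \<zero>" for c F
    proof -
      obtain E where "E \<in> \<C>" "F \<subseteq> E"
        using finite_subset_Union_chain[OF F(1,2) C] by blast
      then show ?thesis using C(2) F unfolding lin_indep_def subset.chain_def by blast
    qed
    then have "lin_indep (\<lambda>x. x) (\<Union>\<C>)" unfolding lin_indep_def by blast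
    then show "\<Union>\<C> \<in> ?X" using C(2) unfolding subset.chain_def by blast
  qed
  then obtain E where E0: "E \<in> ?X" and max0: "\<forall>E'\<in>?X. E \<subseteq> E' \<longrightarrow> E' = E" by (rule bexE)
  from E0 have E: "E \<subseteq> carrier A" "lin_indep (\<lambda>x. x) E" by simp_all
  from max0 have max: "E' = E" if "E' \<subseteq> carrier A" "lin_indep (\<lambda>x. x) E'" "E \<subseteq> E'" for E'
    using that by simp
  have id: "(\<lambda>x. x) \<in> F \<rightarrow> carrier A" if "F \<subseteq> carrier A" for F using that by auto
  have "r \<in> lspan (\<lambda>x. x) E" if r: "r \<in> carrier A" for r
  proof (rule ccontr)
    assume n: "r \<notin> lspan (\<lambda>x. x) E"
    have rE: "r \<notin> E" using n lspan_base[of r E "\<lambda>x. x"] r by auto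
    have "lin_indep (\<lambda>x. x) (insert r E)"
      unfolding lin_indep_def
    proof (intro allI impI; elim conjE)
      fix c F assume F: "finite F" "F \<subseteq> insert r E" "lincomb (\<lambda>x. x) c F = \<zero>"
      have G: "finite (F - {r})" "F - {r} \<subseteq> E" using F by auto
      have Gc: "(\<lambda>x. x) \<in> F - {r} \<rightarrow> carrier A" using G E by auto
      have Fc: "(\<lambda>x. x) \<in> insert r (F - {r}) \<rightarrow> carrier A" using Gc r by auto
      let ?g = "lincomb (\<lambda>x. x) c (F - {r})"
      have g: "?g \<in> lspan (\<lambda>x. x) E" unfolding lspan_def using G by blast
      have "lincomb (\<lambda>x. x) c F = lincomb (\<lambda>x. x) (\<lambda>i. if i \<in> F then c i else 0) (insert r (F - {r}))"
        using F(1) by (intro lincomb_extend Fc) auto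
      also have "\<dots> = ((if r \<in> F then c r else 0) \<odot> r) \<oplus> lincomb (\<lambda>x. x) (\<lambda>i. if i \<in> F then c i else 0) (F - {r})"
        unfolding lincomb_def using G(1) Gc r by (subst finsum_insert) (auto simp: Pi_def)
      also have "lincomb (\<lambda>x. x) (\<lambda>i. if i \<in> F then c i else 0) (F - {r}) = ?g"
        unfolding lincomb_def using Gc by (intro finsum_cong') auto
      finally have eq: "((if r \<in> F then c r else 0) \<odot> r) \<oplus> ?g = \<zero>" using F(3) by simp
      \<comment> \<open>A nonzero coefficient at \<open>r\<close> would allow solving for
        \<open>r\<close>, placing it in the span of \<open>E\<close>.\<close>
      have "r \<in> F \<Longrightarrow> c r = 0"
      proof (rule ccontr)
        assume c: "r \<in> F" "c r \<noteq> 0"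
        have "\<ominus> ?g = c r \<odot> r"
          by (rule minus_equality) (use eq c(1) r Gc in \<open>simp_all add: lincomb_closed\<close>)
        then have "inverse (c r) \<odot> (c r \<odot> r) = inverse (c r) \<odot> ((- 1) \<odot> ?g)"
          by (simp add: smult_l_minus lincomb_closed[OF Gc] flip: \<open>\<ominus> ?g = c r \<odot> r\<close>)
        then have "r = inverse (c r) \<odot> ((- 1) \<odot> ?g)" using c(2) r by (simp add: smult_smult)
        moreover have "inverse (c r) \<odot> ((- 1) \<odot> ?g) \<in> lspan (\<lambda>x. x) E"
          by (intro lspan_smult g id E)
        ultimately show False using n by simp
      qed
      moreover from this have "?g = \<zero>" using eq Gc r by (auto split: if_splits)
      then have "\<forall>i\<in>F - {r}. c i = 0" using E(2) G unfolding lin_indep_def by blast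
      ultimately show "\<forall>i\<in>F. c i = 0" by blast
    qed
    then have "insert r E = E" using E(1) r by (intro max) auto
    then show False using rE by blast
  qed
  then have "lspan (\<lambda>x. x) E = carrier A" using lspan_closed[OF id[OF E(1)]] by blast
  then show ?thesis using E unfolding is_basis_def by blast
qed

lemma dual_functional:
  assumes "is_basis E" "b \<in> E"
  obtains \<rho> where "linear_functional A \<rho>" "\<rho> b = 1" "\<And>e. e \<in> E \<Longrightarrow> e \<noteq> b \<Longrightarrow> \<rho> e = 0"
proof -
  note E = assms(1)[unfolded is_basis_def]
  let ?lc = "lincomb (\<lambda>x. x)"
  have cl: "(\<lambda>x. x) \<in> F \<rightarrow> carrier A" if "F \<subseteq> E" for F using that E by auto
  \<comment> \<open>The coordinate at \<open>b\<close> is introduced as a relation. Demanding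
    \<open>b \<in> F\<close> makes \<open>c b\<close> meaningful also when \<open>b\<close> does not
    occur, in which case the expansion is padded by a zero coefficient.\<close>
  define rep where "rep r v \<longleftrightarrow> (\<exists>c F. finite F \<and> F \<subseteq> E \<and> b \<in> F \<and> r = ?lc c F \<and> v = c b)" for r v
  have ex: "\<exists>v. rep r v" if "r \<in> carrier A" for r
  proof -
    from that have "r \<in> lspan (\<lambda>x. x) E" using E by simp
    then obtain c F where F: "finite F" "F \<subseteq> E" "r = ?lc c F" by (rule lspanE)
    then have "r = ?lc (\<lambda>i. if i \<in> F then c i else 0) (insert b F)"
      using lincomb_extend[of "insert b F" F "\<lambda>x. x" c] cl[of "insert b F"] assms by auto
    then show ?thesis unfolding rep_def using F assms by (metis finite.insertI insertI1 insert_subset)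
  qed
  \<comment> \<open>Any two expansions can be padded to a common finite set; uniqueness and
    additivity of the coordinate both follow from this.\<close>
  have both: "\<exists>c d F. finite F \<and> F \<subseteq> E \<and> b \<in> F \<and> r = ?lc c F \<and> v = c b \<and> s = ?lc d F \<and> w = d b"
    if "rep r v" "rep s w" for r s v w
  proof -
    from that obtain c F d G where *: "finite F" "F \<subseteq> E" "b \<in> F" "r = ?lc c F" "v = c b"
      "finite G" "G \<subseteq> E" "b \<in> G" "s = ?lc d G" "w = d b" unfolding rep_def by blast
    have "r = ?lc (\<lambda>i. if i \<in> F then c i else 0) (F \<union> G)" "s = ?lc (\<lambda>i. if i \<in> G then d i else 0) (F \<union> G)"
      using * lincomb_extend[of "F \<union> G" F "\<lambda>x. x" c] lincomb_extend[of "F \<union> G" G "\<lambda>x. x" d]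
        cl[of "F \<union> G"] by auto
    then show ?thesis using *
      by (intro exI[of _ "\<lambda>i. if i \<in> F then c i else 0"] exI[of _ "\<lambda>i. if i \<in> G then d i else 0"]
          exI[of _ "F \<union> G"]) auto
  qed
  have uniq: "v = w" if "rep r v" "rep r w" for r v w
    using both[OF that] lin_indep_unique[of "\<lambda>x. x" E] E cl[of E] by (metis order_refl)
  define \<rho> where "\<rho> r = (SOME v. rep r v)" for r
  have rep: "rep r (\<rho> r)" if "r \<in> carrier A" for r
    unfolding \<rho>_def using ex[OF that] by (rule someI_ex)
  have \<rho>I: "\<rho> r = v" if "rep r v" "r \<in> carrier A" for r v using uniq rep that by blast
  show ?thesis
  proof (rule that)
    show "linear_functional A \<rho>" unfolding linear_functional_def
    proof (intro conjI ballI allI)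
      fix x y assume x: "x \<in> carrier A" and y: "y \<in> carrier A"
      obtain c d F where *: "finite F" "F \<subseteq> E" "b \<in> F" "x = ?lc c F" "\<rho> x = c b" "y = ?lc d F" "\<rho> y = d b"
        using both[OF rep[OF x] rep[OF y]] by blast
      then have "rep (x \<oplus> y) (\<rho> x + \<rho> y)" unfolding rep_def using lincomb_add[OF cl[OF *(2)]]
        by (intro exI[of _ "\<lambda>i. c i + d i"] exI[of _ F]) simp
      then show "\<rho> (x \<oplus> y) = \<rho> x + \<rho> y" using x y by (intro \<rho>I) auto
    next
      fix c x assume x: "x \<in> carrier A"
      obtain d F where *: "finite F" "F \<subseteq> E" "b \<in> F" "x = ?lc d F" "\<rho> x = d b"
        using rep[OF x] unfolding rep_def by blast
      then have "rep (c \<odot> x) (c * \<rho> x)" unfolding rep_def using lincomb_smult[OF cl[OF *(2)]]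
        by (intro exI[of _ "\<lambda>i. c * d i"] exI[of _ F]) simp
      then show "\<rho> (c \<odot> x) = c * \<rho> x" using x by (intro \<rho>I) auto
    qed
    have b: "b \<in> carrier A" using E assms by auto
    have "rep b 1" unfolding rep_def using b assms
      by (intro exI[of _ "\<lambda>_. 1"] exI[of _ "{b}"]) (simp add: lincomb_def)
    then show "\<rho> b = 1" using b by (rule \<rho>I)
    show "\<rho> e = 0" if e: "e \<in> E" "e \<noteq> b" for e
    proof (rule \<rho>I)
      show ec: "e \<in> carrier A" using E e by auto
      show "rep e 0" unfolding rep_def using b ec e assms
        by (intro exI[of _ "\<lambda>i. if i = e then 1 else 0"] exI[of _ "{b, e}"]) (auto simp: lincomb_def Pi_def)
    qed
  qed
qed

end

section \<open>Growth of finitely generated commutative algebras\<close>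

text \<open>Gaussian elimination on a homogeneous system with one equation for each element of Q and
  one unknown for each element of P, by induction on the equations.\<close>

lemma nontrivial_kernel_if_more_columns:
  fixes M :: "'p \<Rightarrow> 'q \<Rightarrow> 'k::field"
  assumes "finite Q" "finite P" "card Q < card P"
  shows "\<exists>c. (\<exists>p\<in>P. c p \<noteq> 0) \<and> (\<forall>q\<in>Q. (\<Sum>p\<in>P. c p * M p q) = 0)"
  using assms
proof (induction Q arbitrary: P M rule: finite_induct)
  case empty
  then have "P \<noteq> {}" by auto
  then show ?case by (intro exI[of _ "\<lambda>_. 1"]) auto
next
  case (insert q Q)
  show ?case
  proof (cases "\<forall>p\<in>P. M p q = 0")
    case True
    have "card Q < card P" using insert by simp
    from insert.IH[OF insert.prems(1) this, of M] obtain c where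
      "\<exists>p\<in>P. c p \<noteq> 0" "\<forall>q\<in>Q. (\<Sum>p\<in>P. c p * M p q) = 0" by blast
    then show ?thesis using True by (intro exI[of _ c]) auto
  next
    case False
    then obtain r where r: "r \<in> P" "M r q \<noteq> 0" by blast
    \<comment> \<open>The unknown at the pivot \<open>r\<close> is eliminated with the help of
      equation \<open>q\<close>.\<close>
    let ?P = "P - {r}" and ?M = "\<lambda>p x. M p x - M p q / M r q * M r x"
    have "finite ?P" "card Q < card ?P" using insert r by (auto simp: card_Diff_singleton)
    from insert.IH[OF this, of ?M] obtain c where
      c: "\<exists>p\<in>?P. c p \<noteq> 0" "\<forall>x\<in>Q. (\<Sum>p\<in>?P. c p * ?M p x) = 0" by blast
    \<comment> \<open>The value at \<open>r\<close> is the one that solves equation \<open>q\<close>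
      for the eliminated unknown.\<close>
    define d where "d = c(r := - (\<Sum>p\<in>?P. c p * (M p q / M r q)))"
    have sum: "(\<Sum>p\<in>P. d p * M p x) = (\<Sum>p\<in>?P. c p * ?M p x)" for x
    proof -
      have "(\<Sum>p\<in>P. d p * M p x) = d r * M r x + (\<Sum>p\<in>?P. d p * M p x)"
        using r insert.prems(1) by (simp add: sum.remove)
      also have "(\<Sum>p\<in>?P. d p * M p x) = (\<Sum>p\<in>?P. c p * M p x)"
        by (rule sum.cong) (auto simp: d_def)
      also have "d r * M r x = - (\<Sum>p\<in>?P. c p * (M p q / M r q) * M r x)"
        by (simp add: d_def sum_distrib_right)
      finally show ?thesis by (simp add: right_diff_distrib sum_subtractf mult.assoc)
    qed
    have "(\<Sum>p\<in>P. d p * M p q) = 0" unfolding sum using r by (intro sum.neutral) auto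
    moreover have "\<exists>p\<in>P. d p \<noteq> 0" using c(1) by (auto simp: d_def)
    ultimately show ?thesis using c(2) sum by (intro exI[of _ d]) auto
  qed
qed

text \<open>Writing each \<open>h p\<close> in terms of \<open>v\<close> turns a relation into a
  homogeneous system with fewer equations than unknowns.\<close>

lemma (in kmod) not_lin_indep_if_card:
  assumes "finite P" "finite Q" "v \<in> Q \<rightarrow> carrier A" "\<And>p. p \<in> P \<Longrightarrow> h p \<in> lspan v Q"
    "card Q < card P"
  shows "\<not> lin_indep h P"
proof
  assume ind: "lin_indep h P"
  have "\<forall>p\<in>P. \<exists>c. h p = lincomb v c Q"
    using assms lspanE_finite by metis
  then obtain M where M: "\<And>p. p \<in> P \<Longrightarrow> h p = lincomb v (M p) Q" by metis
  obtain c where c: "\<exists>p\<in>P. c p \<noteq> 0" "\<forall>q\<in>Q. (\<Sum>p\<in>P. c p * M p q) = 0"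
    using nontrivial_kernel_if_more_columns[OF assms(2,1,5), of M] by blast
  have "lincomb h c P = (\<Oplus>p\<in>P. \<Oplus>q\<in>Q. (c p * M p q) \<odot> v q)"
    unfolding lincomb_def
  proof (rule finsum_cong')
    show "c p \<odot> h p = (\<Oplus>q\<in>Q. (c p * M p q) \<odot> v q)" if "p \<in> P" for p
      using M[OF that] lincomb_smult[OF assms(3), of "c p" "M p"] by (simp add: lincomb_def)
  qed (use assms(3) in \<open>auto intro!: finsum_closed\<close>)
  also have "\<dots> = (\<Oplus>q\<in>Q. \<Oplus>p\<in>P. (c p * M p q) \<odot> v q)"
    using assms by (intro finsum_swap) auto
  also have "\<dots> = \<zero>"
  proof (rule add.finprod_one_eqI)
    fix q assume q: "q \<in> Q"
    then have "(\<Oplus>p\<in>P. (c p * M p q) \<odot> v q) = (\<Sum>p\<in>P. c p * M p q) \<odot> v q"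
      using assms by (subst smult_sum) auto
    then show "(\<Oplus>p\<in>P. (c p * M p q) \<odot> v q) = \<zero>" using c(2) q assms(3) by (simp add: Pi_iff)
  qed
  finally show False using ind c(1) assms(1) unfolding lin_indep_def by blast
qed

text \<open>Exponents are bounded one by one rather than in total, which makes the number of
  exponent vectors an exact power.\<close>

definition box :: "nat \<Rightarrow> nat \<Rightarrow> nat list set" where
  "box m N = {es. set es \<subseteq> {..N} \<and> length es = m}"

lemma finite_box: "finite (box m N)" and card_box: "card (box m N) = (N + 1) ^ m"
  unfolding box_def by (simp_all add: finite_lists_length_eq card_lists_length_eq)

lemma box_0: "box 0 N = {[]}"
  by (auto simp: box_def)

lemma box_Suc: "box (Suc m) N = (\<lambda>(j, es). j # es) ` ({..N} \<times> box m N)"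
proof
  show "box (Suc m) N \<subseteq> (\<lambda>(j, es). j # es) ` ({..N} \<times> box m N)"
  proof
    fix es assume es: "es \<in> box (Suc m) N"
    then obtain j fs where "es = j # fs" by (cases es) (auto simp: box_def)
    then show "es \<in> (\<lambda>(j, es). j # es) ` ({..N} \<times> box m N)" using es by (auto simp: box_def)
  qed
qed (auto simp: box_def)

section \<open>Monomials and the filtration of a finitely generated commutative algebra\<close>

locale comm_kalg = kalg A + cring A for A :: "('k::field, 'a) module" (structure)
begin

fun mon :: "'a list \<Rightarrow> nat list \<Rightarrow> 'a" where
  "mon (s # ss) (j # es) = (s [^] j) \<otimes> mon ss es"
| "mon _ _ = \<one>"

text \<open>A filtration of the subalgebra generated by \<open>ss\<close>, compatible with products,
  whose N-th piece has dimension at most (N+1) to the power \<open>length ss\<close>.\<close>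

definition V :: "'a list \<Rightarrow> nat \<Rightarrow> 'a set" where
  "V ss N = lspan (mon ss) (box (length ss) N)"

lemma mon_closed [simp]: "set ss \<subseteq> carrier A \<Longrightarrow> mon ss es \<in> carrier A"
  by (induction ss es rule: mon.induct) auto

lemma mon_funcset: "set ss \<subseteq> carrier A \<Longrightarrow> mon ss \<in> P \<rightarrow> carrier A"
  by auto

lemma mon_mult:
  "set ss \<subseteq> carrier A \<Longrightarrow> length es = length ss \<Longrightarrow> length fs = length ss \<Longrightarrow>
    mon ss es \<otimes> mon ss fs = mon ss (map2 (+) es fs)"
proof (induction ss arbitrary: es fs)
  case (Cons s ss)
  from Cons.prems obtain j es' where es: "es = j # es'" by (cases es) auto
  from Cons.prems obtain k fs' where fs: "fs = k # fs'" by (cases fs) auto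
  have "(s [^] j \<otimes> mon ss es') \<otimes> (s [^] k \<otimes> mon ss fs') = (s [^] j \<otimes> s [^] k) \<otimes> (mon ss es' \<otimes> mon ss fs')"
    using Cons.prems by (simp add: m_ac)
  then show ?case using Cons es fs by (simp add: nat_pow_mult)
qed simp

lemma box_map2: "es \<in> box m N \<Longrightarrow> fs \<in> box m N' \<Longrightarrow> map2 (+) es fs \<in> box m (N + N')"
  unfolding box_def by (auto simp: set_zip) (metis add_mono nth_mem atMost_iff subsetD)

lemma V_closed: "set ss \<subseteq> carrier A \<Longrightarrow> V ss N \<subseteq> carrier A"
  unfolding V_def by (intro lspan_closed mon_funcset)

lemma V_mono: "N \<le> N' \<Longrightarrow> V ss N \<subseteq> V ss N'"
proof -
  assume "N \<le> N'"
  then have "box (length ss) N \<subseteq> box (length ss) N'" by (auto simp: box_def)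
  then show ?thesis unfolding V_def lspan_def by blast
qed

text \<open>Exponents of monomials add up. The passage from monomials to spans is made for the right
  factor against a fixed monomial, and afterwards for the left factor.\<close>

lemma V_mult:
  assumes ss: "set ss \<subseteq> carrier A" and x: "x \<in> V ss N" and y: "y \<in> V ss N'"
  shows "x \<otimes> y \<in> V ss (N + N')"
proof -
  note f = mon_funcset[OF ss]
  have add: "u \<oplus> v \<in> V ss K" if "u \<in> V ss K" "v \<in> V ss K" for u v K
    using that lspan_add[OF _ _ f] unfolding V_def by blast
  have sm: "c \<odot> u \<in> V ss K" if "u \<in> V ss K" for u c K
    using that lspan_smult[OF _ f] unfolding V_def by blast
  have z: "\<zero> \<in> V ss K" for K unfolding V_def by (rule lspan_zero)
  have 1: "mon ss es \<otimes> y \<in> V ss (N + N')" if es: "es \<in> box (length ss) N" for es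
  proof -
    have "V ss N' \<subseteq> {y \<in> carrier A. mon ss es \<otimes> y \<in> V ss (N + N')}"
      unfolding V_def[of ss N']
    proof (rule lspan_subset)
      fix fs assume fs: "fs \<in> box (length ss) N'"
      then have "mon ss es \<otimes> mon ss fs = mon ss (map2 (+) es fs)"
        using es by (intro mon_mult ss) (auto simp: box_def)
      also have "\<dots> \<in> V ss (N + N')"
        unfolding V_def using box_map2[OF es fs] ss by (intro lspan_base) auto
      finally show "mon ss fs \<in> {y \<in> carrier A. mon ss es \<otimes> y \<in> V ss (N + N')}" using ss by simp
    qed (use ss add sm z in \<open>auto simp: r_distr smult_mult_r\<close>)
    then show ?thesis using y by blast
  qed
  have yc: "y \<in> carrier A" using y V_closed[OF ss] by blast
  have "V ss N \<subseteq> {x \<in> carrier A. x \<otimes> y \<in> V ss (N + N')}"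
    unfolding V_def[of ss N]
    by (rule lspan_subset) (use ss add sm z 1 yc in \<open>auto simp: l_distr smult_mult_l\<close>)
  then show ?thesis using x by blast
qed

lemma one_in_V: "set ss \<subseteq> carrier A \<Longrightarrow> \<one> \<in> V ss N"
proof -
  assume ss: "set ss \<subseteq> carrier A"
  have "mon ss (replicate (length ss) 0) = \<one>" using ss
    by (induction ss) auto
  moreover have "replicate (length ss) 0 \<in> box (length ss) N" by (auto simp: box_def)
  ultimately show ?thesis unfolding V_def
    using lspan_base[of "replicate (length ss) 0" "box (length ss) N" "mon ss"] by simp
qed

lemma gen_in_V:
  assumes ss: "set ss \<subseteq> carrier A" and s: "s \<in> set ss"
  shows "s \<in> V ss 1"
proof -
  have "\<exists>es\<in>box (length ss) 1. mon ss es = s" using assms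
  proof (induction ss)
    case (Cons t ss)
    show ?case
    proof (cases "s = t")
      case True
      have "mon ss (replicate (length ss) 0) = \<one>" using Cons.prems(1) by (induction ss) auto
      then show ?thesis using True Cons.prems
        by (intro bexI[of _ "1 # replicate (length ss) 0"]) (auto simp: box_def)
    next
      case False
      then obtain es where "es \<in> box (length ss) 1" "mon ss es = s" using Cons by auto
      then show ?thesis using Cons.prems
        by (intro bexI[of _ "0 # es"]) (auto simp: box_def)
    qed
  qed simp
  then obtain es where "es \<in> box (length ss) 1" "mon ss es = s" by blast
  then show ?thesis unfolding V_def using lspan_base[of es _ "mon ss"] assms by auto
qed

text \<open>The union of the filtration is a subalgebra containing the generators. Closure under
  sums uses that the pieces increase.\<close>

lemma V_exhausts:
  assumes "kalg_fin_gen A"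
  obtains ss where "set ss \<subseteq> carrier A" "(\<Union>N. V ss N) = carrier A"
proof -
  from assms obtain S where S: "finite S" "S \<subseteq> carrier A"
    and gen: "\<And>T. S \<subseteq> T \<Longrightarrow> T \<subseteq> carrier A \<Longrightarrow> \<one> \<in> T \<Longrightarrow>
      (\<forall>x\<in>T. \<forall>y\<in>T. x \<oplus> y \<in> T \<and> x \<otimes> y \<in> T) \<Longrightarrow> (\<forall>c. \<forall>x\<in>T. c \<odot> x \<in> T) \<Longrightarrow> T = carrier A"
    unfolding kalg_fin_gen_def by metis
  obtain ss where ss: "set ss = S" using S finite_list by blast
  then have sc: "set ss \<subseteq> carrier A" using S by simp
  have "(\<Union>N. V ss N) = carrier A"
  proof (rule gen)
    show "S \<subseteq> (\<Union>N. V ss N)" using gen_in_V[OF sc] ss by blast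
    show "(\<Union>N. V ss N) \<subseteq> carrier A" using V_closed[OF sc] by blast
    show "\<one> \<in> (\<Union>N. V ss N)" using one_in_V[OF sc] by blast
    show "\<forall>c. \<forall>x\<in>\<Union>N. V ss N. c \<odot> x \<in> (\<Union>N. V ss N)"
      unfolding V_def using lspan_smult[OF _ mon_funcset[OF sc]] by blast
    show "\<forall>x\<in>\<Union>N. V ss N. \<forall>y\<in>\<Union>N. V ss N. x \<oplus> y \<in> (\<Union>N. V ss N) \<and> x \<otimes> y \<in> (\<Union>N. V ss N)"
    proof (intro ballI conjI; elim UN_E)
      fix x y N N' assume xy: "x \<in> V ss N" "y \<in> V ss N'"
      show "x \<otimes> y \<in> (\<Union>N. V ss N)" using V_mult[OF sc xy] by blast
      have "x \<in> V ss (max N N')" "y \<in> V ss (max N N')" using xy V_mono by (meson max.cobounded1 max.cobounded2 subsetD)+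
      then have "x \<oplus> y \<in> V ss (max N N')"
        unfolding V_def by (rule lspan_add[OF _ _ mon_funcset[OF sc]])
      then show "x \<oplus> y \<in> (\<Union>N. V ss N)" by blast
    qed
  qed
  then show ?thesis using that sc by blast
qed

lemma V_pow:
  assumes ss: "set ss \<subseteq> carrier A" and x: "x \<in> V ss D"
  shows "x [^] n \<in> V ss (D * n)"
proof (induction n)
  case 0
  then show ?case using one_in_V[OF ss] by simp
next
  case (Suc n)
  then show ?case using V_mult[OF ss Suc x] by (simp add: add.commute)
qed

text \<open>Each power with exponent at most \<open>N\<close> lies in level \<open>D * N\<close>,
  and a monomial is a product of \<open>length zs\<close> such powers.\<close>

lemma mon_in_V:
  assumes ss: "set ss \<subseteq> carrier A" and "set zs \<subseteq> V ss D" "es \<in> box (length zs) N"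
  shows "mon zs es \<in> V ss (length zs * (D * N))"
  using assms(2,3)
proof (induction zs arbitrary: es)
  case Nil
  then show ?case using one_in_V[OF ss] by simp
next
  case (Cons z zs)
  from Cons.prems obtain j fs where es: "es = j # fs" "j \<le> N" "fs \<in> box (length zs) N"
    by (auto simp: box_Suc)
  have "z [^] j \<in> V ss (D * N)"
    using V_pow[OF ss, of z D j] Cons.prems(1) V_mono[of "D * j" "D * N" ss] es(2) by auto
  moreover have "mon zs fs \<in> V ss (length zs * (D * N))" using Cons es by auto
  ultimately show ?case using V_mult[OF ss] es(1) by (simp add: algebra_simps)
qed

end

lemma box_growth: "\<exists>N. (C * N + 1) ^ s < (N + 1 :: nat) ^ (s + 1)"
proof
  \<comment> \<open>With this choice the constant \<open>(C + 1) ^ s\<close> equals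
    \<open>?N\<close> and is absorbed by the one additional factor \<open>?N + 1\<close> on the
    right.\<close>
  let ?N = "(C + 1) ^ s"
  have "(C * ?N + 1) ^ s \<le> ((C + 1) * (?N + 1)) ^ s" by (intro power_mono) auto
  also have "\<dots> = ?N * (?N + 1) ^ s" by (simp only: power_mult_distrib)
  also have "\<dots> < (?N + 1) ^ (s + 1)" by simp
  finally show "(C * ?N + 1) ^ s < (?N + 1) ^ (s + 1)" .
qed

text \<open>An injective endomorphism \<open>\<psi>\<close> together with an element transcendental over its image
  amounts to an embedding of the polynomial ring over \<open>A\<close> into \<open>A\<close>; iterating it produces more
  algebraically independent elements than \<open>A\<close> has generators.\<close>

lemma (in comm_kalg) no_transcendental_over_endomorphic_image:
  assumes fg: "kalg_fin_gen A" and psi: "\<psi> \<in> kalg_hom A A" and \<zeta>: "\<zeta> \<in> carrier A"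
    and nontriv: "\<one> \<noteq> \<zero>"
    and ind: "\<And>k r. r \<in> {..k::nat} \<rightarrow> carrier A \<Longrightarrow> (\<Oplus>j\<in>{..k}. (\<zeta> [^] j) \<otimes> \<psi> (r j)) = \<zero> \<Longrightarrow>
      \<forall>j\<le>k. r j = \<zero>"
  shows False
proof -
  note h = kalg_homD[OF psi]
  \<comment> \<open>The list consists of \<open>\<zeta>\<close>, \<open>\<psi> \<zeta>\<close>, and
    so on, up to the (m-1)-fold iterate of \<open>\<psi>\<close> at \<open>\<zeta>\<close>.\<close>
  define zs where "zs m = ((\<lambda>l. \<zeta> # map \<psi> l) ^^ m) []" for m
  have zs_Suc: "zs (Suc m) = \<zeta> # map \<psi> (zs m)" and zs_0: "zs 0 = []" for m by (simp_all add: zs_def)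
  have len: "length (zs m) = m" for m by (induction m) (simp_all add: zs_0 zs_Suc)
  have zsc: "set (zs m) \<subseteq> carrier A" for m by (induction m) (use \<zeta> h(2) in \<open>auto simp: zs_0 zs_Suc\<close>)
  have pow: "\<psi> (x [^] (j::nat)) = \<psi> x [^] j" if "x \<in> carrier A" for x j
    using that by (induction j) (simp_all add: h)
  have mon_psi: "mon (map \<psi> l) es = \<psi> (mon l es)" if "set l \<subseteq> carrier A" for l es
    using that by (induction l es rule: mon.induct) (simp_all add: h pow)
  \<comment> \<open>Grouping a relation by the exponent of the leading \<open>\<zeta>\<close> gives
    a polynomial in \<open>\<zeta>\<close> whose coefficients are \<open>\<psi>\<close> of
    combinations of monomials in the shorter list. By transcendence these combinations vanish, and
    the induction hypothesis applies to each of them.\<close>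
  have indep: "lin_indep (mon (zs m)) (box m N)" for m N
  proof (induction m)
    case 0
    show ?case
    proof (rule lin_indepI_finite)
      fix c :: "nat list \<Rightarrow> 'k" assume "lincomb (mon (zs 0)) c (box 0 N) = \<zero>"
      then have "c [] \<odot> \<one> = \<zero>" by (simp add: lincomb_def box_0 zs_0)
      then show "\<forall>i\<in>box 0 N. c i = 0" using nontriv by (simp add: box_0 smult_one_eq_zero_iff)
    qed (auto simp: finite_box zs_0)
  next
    case (Suc m)
    show ?case
    proof (rule lin_indepI_finite[OF finite_box mon_funcset[OF zsc]])
      fix c :: "nat list \<Rightarrow> 'k" assume 0: "lincomb (mon (zs (Suc m))) c (box (Suc m) N) = \<zero>"
      let ?r = "\<lambda>j. lincomb (mon (zs m)) (\<lambda>es. c (j # es)) (box m N)"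
      have inj: "inj_on (\<lambda>(j, es). j # es) ({..N} \<times> box m N)" by (auto simp: inj_on_def)
      have "lincomb (mon (zs (Suc m))) c (box (Suc m) N) =
        (\<Oplus>p\<in>{..N} \<times> box m N. c (fst p # snd p) \<odot> mon (zs (Suc m)) (fst p # snd p))"
        unfolding lincomb_def box_Suc using zsc[of "Suc m"]
        by (subst finsum_reindex[OF _ inj]) (auto simp: case_prod_unfold)
      also have "\<dots> = (\<Oplus>j\<in>{..N}. \<Oplus>es\<in>box m N. c (j # es) \<odot> mon (zs (Suc m)) (j # es))"
        using zsc[of "Suc m"] by (subst finsum_Times) (auto simp: finite_box)
      also have "\<dots> = (\<Oplus>j\<in>{..N}. (\<zeta> [^] j) \<otimes> \<psi> (?r j))"
      proof (rule finsum_cong')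
        show "(\<lambda>j. (\<zeta> [^] j) \<otimes> \<psi> (?r j)) \<in> {..N} \<rightarrow> carrier A"
          using \<zeta> zsc[of m] by (auto intro!: h(2) lincomb_closed)
        fix j assume "j \<in> {..N}"
        have "(\<zeta> [^] j) \<otimes> \<psi> (?r j) = (\<zeta> [^] j) \<otimes> (\<Oplus>es\<in>box m N. \<psi> (c (j # es) \<odot> mon (zs m) es))"
          unfolding lincomb_def using zsc[of m]
          by (subst kalg_hom_finsum[OF kalg_axioms kalg_axioms psi]) auto
        also have "\<dots> = (\<Oplus>es\<in>box m N. (\<zeta> [^] j) \<otimes> \<psi> (c (j # es) \<odot> mon (zs m) es))"
          using zsc[of m] \<zeta> by (intro finsum_rdistr) (auto simp: finite_box intro!: h(2))
        also have "\<dots> = (\<Oplus>es\<in>box m N. c (j # es) \<odot> mon (zs (Suc m)) (j # es))"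
          using zsc[of m] \<zeta>
          by (intro finsum_cong') (auto simp: zs_Suc mon_psi h(6) smult_mult_r h(2))
        finally show "(\<Oplus>es\<in>box m N. c (j # es) \<odot> mon (zs (Suc m)) (j # es)) = (\<zeta> [^] j) \<otimes> \<psi> (?r j)"
          by simp
      qed (rule refl)
      finally have "(\<Oplus>j\<in>{..N}. (\<zeta> [^] j) \<otimes> \<psi> (?r j)) = \<zero>" using 0 by simp
      moreover have "?r \<in> {..N} \<rightarrow> carrier A" using zsc[of m] by (auto intro!: lincomb_closed)
      ultimately have "\<forall>j\<le>N. ?r j = \<zero>" by (intro ind)
      then have "\<forall>j\<le>N. \<forall>es\<in>box m N. c (j # es) = 0"
        using Suc finite_box[of m N] unfolding lin_indep_def by blast
      then show "\<forall>es\<in>box (Suc m) N. c es = 0" unfolding box_Suc by auto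
    qed
  qed
  obtain ss where ss: "set ss \<subseteq> carrier A" "(\<Union>N. V ss N) = carrier A" using V_exhausts[OF fg] .
  \<comment> \<open>One more independent element than there are generators.\<close>
  let ?m = "length ss + 1"
  have "\<exists>D. set l \<subseteq> V ss D" if "set l \<subseteq> carrier A" for l using that
  proof (induction l)
    case (Cons x l)
    then obtain D where "set l \<subseteq> V ss D" by auto
    moreover have "x \<in> (\<Union>N. V ss N)" using Cons.prems ss(2) by simp
    then obtain D' where "x \<in> V ss D'" by blast
    ultimately have "set (x # l) \<subseteq> V ss (max D D')"
      using V_mono[of D "max D D'" ss] V_mono[of D' "max D D'" ss] by auto
    then show ?case by blast
  qed simp
  then obtain D where D: "set (zs ?m) \<subseteq> V ss D" using zsc by blast
  \<comment> \<open>The monomials of \<open>zs ?m\<close> with exponents up to \<open>N\<close> lie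
    in filtration level \<open>?m * D * N\<close>, so this product takes the place of
    \<open>C * N\<close> in \<open>box_growth\<close>.\<close>
  obtain N where N: "(?m * D * N + 1) ^ length ss < (N + 1) ^ (length ss + 1)"
    using box_growth by blast
  have "\<not> lin_indep (mon (zs ?m)) (box ?m N)"
  proof (rule not_lin_indep_if_card)
    show "mon ss \<in> box (length ss) (?m * (D * N)) \<rightarrow> carrier A" using ss by auto
    show "mon (zs ?m) es \<in> lspan (mon ss) (box (length ss) (?m * (D * N)))" if "es \<in> box ?m N" for es
      using mon_in_V[OF ss(1) D, of es N] that unfolding V_def by (simp add: len)
    show "card (box (length ss) (?m * (D * N))) < card (box ?m N)"
      using N unfolding card_box by (simp only: mult.assoc)
  qed (auto simp: finite_box)
  then show False using indep by blast
qed

section \<open>Tensor products, abstractly\<close>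

text \<open>In a basis expansion each coefficient is the value of a coordinate functional. Equations
  in R can thus be verified through the maps that \<open>slice\<close> provides.\<close>

lemma (in kmod) functionals_separate_points:
  assumes "r \<in> carrier A" "\<And>\<rho>. linear_functional A \<rho> \<Longrightarrow> \<rho> r = 0"
  shows "r = \<zero>"
proof -
  obtain E where E: "is_basis E" using ex_basis by blast
  then have "r \<in> lspan (\<lambda>x. x) E" using assms(1) by (simp add: is_basis_def)
  then obtain c F where F: "finite F" "F \<subseteq> E" "r = lincomb (\<lambda>x. x) c F" by (rule lspanE)
  have Fc: "(\<lambda>x. x) \<in> F \<rightarrow> carrier A" using F(2) E by (auto simp: is_basis_def)
  have "c b = 0" if b: "b \<in> F" for b
  proof -
    obtain \<rho> where rho: "linear_functional A \<rho>" "\<rho> b = 1" "\<And>e. e \<in> E \<Longrightarrow> e \<noteq> b \<Longrightarrow> \<rho> e = 0"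
      using dual_functional[OF E] b F(2) by blast
    have z: "\<rho> \<zero> = 0" using rho(1) smult_l_zero[of \<zero>] zero_closed
      unfolding linear_functional_def by (metis mult_zero_left)
    have "\<rho> (lincomb (\<lambda>x. x) c G) = (\<Sum>e\<in>G. c e * \<rho> e)" if "finite G" "G \<subseteq> F" for G
      using that
    proof (induction G rule: finite_induct)
      case empty
      then show ?case by (simp add: lincomb_def z)
    next
      case (insert x G)
      then have "(\<lambda>x. x) \<in> G \<rightarrow> carrier A" "x \<in> carrier A" using Fc by auto
      moreover from this have "finsum A (\<lambda>x. c x \<odot> x) G \<in> carrier A" by (intro finsum_closed) auto
      ultimately show ?case using insert rho(1)
        by (simp add: lincomb_def linear_functional_def Pi_def)
    qed
    from this[OF F(1) order_refl] have "\<rho> r = (\<Sum>e\<in>F. c e * \<rho> e)" using F(3) by simp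
    also have "\<dots> = (\<Sum>e\<in>{b}. c e * \<rho> e)"
      using F(1,2) b rho(3) by (intro sum.mono_neutral_right) auto
    finally show ?thesis using assms(2)[OF rho(1)] rho(2) by simp
  qed
  then show ?thesis using F(3) Fc by (auto simp: lincomb_def Pi_def intro!: add.finprod_one_eqI)
qed

text \<open>\<open>T\<close> is a tensor product of \<open>A\<close> and \<open>R\<close>: it is spanned by pure tensors, and the existence
  of the maps \<open>id \<otimes> \<rho>\<close> for all functionals \<open>\<rho>\<close> on \<open>R\<close> rules out additional relations.\<close>

locale tens = A: kalg A + R: comm_kalg R + T: kalg T
  for A :: "('k::field, 'a) module" and R :: "('k, 'r) module" and T :: "('k, 't) module" +
  fixes \<iota> :: "'a \<Rightarrow> 't" and \<kappa> :: "'r \<Rightarrow> 't"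
  assumes iota_hom: "\<iota> \<in> kalg_hom A T"
    and kappa_hom: "\<kappa> \<in> kalg_hom R T"
    and iota_kappa_comm: "a \<in> carrier A \<Longrightarrow> r \<in> carrier R \<Longrightarrow> \<kappa> r \<otimes>\<^bsub>T\<^esub> \<iota> a = \<iota> a \<otimes>\<^bsub>T\<^esub> \<kappa> r"
    and tens_induct [consumes 1, case_names pure add]:
      "\<And>u P. \<lbrakk>u \<in> carrier T; \<And>a r. a \<in> carrier A \<Longrightarrow> r \<in> carrier R \<Longrightarrow> P (\<iota> a \<otimes>\<^bsub>T\<^esub> \<kappa> r);
        \<And>u v. u \<in> carrier T \<Longrightarrow> v \<in> carrier T \<Longrightarrow> P u \<Longrightarrow> P v \<Longrightarrow> P (u \<oplus>\<^bsub>T\<^esub> v)\<rbrakk> \<Longrightarrow> P u"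
    and slice: "linear_functional R \<rho> \<Longrightarrow> \<exists>L. additive_map T A L \<and>
      (\<forall>a\<in>carrier A. \<forall>r\<in>carrier R. L (\<iota> a \<otimes>\<^bsub>T\<^esub> \<kappa> r) = \<rho> r \<odot>\<^bsub>A\<^esub> a)"
begin

lemmas iota = kalg_homD(2-6)[OF iota_hom]
lemmas kappa = kalg_homD(2-6)[OF kappa_hom]
lemmas [simp] = iota(1) kappa(1)

lemma iota_zero [simp]: "\<iota> \<zero>\<^bsub>A\<^esub> = \<zero>\<^bsub>T\<^esub>"
  by (rule kalg_hom_zero[OF A.kalg_axioms T.kalg_axioms iota_hom])

lemma kappa_minus: "r \<in> carrier R \<Longrightarrow> s \<in> carrier R \<Longrightarrow> \<kappa> (r \<ominus>\<^bsub>R\<^esub> s) = \<kappa> r \<ominus>\<^bsub>T\<^esub> \<kappa> s"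
  by (rule kalg_hom_minus[OF R.kalg_axioms T.kalg_axioms kappa_hom])

lemma iota_minus: "a \<in> carrier A \<Longrightarrow> b \<in> carrier A \<Longrightarrow> \<iota> (a \<ominus>\<^bsub>A\<^esub> b) = \<iota> a \<ominus>\<^bsub>T\<^esub> \<iota> b"
  by (rule kalg_hom_minus[OF A.kalg_axioms T.kalg_axioms iota_hom])

lemma pure_mult:
  assumes "a \<in> carrier A" "b \<in> carrier A" "r \<in> carrier R" "s \<in> carrier R"
  shows "(\<iota> a \<otimes>\<^bsub>T\<^esub> \<kappa> r) \<otimes>\<^bsub>T\<^esub> (\<iota> b \<otimes>\<^bsub>T\<^esub> \<kappa> s) = \<iota> (a \<otimes>\<^bsub>A\<^esub> b) \<otimes>\<^bsub>T\<^esub> \<kappa> (r \<otimes>\<^bsub>R\<^esub> s)"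
proof -
  have "(\<iota> a \<otimes>\<^bsub>T\<^esub> \<kappa> r) \<otimes>\<^bsub>T\<^esub> (\<iota> b \<otimes>\<^bsub>T\<^esub> \<kappa> s) = \<iota> a \<otimes>\<^bsub>T\<^esub> (\<kappa> r \<otimes>\<^bsub>T\<^esub> \<iota> b) \<otimes>\<^bsub>T\<^esub> \<kappa> s"
    using assms by (simp add: T.m_assoc)
  also have "\<dots> = \<iota> a \<otimes>\<^bsub>T\<^esub> (\<iota> b \<otimes>\<^bsub>T\<^esub> \<kappa> r) \<otimes>\<^bsub>T\<^esub> \<kappa> s" using assms by (simp add: iota_kappa_comm)
  finally show ?thesis using assms by (simp add: T.m_assoc iota kappa)
qed

text \<open>Together with \<open>normal_form_zero\<close> this says that T is free over A on the
  images of a basis of R.\<close>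

lemma normal_form:
  assumes "R.is_basis E" "u \<in> carrier T"
  obtains F a where "finite F" "F \<subseteq> E" "\<And>e. a e \<in> carrier A"
    "u = (\<Oplus>\<^bsub>T\<^esub>e\<in>F. \<iota> (a e) \<otimes>\<^bsub>T\<^esub> \<kappa> e)"
proof -
  have Ec: "E \<subseteq> carrier R" using assms(1) by (simp add: R.is_basis_def)
  have ext: "(\<Oplus>\<^bsub>T\<^esub>e\<in>F. \<iota> (a e) \<otimes>\<^bsub>T\<^esub> \<kappa> e) = (\<Oplus>\<^bsub>T\<^esub>e\<in>G. \<iota> (a e) \<otimes>\<^bsub>T\<^esub> \<kappa> e)"
    if "finite G" "F \<subseteq> G" "G \<subseteq> E" "\<And>e. a e \<in> carrier A" "\<And>e. e \<notin> F \<Longrightarrow> a e = \<zero>\<^bsub>A\<^esub>" for a F G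
    using that Ec by (intro T.add.finprod_mono_neutral_cong_left) (auto simp: subset_iff)
  \<comment> \<open>The invariant also makes the coefficients vanish off \<open>F\<close>, so that
    two expansions can be extended to the union of their index sets and added.\<close>
  have "\<exists>F a. finite F \<and> F \<subseteq> E \<and> (\<forall>e. a e \<in> carrier A) \<and> (\<forall>e. e \<notin> F \<longrightarrow> a e = \<zero>\<^bsub>A\<^esub>) \<and>
    u = (\<Oplus>\<^bsub>T\<^esub>e\<in>F. \<iota> (a e) \<otimes>\<^bsub>T\<^esub> \<kappa> e)"
    using assms(2)
  proof (induction u rule: tens_induct)
    case (pure a r)
    have "r \<in> R.lspan (\<lambda>x. x) E" using assms(1) pure by (simp add: R.is_basis_def)
    then obtain c F where F: "finite F" "F \<subseteq> E" "r = R.lincomb (\<lambda>x. x) c F" by (rule R.lspanE)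
    have Fc: "x \<in> carrier R" if "x \<in> F" for x using that F(2) Ec by auto
    have "\<kappa> r = (\<Oplus>\<^bsub>T\<^esub>e\<in>F. \<kappa> (c e \<odot>\<^bsub>R\<^esub> e))"
      unfolding F(3) R.lincomb_def using Fc
      by (intro kalg_hom_finsum[OF R.kalg_axioms T.kalg_axioms kappa_hom]) auto
    then have "\<iota> a \<otimes>\<^bsub>T\<^esub> \<kappa> r = (\<Oplus>\<^bsub>T\<^esub>e\<in>F. \<iota> a \<otimes>\<^bsub>T\<^esub> \<kappa> (c e \<odot>\<^bsub>R\<^esub> e))"
      using pure Fc F(1) by (simp add: T.finsum_rdistr)
    also have "\<dots> = (\<Oplus>\<^bsub>T\<^esub>e\<in>F. \<iota> (if e \<in> F then c e \<odot>\<^bsub>A\<^esub> a else \<zero>\<^bsub>A\<^esub>) \<otimes>\<^bsub>T\<^esub> \<kappa> e)"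
      using pure Fc by (intro T.finsum_cong') (auto simp: iota(5) kappa(5) T.smult_mult_l T.smult_mult_r)
    finally show ?case using F pure
      by (intro exI[of _ F] exI[of _ "\<lambda>e. if e \<in> F then c e \<odot>\<^bsub>A\<^esub> a else \<zero>\<^bsub>A\<^esub>"]) auto
  next
    case (add u v)
    from add.IH(1) obtain F a where F: "finite F" "F \<subseteq> E" "\<And>e. a e \<in> carrier A" "\<And>e. e \<notin> F \<Longrightarrow> a e = \<zero>\<^bsub>A\<^esub>"
      "u = (\<Oplus>\<^bsub>T\<^esub>e\<in>F. \<iota> (a e) \<otimes>\<^bsub>T\<^esub> \<kappa> e)" by blast
    from add.IH(2) obtain G b where G: "finite G" "G \<subseteq> E" "\<And>e. b e \<in> carrier A" "\<And>e. e \<notin> G \<Longrightarrow> b e = \<zero>\<^bsub>A\<^esub>"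
      "v = (\<Oplus>\<^bsub>T\<^esub>e\<in>G. \<iota> (b e) \<otimes>\<^bsub>T\<^esub> \<kappa> e)" by blast
    have c: "x \<in> carrier R" if "x \<in> F \<union> G" for x using that F(2) G(2) Ec by auto
    have "u = (\<Oplus>\<^bsub>T\<^esub>e\<in>F \<union> G. \<iota> (a e) \<otimes>\<^bsub>T\<^esub> \<kappa> e)" "v = (\<Oplus>\<^bsub>T\<^esub>e\<in>F \<union> G. \<iota> (b e) \<otimes>\<^bsub>T\<^esub> \<kappa> e)"
      using F G ext[of "F \<union> G" F a] ext[of "F \<union> G" G b] by auto
    then have "u \<oplus>\<^bsub>T\<^esub> v = (\<Oplus>\<^bsub>T\<^esub>e\<in>F \<union> G. (\<iota> (a e) \<otimes>\<^bsub>T\<^esub> \<kappa> e) \<oplus>\<^bsub>T\<^esub> (\<iota> (b e) \<otimes>\<^bsub>T\<^esub> \<kappa> e))"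
      using F(3) G(3) c by (simp add: T.finsum_addf Pi_def)
    also have "\<dots> = (\<Oplus>\<^bsub>T\<^esub>e\<in>F \<union> G. \<iota> (a e \<oplus>\<^bsub>A\<^esub> b e) \<otimes>\<^bsub>T\<^esub> \<kappa> e)"
      using F(3) G(3) c by (intro T.finsum_cong') (auto simp: iota(2) T.l_distr)
    finally show ?case using F G
      by (intro exI[of _ "F \<union> G"] exI[of _ "\<lambda>e. a e \<oplus>\<^bsub>A\<^esub> b e"]) auto
  qed
  then show ?thesis using that by blast
qed

text \<open>The slice along the coordinate functional of \<open>b\<close> annihilates every summand
  except the one at \<open>b\<close>, where it returns the coefficient.\<close>

lemma normal_form_zero:
  assumes E: "R.is_basis E" and F: "finite F" "F \<subseteq> E" and a: "\<And>e. e \<in> F \<Longrightarrow> a e \<in> carrier A"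
    and 0: "(\<Oplus>\<^bsub>T\<^esub>e\<in>F. \<iota> (a e) \<otimes>\<^bsub>T\<^esub> \<kappa> e) = \<zero>\<^bsub>T\<^esub>" and b: "b \<in> F"
  shows "a b = \<zero>\<^bsub>A\<^esub>"
proof -
  have Fc: "x \<in> carrier R" if "x \<in> F" for x using that F(2) E by (auto simp: R.is_basis_def)
  obtain \<rho> where rho: "linear_functional R \<rho>" "\<rho> b = 1" "\<And>e. e \<in> E \<Longrightarrow> e \<noteq> b \<Longrightarrow> \<rho> e = 0"
    using R.dual_functional[OF E] b F(2) by blast
  obtain L where L: "additive_map T A L"
    and Lp: "\<And>a r. a \<in> carrier A \<Longrightarrow> r \<in> carrier R \<Longrightarrow> L (\<iota> a \<otimes>\<^bsub>T\<^esub> \<kappa> r) = \<rho> r \<odot>\<^bsub>A\<^esub> a"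
    using slice[OF rho(1)] by blast
  have "\<zero>\<^bsub>A\<^esub> = L (\<Oplus>\<^bsub>T\<^esub>e\<in>F. \<iota> (a e) \<otimes>\<^bsub>T\<^esub> \<kappa> e)"
    using additive_map_zero[OF T.abelian_group_axioms A.abelian_group_axioms L] 0 by simp
  also have "\<dots> = (\<Oplus>\<^bsub>A\<^esub>e\<in>F. L (\<iota> (a e) \<otimes>\<^bsub>T\<^esub> \<kappa> e))"
    using a Fc by (intro additive_map_finsum[OF T.abelian_group_axioms A.abelian_group_axioms L]) auto
  also have "\<dots> = L (\<iota> (a b) \<otimes>\<^bsub>T\<^esub> \<kappa> b)"
  proof (rule A.finsum_single_support)
    show "L (\<iota> (a j) \<otimes>\<^bsub>T\<^esub> \<kappa> j) = \<zero>\<^bsub>A\<^esub>" if j: "j \<in> F" "j \<noteq> b" for j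
    proof -
      have "\<rho> j = 0" using rho(3) j F(2) by auto
      then show ?thesis using a[OF j(1)] Fc[OF j(1)] by (simp add: Lp)
    qed
  qed (use F(1) b a Fc in \<open>auto simp: Lp\<close>)
  finally show ?thesis using a b Fc rho(2) by (simp add: Lp)
qed

lemma kappa_central: "r \<in> carrier R \<Longrightarrow> \<kappa> r \<in> kcenter T"
proof -
  assume r: "r \<in> carrier R"
  have "\<kappa> r \<otimes>\<^bsub>T\<^esub> u = u \<otimes>\<^bsub>T\<^esub> \<kappa> r" if "u \<in> carrier T" for u
    using that
  proof (induction u rule: tens_induct)
    case (pure a s)
    have "\<kappa> r \<otimes>\<^bsub>T\<^esub> (\<iota> a \<otimes>\<^bsub>T\<^esub> \<kappa> s) = (\<iota> \<one>\<^bsub>A\<^esub> \<otimes>\<^bsub>T\<^esub> \<kappa> r) \<otimes>\<^bsub>T\<^esub> (\<iota> a \<otimes>\<^bsub>T\<^esub> \<kappa> s)"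
      using r pure by (simp add: iota)
    also have "\<dots> = \<iota> a \<otimes>\<^bsub>T\<^esub> \<kappa> (s \<otimes>\<^bsub>R\<^esub> r)" using r pure by (simp add: pure_mult R.m_comm)
    also have "\<dots> = (\<iota> a \<otimes>\<^bsub>T\<^esub> \<kappa> s) \<otimes>\<^bsub>T\<^esub> \<kappa> r" using r pure by (simp add: kappa T.m_assoc)
    finally show ?case .
  qed (use r in \<open>auto simp: T.l_distr T.r_distr\<close>)
  then show ?thesis using r by (simp add: kcenter_def)
qed

lemma iota_central: "z \<in> kcenter A \<Longrightarrow> \<iota> z \<in> kcenter T"
proof -
  assume z: "z \<in> kcenter A"
  then have zc: "z \<in> carrier A" by (simp add: kcenter_def)
  have "\<iota> z \<otimes>\<^bsub>T\<^esub> u = u \<otimes>\<^bsub>T\<^esub> \<iota> z" if "u \<in> carrier T" for u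
    using that
  proof (induction u rule: tens_induct)
    case (pure a s)
    have "\<iota> z \<otimes>\<^bsub>T\<^esub> (\<iota> a \<otimes>\<^bsub>T\<^esub> \<kappa> s) = \<iota> (a \<otimes>\<^bsub>A\<^esub> z) \<otimes>\<^bsub>T\<^esub> \<kappa> s"
      using z zc pure by (simp add: iota(3)[symmetric] T.m_assoc[symmetric] kcenter_def)
    also have "\<dots> = (\<iota> a \<otimes>\<^bsub>T\<^esub> \<kappa> s) \<otimes>\<^bsub>T\<^esub> \<iota> z"
      using zc pure by (simp add: iota(3) T.m_assoc iota_kappa_comm)
    finally show ?case .
  qed (use zc in \<open>auto simp: T.l_distr T.r_distr\<close>)
  then show ?thesis using zc by (simp add: kcenter_def)
qed

text \<open>Comparing normal forms of \<open>u\<close> times \<open>\<iota> b\<close> and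
  \<open>\<iota> b\<close> times \<open>u\<close> shows that each coefficient of \<open>u\<close>
  commutes with \<open>b\<close>. The coefficients are therefore central, hence scalars, and scalars
  can be moved into R.\<close>

lemma center_subset_kappa:
  assumes "central_kalg A" "u \<in> kcenter T"
  shows "\<exists>r\<in>carrier R. u = \<kappa> r"
proof -
  obtain E where E: "R.is_basis E" using R.ex_basis by blast
  have uc: "u \<in> carrier T" using assms(2) by (simp add: kcenter_def)
  obtain F a where F: "finite F" "F \<subseteq> E" and a: "\<And>e. a e \<in> carrier A"
    and u: "u = (\<Oplus>\<^bsub>T\<^esub>e\<in>F. \<iota> (a e) \<otimes>\<^bsub>T\<^esub> \<kappa> e)" by (rule normal_form[OF E uc]) blast
  have Fc: "x \<in> carrier R" if "x \<in> F" for x using that F(2) E by (auto simp: R.is_basis_def)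
  have "a e \<in> kcenter A" if e: "e \<in> F" for e
    unfolding kcenter_def
  proof (intro CollectI conjI ballI a)
    fix b assume b: "b \<in> carrier A"
    have 1: "u \<otimes>\<^bsub>T\<^esub> \<iota> b = (\<Oplus>\<^bsub>T\<^esub>e\<in>F. \<iota> (a e \<otimes>\<^bsub>A\<^esub> b) \<otimes>\<^bsub>T\<^esub> \<kappa> e)"
    proof -
      have "u \<otimes>\<^bsub>T\<^esub> \<iota> b = (\<Oplus>\<^bsub>T\<^esub>e\<in>F. (\<iota> (a e) \<otimes>\<^bsub>T\<^esub> \<kappa> e) \<otimes>\<^bsub>T\<^esub> \<iota> b)"
        unfolding u using a Fc b F(1) by (intro T.finsum_ldistr) auto
      also have "\<dots> = (\<Oplus>\<^bsub>T\<^esub>e\<in>F. \<iota> (a e \<otimes>\<^bsub>A\<^esub> b) \<otimes>\<^bsub>T\<^esub> \<kappa> e)"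
        using a Fc b by (intro T.finsum_cong') (auto simp: iota(3) T.m_assoc iota_kappa_comm)
      finally show ?thesis .
    qed
    have 2: "\<iota> b \<otimes>\<^bsub>T\<^esub> u = (\<Oplus>\<^bsub>T\<^esub>e\<in>F. \<iota> (b \<otimes>\<^bsub>A\<^esub> a e) \<otimes>\<^bsub>T\<^esub> \<kappa> e)"
    proof -
      have "\<iota> b \<otimes>\<^bsub>T\<^esub> u = (\<Oplus>\<^bsub>T\<^esub>e\<in>F. \<iota> b \<otimes>\<^bsub>T\<^esub> (\<iota> (a e) \<otimes>\<^bsub>T\<^esub> \<kappa> e))"
        unfolding u using a Fc b F(1) by (intro T.finsum_rdistr) auto
      also have "\<dots> = (\<Oplus>\<^bsub>T\<^esub>e\<in>F. \<iota> (b \<otimes>\<^bsub>A\<^esub> a e) \<otimes>\<^bsub>T\<^esub> \<kappa> e)"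
        using a Fc b by (intro T.finsum_cong') (auto simp: iota(3) T.m_assoc)
      finally show ?thesis .
    qed
    \<comment> \<open>Uniqueness is available for expansions of zero, so the commutators of the
      coefficients are collected into one expansion.\<close>
    let ?d = "\<lambda>e. a e \<otimes>\<^bsub>A\<^esub> b \<ominus>\<^bsub>A\<^esub> b \<otimes>\<^bsub>A\<^esub> a e"
    have "(\<Oplus>\<^bsub>T\<^esub>e\<in>F. \<iota> (?d e) \<otimes>\<^bsub>T\<^esub> \<kappa> e) \<oplus>\<^bsub>T\<^esub> \<iota> b \<otimes>\<^bsub>T\<^esub> u = u \<otimes>\<^bsub>T\<^esub> \<iota> b"
    proof -
      have "(\<Oplus>\<^bsub>T\<^esub>e\<in>F. \<iota> (?d e) \<otimes>\<^bsub>T\<^esub> \<kappa> e) \<oplus>\<^bsub>T\<^esub> \<iota> b \<otimes>\<^bsub>T\<^esub> u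
          = (\<Oplus>\<^bsub>T\<^esub>e\<in>F. (\<iota> (?d e) \<otimes>\<^bsub>T\<^esub> \<kappa> e) \<oplus>\<^bsub>T\<^esub> (\<iota> (b \<otimes>\<^bsub>A\<^esub> a e) \<otimes>\<^bsub>T\<^esub> \<kappa> e))"
        unfolding 2 using a Fc b by (intro T.finsum_addf[symmetric]) auto
      also have "\<dots> = (\<Oplus>\<^bsub>T\<^esub>e\<in>F. \<iota> (a e \<otimes>\<^bsub>A\<^esub> b) \<otimes>\<^bsub>T\<^esub> \<kappa> e)"
      proof (rule T.finsum_cong')
        fix e assume e: "e \<in> F"
        have "(\<iota> (?d e) \<otimes>\<^bsub>T\<^esub> \<kappa> e) \<oplus>\<^bsub>T\<^esub> (\<iota> (b \<otimes>\<^bsub>A\<^esub> a e) \<otimes>\<^bsub>T\<^esub> \<kappa> e) = \<iota> (?d e \<oplus>\<^bsub>A\<^esub> b \<otimes>\<^bsub>A\<^esub> a e) \<otimes>\<^bsub>T\<^esub> \<kappa> e"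
          using a Fc[OF e] b by (simp add: iota(2) T.l_distr)
        also have "?d e \<oplus>\<^bsub>A\<^esub> b \<otimes>\<^bsub>A\<^esub> a e = a e \<otimes>\<^bsub>A\<^esub> b"
          using a[of e] b by (simp add: a_minus_def A.a_assoc A.l_neg)
        finally show "(\<iota> (?d e) \<otimes>\<^bsub>T\<^esub> \<kappa> e) \<oplus>\<^bsub>T\<^esub> (\<iota> (b \<otimes>\<^bsub>A\<^esub> a e) \<otimes>\<^bsub>T\<^esub> \<kappa> e) = \<iota> (a e \<otimes>\<^bsub>A\<^esub> b) \<otimes>\<^bsub>T\<^esub> \<kappa> e" .
      qed (use a Fc b in auto)
      finally show ?thesis using 1 by simp
    qed
    moreover have "u \<otimes>\<^bsub>T\<^esub> \<iota> b = \<iota> b \<otimes>\<^bsub>T\<^esub> u" using assms(2) b by (simp add: kcenter_def)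
    moreover have "(\<Oplus>\<^bsub>T\<^esub>e\<in>F. \<iota> (?d e) \<otimes>\<^bsub>T\<^esub> \<kappa> e) \<in> carrier T"
      using a Fc b by (intro T.finsum_closed) auto
    ultimately have "(\<Oplus>\<^bsub>T\<^esub>e\<in>F. \<iota> (?d e) \<otimes>\<^bsub>T\<^esub> \<kappa> e) = \<zero>\<^bsub>T\<^esub>"
      using uc b by (simp add: T.add.r_cancel_one)
    then have "?d e = \<zero>\<^bsub>A\<^esub>" using normal_form_zero[OF E F, of ?d e] a b e by simp
    then show "a e \<otimes>\<^bsub>A\<^esub> b = b \<otimes>\<^bsub>A\<^esub> a e" using A.eq_if_minus_eq_zero[of "a e \<otimes>\<^bsub>A\<^esub> b" "b \<otimes>\<^bsub>A\<^esub> a e"] a b by simp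
  qed
  then have "\<forall>e\<in>F. \<exists>c. a e = c \<odot>\<^bsub>A\<^esub> \<one>\<^bsub>A\<^esub>" using assms(1) by (simp add: central_kalg_def)
  then obtain c where c: "\<And>e. e \<in> F \<Longrightarrow> a e = c e \<odot>\<^bsub>A\<^esub> \<one>\<^bsub>A\<^esub>" by metis
  have "u = (\<Oplus>\<^bsub>T\<^esub>e\<in>F. \<kappa> (c e \<odot>\<^bsub>R\<^esub> e))"
    unfolding u using Fc c by (intro T.finsum_cong') (auto simp: iota(4,5) kappa(5) T.smult_one_mult)
  also have "\<dots> = \<kappa> (\<Oplus>\<^bsub>R\<^esub>e\<in>F. c e \<odot>\<^bsub>R\<^esub> e)"
    using Fc by (intro kalg_hom_finsum[OF R.kalg_axioms T.kalg_axioms kappa_hom, symmetric]) auto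
  finally show ?thesis using Fc by (intro bexI[of _ "\<Oplus>\<^bsub>R\<^esub>e\<in>F. c e \<odot>\<^bsub>R\<^esub> e"]) (auto intro!: R.finsum_closed)
qed

text \<open>Independence over K persists over R: slicing along any functional \<open>\<rho>\<close>
  turns an R-relation into a K-relation with coefficients \<open>\<rho> (r j)\<close>, and
  functionals separate points.\<close>

lemma lin_indep_over_R:
  assumes z: "A.lin_indep z {..k}" "z \<in> {..k::nat} \<rightarrow> carrier A" and r: "r \<in> {..k} \<rightarrow> carrier R"
    and 0: "(\<Oplus>\<^bsub>T\<^esub>j\<in>{..k}. \<iota> (z j) \<otimes>\<^bsub>T\<^esub> \<kappa> (r j)) = \<zero>\<^bsub>T\<^esub>" and j: "j \<le> k"
  shows "r j = \<zero>\<^bsub>R\<^esub>"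
proof (rule R.functionals_separate_points)
  show "r j \<in> carrier R" using r j by auto
  fix \<rho> assume "linear_functional R \<rho>"
  from slice[OF this] obtain L where L: "additive_map T A L"
    and Lp: "\<And>a r. a \<in> carrier A \<Longrightarrow> r \<in> carrier R \<Longrightarrow> L (\<iota> a \<otimes>\<^bsub>T\<^esub> \<kappa> r) = \<rho> r \<odot>\<^bsub>A\<^esub> a" by blast
  have zc: "z i \<in> carrier A" "r i \<in> carrier R" if "i \<in> {..k}" for i using z(2) r that by auto
  have "\<zero>\<^bsub>A\<^esub> = L (\<Oplus>\<^bsub>T\<^esub>j\<in>{..k}. \<iota> (z j) \<otimes>\<^bsub>T\<^esub> \<kappa> (r j))"
    using additive_map_zero[OF T.abelian_group_axioms A.abelian_group_axioms L] 0 by simp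
  also have "\<dots> = (\<Oplus>\<^bsub>A\<^esub>j\<in>{..k}. L (\<iota> (z j) \<otimes>\<^bsub>T\<^esub> \<kappa> (r j)))"
    using zc by (intro additive_map_finsum[OF T.abelian_group_axioms A.abelian_group_axioms L]) auto
  also have "\<dots> = A.lincomb z (\<lambda>j. \<rho> (r j)) {..k}"
    unfolding A.lincomb_def using zc by (intro A.finsum_cong') (auto simp: Lp)
  finally show "\<rho> (r j) = 0" using z(1) j unfolding A.lin_indep_def by auto
qed

lemma kappa_inj:
  assumes "\<one>\<^bsub>A\<^esub> \<noteq> \<zero>\<^bsub>A\<^esub>" "r \<in> carrier R" "s \<in> carrier R" "\<kappa> r = \<kappa> s"
  shows "r = s"
proof -
  have "r \<ominus>\<^bsub>R\<^esub> s = \<zero>\<^bsub>R\<^esub>"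
  proof (rule R.functionals_separate_points)
    fix \<rho> assume "linear_functional R \<rho>"
    from slice[OF this] obtain L where L: "additive_map T A L"
      and Lp: "\<And>a r. a \<in> carrier A \<Longrightarrow> r \<in> carrier R \<Longrightarrow> L (\<iota> a \<otimes>\<^bsub>T\<^esub> \<kappa> r) = \<rho> r \<odot>\<^bsub>A\<^esub> a" by blast
    have "\<kappa> (r \<ominus>\<^bsub>R\<^esub> s) = \<zero>\<^bsub>T\<^esub>" using assms by (simp add: kappa_minus)
    then have "\<iota> \<one>\<^bsub>A\<^esub> \<otimes>\<^bsub>T\<^esub> \<kappa> (r \<ominus>\<^bsub>R\<^esub> s) = \<zero>\<^bsub>T\<^esub>" by simp
    then have "\<rho> (r \<ominus>\<^bsub>R\<^esub> s) \<odot>\<^bsub>A\<^esub> \<one>\<^bsub>A\<^esub> = \<zero>\<^bsub>A\<^esub>"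
      using Lp[of "\<one>\<^bsub>A\<^esub>" "r \<ominus>\<^bsub>R\<^esub> s"] assms additive_map_zero[OF T.abelian_group_axioms A.abelian_group_axioms L]
      by simp
    then show "\<rho> (r \<ominus>\<^bsub>R\<^esub> s) = 0" using assms(1) by (simp add: A.smult_one_eq_zero_iff)
  qed (use assms in simp)
  then show ?thesis using R.eq_if_minus_eq_zero assms by blast
qed

lemma iota_eq_zeroD:
  assumes "\<one>\<^bsub>R\<^esub> \<noteq> \<zero>\<^bsub>R\<^esub>" "a \<in> carrier A" "\<iota> a = \<zero>\<^bsub>T\<^esub>"
  shows "a = \<zero>\<^bsub>A\<^esub>"
proof -
  obtain \<rho> where rho: "linear_functional R \<rho>" "\<rho> \<one>\<^bsub>R\<^esub> \<noteq> 0"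
    using R.functionals_separate_points[of "\<one>\<^bsub>R\<^esub>"] assms(1) by blast
  obtain L where L: "additive_map T A L"
    and Lp: "\<And>a r. a \<in> carrier A \<Longrightarrow> r \<in> carrier R \<Longrightarrow> L (\<iota> a \<otimes>\<^bsub>T\<^esub> \<kappa> r) = \<rho> r \<odot>\<^bsub>A\<^esub> a"
    using slice[OF rho(1)] by blast
  have "\<iota> a \<otimes>\<^bsub>T\<^esub> \<kappa> \<one>\<^bsub>R\<^esub> = \<zero>\<^bsub>T\<^esub>" using assms by (simp add: kappa)
  then have "\<rho> \<one>\<^bsub>R\<^esub> \<odot>\<^bsub>A\<^esub> a = \<zero>\<^bsub>A\<^esub>"
    using Lp[of a "\<one>\<^bsub>R\<^esub>"] assms additive_map_zero[OF T.abelian_group_axioms A.abelian_group_axioms L]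
    by simp
  then show ?thesis using A.smult_eq_zeroD rho(2) assms(2) by blast
qed

text \<open>The slice along a multiplicative functional is itself multiplicative, as is seen on pure
  tensors.\<close>

lemma specialize:
  assumes eps: "\<epsilon> \<in> kalg_hom R K_alg"
  obtains \<pi> where "\<pi> \<in> kalg_hom T A"
    "\<And>a. a \<in> carrier A \<Longrightarrow> \<pi> (\<iota> a) = a" "\<And>r. r \<in> carrier R \<Longrightarrow> \<pi> (\<kappa> r) = \<epsilon> r \<odot>\<^bsub>A\<^esub> \<one>\<^bsub>A\<^esub>"
proof -
  note e = kalg_homD(2-6)[OF eps, simplified]
  have "linear_functional R \<epsilon>" using e by (simp add: linear_functional_def)
  from slice[OF this] obtain L where L: "additive_map T A L"
    and Lp: "\<And>a r. a \<in> carrier A \<Longrightarrow> r \<in> carrier R \<Longrightarrow> L (\<iota> a \<otimes>\<^bsub>T\<^esub> \<kappa> r) = \<epsilon> r \<odot>\<^bsub>A\<^esub> a" by blast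
  have Lc: "L u \<in> carrier A" if "u \<in> carrier T" for u using L that by (auto simp: additive_map_def)
  have La: "L (u \<oplus>\<^bsub>T\<^esub> v) = L u \<oplus>\<^bsub>A\<^esub> L v" if "u \<in> carrier T" "v \<in> carrier T" for u v
    using L that by (auto simp: additive_map_def)
  have Li: "L (\<iota> a) = a" if "a \<in> carrier A" for a
    using Lp[of a "\<one>\<^bsub>R\<^esub>"] that e by (simp add: kappa)
  have Lk: "L (\<kappa> r) = \<epsilon> r \<odot>\<^bsub>A\<^esub> \<one>\<^bsub>A\<^esub>" if "r \<in> carrier R" for r
    using Lp[of "\<one>\<^bsub>A\<^esub>" r] that by (simp add: iota)
  have "L \<in> kalg_hom T A"
  proof (rule kalg_homI)
    show "L (u \<otimes>\<^bsub>T\<^esub> v) = L u \<otimes>\<^bsub>A\<^esub> L v" if u: "u \<in> carrier T" and v: "v \<in> carrier T" for u v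
      using u
    proof (induction u rule: tens_induct)
      case u: (pure a r)
      show ?case using v
      proof (induction v rule: tens_induct)
        case (pure b s)
        then show ?case using u
          by (simp add: pure_mult Lp e A.smult_mult_l A.smult_mult_r A.smult_smult mult.commute)
      qed (use u in \<open>simp_all add: T.r_distr A.r_distr La Lc\<close>)
    qed (use v in \<open>simp_all add: T.l_distr A.l_distr La Lc\<close>)
    show "L (c \<odot>\<^bsub>T\<^esub> u) = c \<odot>\<^bsub>A\<^esub> L u" if "u \<in> carrier T" for c u
      using that
    proof (induction u rule: tens_induct)
      case (pure a r)
      then have "c \<odot>\<^bsub>T\<^esub> (\<iota> a \<otimes>\<^bsub>T\<^esub> \<kappa> r) = \<iota> (c \<odot>\<^bsub>A\<^esub> a) \<otimes>\<^bsub>T\<^esub> \<kappa> r"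
        by (simp add: iota(5) T.smult_mult_l)
      then show ?case using pure by (simp add: Lp A.smult_smult mult.commute)
    qed (simp_all add: T.smult_r_distr A.smult_r_distr La Lc)
    show "L \<one>\<^bsub>T\<^esub> = \<one>\<^bsub>A\<^esub>" using Li[of "\<one>\<^bsub>A\<^esub>"] by (simp add: iota)
  qed (use Lc La in auto)
  then show ?thesis using that Li Lk by blast
qed

text \<open>A homomorphism that acts on R through \<open>\<epsilon>\<close> takes the same value on
  a pure tensor and on its specialization. This identity is what makes the two maps between A and B
  in \<open>cancel_tens\<close> mutually inverse.\<close>

lemma hom_factors_through_specialization:
  assumes C: "kalg C" and h: "h \<in> kalg_hom T C" and \<pi>: "\<pi> \<in> kalg_hom T A"
    "\<And>a. a \<in> carrier A \<Longrightarrow> \<pi> (\<iota> a) = a" "\<And>r. r \<in> carrier R \<Longrightarrow> \<pi> (\<kappa> r) = \<epsilon> r \<odot>\<^bsub>A\<^esub> \<one>\<^bsub>A\<^esub>"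
    and hk: "\<And>r. r \<in> carrier R \<Longrightarrow> h (\<kappa> r) = \<epsilon> r \<odot>\<^bsub>C\<^esub> \<one>\<^bsub>C\<^esub>" and u: "u \<in> carrier T"
  shows "h u = h (\<iota> (\<pi> u))"
proof -
  interpret C: kalg C by fact
  note hh = kalg_homD(2-6)[OF h] and pp = kalg_homD(2-6)[OF \<pi>(1)]
  show ?thesis using u
  proof (induction u rule: tens_induct)
    case (pure a r)
    have "h (\<iota> a \<otimes>\<^bsub>T\<^esub> \<kappa> r) = \<epsilon> r \<odot>\<^bsub>C\<^esub> h (\<iota> a)"
      using pure by (simp add: hh hk C.mult_smult_one)
    moreover have "\<pi> (\<iota> a \<otimes>\<^bsub>T\<^esub> \<kappa> r) = \<epsilon> r \<odot>\<^bsub>A\<^esub> a"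
      using pure by (simp add: pp \<pi> A.mult_smult_one)
    ultimately show ?case using pure by (simp add: iota(5) hh)
  qed (simp_all add: hh pp iota(2))
qed

end

section \<open>Cancellation over algebras with trivial center\<close>

text \<open>The augmentation sends a relation for \<open>z\<close> to its constant coefficient,
  which therefore vanishes. What remains has a factor \<open>z\<close>, which a domain allows to be
  cancelled unless it is zero; this lowers the degree.\<close>

lemma (in comm_kalg) augmented_domain_algebraic_eq_zero:
  assumes dom: "domain A" and eps: "\<epsilon> \<in> kalg_hom A K_alg" and z: "z \<in> carrier A" "\<epsilon> z = 0"
  shows "lincomb (\<lambda>j. z [^] j) c {..k::nat} = \<zero> \<Longrightarrow> \<exists>j\<le>k. c j \<noteq> 0 \<Longrightarrow> z = \<zero>"
proof (induction k arbitrary: c)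
  case 0
  then have "c 0 \<odot> \<one> = \<zero>" "c 0 \<noteq> 0" using z by (auto simp: lincomb_def)
  then show ?case using domain.one_not_zero[OF dom] by (simp add: smult_one_eq_zero_iff)
next
  case (Suc k)
  interpret domain A by fact
  note e = kalg_homD(2-6)[OF eps, simplified]
  have e0: "\<epsilon> \<zero> = 0" using kalg_hom_zero[OF kalg_axioms kalg_K_alg eps] by simp
  let ?s = "lincomb (\<lambda>j. z [^] j) (\<lambda>j. c (Suc j)) {..k}"
  have sc: "?s \<in> carrier A" using z by (intro lincomb_closed) auto
  have "lincomb (\<lambda>j. z [^] j) c {..Suc k} = (\<Oplus>j\<in>{..k}. c (Suc j) \<odot> z [^] Suc j) \<oplus> (c 0 \<odot> \<one>)"
    unfolding lincomb_def using z by (subst finsum_Suc2) auto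
  also have "(\<Oplus>j\<in>{..k}. c (Suc j) \<odot> z [^] Suc j) = ?s \<otimes> z"
    unfolding lincomb_def using z by (subst finsum_ldistr) (auto simp: smult_mult_l intro!: finsum_cong')
  finally have eq: "?s \<otimes> z \<oplus> (c 0 \<odot> \<one>) = \<zero>" using Suc.prems(1) by simp
  then have "\<epsilon> (?s \<otimes> z \<oplus> (c 0 \<odot> \<one>)) = 0" using e0 by simp
  then have c0: "c 0 = 0" using sc z by (simp add: e)
  then have "?s \<otimes> z = \<zero>" using eq sc z by simp
  then have "?s = \<zero> \<or> z = \<zero>" using sc z integral by blast
  moreover have "\<exists>j\<le>k. c (Suc j) \<noteq> 0"
  proof -
    obtain j where "j \<le> Suc k" "c j \<noteq> 0" using Suc.prems(2) by blast
    then show ?thesis using c0 by (cases j) auto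
  qed
  ultimately show ?case using Suc.IH by blast
qed

text \<open>Only the trivial center of A enters, and T and T' are arbitrary tensor products, so the
  result covers \<open>tensor\<close> and \<open>polyring\<close> alike.\<close>

theorem cancel_tens:
  assumes TA: "tens A R T \<iota> \<kappa>" and TB: "tens B R T' \<iota>' \<kappa>'"
    and iso: "kalg_isomorphic T T'" and cA: "central_kalg A"
    and dom: "domain R" and fg: "kalg_fin_gen R" and eps: "\<epsilon> \<in> kalg_hom R K_alg"
  shows "kalg_isomorphic A B"
proof -
  interpret TA: tens A R T \<iota> \<kappa> by fact
  interpret TB: tens B R T' \<iota>' \<kappa>' by fact
  interpret R: domain R by fact
  obtain \<phi> where phi: "\<phi> \<in> kalg_hom T T'" and bij: "bij_betw \<phi> (carrier T) (carrier T')"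
    using iso unfolding kalg_isomorphic_def by blast
  define \<chi> where "\<chi> = inv_into (carrier T) \<phi>"
  have chi: "\<chi> \<in> kalg_hom T' T" unfolding \<chi>_def by (rule kalg_hom_inv[OF TA.T.kalg_axioms phi bij])
  have cp: "\<chi> (\<phi> u) = u" if "u \<in> carrier T" for u
    unfolding \<chi>_def using bij that by (rule bij_betw_inv_into_left)
  have pc: "\<phi> (\<chi> u) = u" if "u \<in> carrier T'" for u
    unfolding \<chi>_def using bij that by (rule bij_betw_inv_into_right)
  note p = kalg_homD(2-6)[OF phi] and x = kalg_homD(2-6)[OF chi] and e = kalg_homD(2-6)[OF eps, simplified]
  note kA = TA.kappa and kB = TB.kappa and iA = TA.iota and iB = TB.iota
  have p0: "\<phi> \<zero>\<^bsub>T\<^esub> = \<zero>\<^bsub>T'\<^esub>" by (rule kalg_hom_zero[OF TA.T.kalg_axioms TB.T.kalg_axioms phi])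
  have x0: "\<chi> \<zero>\<^bsub>T'\<^esub> = \<zero>\<^bsub>T\<^esub>" by (rule kalg_hom_zero[OF TB.T.kalg_axioms TA.T.kalg_axioms chi])
  have A1: "\<one>\<^bsub>A\<^esub> \<noteq> \<zero>\<^bsub>A\<^esub>" using cA by (simp add: central_kalg_def)
  have k0: "\<kappa> \<zero>\<^bsub>R\<^esub> = \<zero>\<^bsub>T\<^esub>" by (rule kalg_hom_zero[OF TA.R.kalg_axioms TA.T.kalg_axioms TA.kappa_hom])
  have k0': "\<kappa>' \<zero>\<^bsub>R\<^esub> = \<zero>\<^bsub>T'\<^esub>" by (rule kalg_hom_zero[OF TA.R.kalg_axioms TB.T.kalg_axioms TB.kappa_hom])
  \<comment> \<open>If B were zero, so would be T' and hence T, although R embeds into T.\<close>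
  have B1: "\<one>\<^bsub>B\<^esub> \<noteq> \<zero>\<^bsub>B\<^esub>"
  proof
    assume "\<one>\<^bsub>B\<^esub> = \<zero>\<^bsub>B\<^esub>"
    then have "\<one>\<^bsub>T'\<^esub> = \<zero>\<^bsub>T'\<^esub>" using iB(4) TB.iota_zero by simp
    then have "\<one>\<^bsub>T\<^esub> = \<zero>\<^bsub>T\<^esub>" using x(4) x0 by simp
    then have "\<kappa> \<one>\<^bsub>R\<^esub> = \<kappa> \<zero>\<^bsub>R\<^esub>" using kA(4) k0 by simp
    then show False using TA.kappa_inj[OF A1, of "\<one>\<^bsub>R\<^esub>" "\<zero>\<^bsub>R\<^esub>"] by simp
  qed
  have x_center: "\<chi> u \<in> kcenter T" if u: "u \<in> kcenter T'" for u
    unfolding kcenter_def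
  proof (intro CollectI conjI ballI)
    have uc: "u \<in> carrier T'" using u by (simp add: kcenter_def)
    then show "\<chi> u \<in> carrier T" by (rule x(1))
    fix v assume v: "v \<in> carrier T"
    have "\<chi> (u \<otimes>\<^bsub>T'\<^esub> \<phi> v) = \<chi> (\<phi> v \<otimes>\<^bsub>T'\<^esub> u)" using u v p(1) by (simp add: kcenter_def)
    then show "\<chi> u \<otimes>\<^bsub>T\<^esub> v = v \<otimes>\<^bsub>T\<^esub> \<chi> u" using uc v by (simp add: x(3) p(1) cp)
  qed
  \<comment> \<open>Central elements of T' are pulled back to R: \<open>\<chi>\<close> carries them
    into the center of T, which lies in the image of \<open>\<kappa>\<close>. The choice is unique
    since \<open>\<kappa>\<close> is injective.\<close>
  define \<theta> where "\<theta> u = (SOME r. r \<in> carrier R \<and> \<kappa> r = \<chi> u)" for u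
  have theta: "\<theta> u \<in> carrier R" "\<kappa> (\<theta> u) = \<chi> u" if "u \<in> kcenter T'" for u
  proof -
    have "\<exists>r. r \<in> carrier R \<and> \<kappa> r = \<chi> u" using TA.center_subset_kappa[OF cA x_center[OF that]] by metis
    then show "\<theta> u \<in> carrier R" "\<kappa> (\<theta> u) = \<chi> u" unfolding \<theta>_def by (metis (mono_tags, lifting) someI_ex)+
  qed
  have thetaI: "\<theta> u = r" if "u \<in> kcenter T'" "r \<in> carrier R" "\<kappa> r = \<chi> u" for u r
    using TA.kappa_inj[OF A1] theta[OF that(1)] that by simp
  \<comment> \<open>The copy of R in T', read inside the copy of R in T. At this stage it need not
    be onto.\<close>
  define \<psi> where "\<psi> r = \<theta> (\<kappa>' r)" for r
  have psi: "\<psi> r \<in> carrier R" "\<kappa> (\<psi> r) = \<chi> (\<kappa>' r)" if "r \<in> carrier R" for r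
    unfolding \<psi>_def using theta[OF TB.kappa_central[OF that]] by auto
  have psiI: "\<psi> r = s" if "r \<in> carrier R" "s \<in> carrier R" "\<kappa> s = \<chi> (\<kappa>' r)" for r s
    using TA.kappa_inj[OF A1] psi[OF that(1)] that by simp
  have psi_hom: "\<psi> \<in> kalg_hom R R"
    by (intro kalg_homI psi(1)) (auto intro!: psiI simp: psi kA kB x)
  note h = kalg_homD(2-6)[OF psi_hom]
  have iota_pow: "\<iota>' (z [^]\<^bsub>B\<^esub> j) = \<iota>' z [^]\<^bsub>T'\<^esub> j" if "z \<in> carrier B" for z and j :: nat
    using that by (induction j) (simp_all add: iB)
  have chi_pow: "\<chi> (z [^]\<^bsub>T'\<^esub> j) = \<chi> z [^]\<^bsub>T\<^esub> j" if "z \<in> carrier T'" for z and j :: nat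
    using that by (induction j) (simp_all add: x)
  have kappa_pow: "\<kappa> (z [^]\<^bsub>R\<^esub> j) = \<kappa> z [^]\<^bsub>T\<^esub> j" if "z \<in> carrier R" for z and j :: nat
    using that by (induction j) (simp_all add: kA)
  \<comment> \<open>Either the powers of \<open>z\<close> are independent, and its image in R is
    transcendental over the image of \<open>\<psi>\<close>, contradicting growth; or
    \<open>z\<close> satisfies a relation, which its image inherits, and augmentation 0 forces that
    image to vanish.\<close>
  have key: "z = \<zero>\<^bsub>B\<^esub>" if z: "z \<in> kcenter B" and ez: "\<epsilon> (\<theta> (\<iota>' z)) = 0" for z
  proof -
    have zc: "z \<in> carrier B" using z by (simp add: kcenter_def)
    let ?\<zeta> = "\<theta> (\<iota>' z)"
    have zeta: "?\<zeta> \<in> carrier R" "\<kappa> ?\<zeta> = \<chi> (\<iota>' z)" using theta[OF TB.iota_central[OF z]] by auto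
    have kz: "\<kappa> (?\<zeta> [^]\<^bsub>R\<^esub> j) = \<chi> (\<iota>' (z [^]\<^bsub>B\<^esub> j))" for j :: nat
      using zeta zc by (simp add: kappa_pow iota_pow chi_pow)
    show ?thesis
    proof (cases "\<forall>k. TB.A.lin_indep (\<lambda>j. z [^]\<^bsub>B\<^esub> j) {..k::nat}")
      case True
      have False
      proof (rule TA.R.no_transcendental_over_endomorphic_image[OF fg psi_hom zeta(1) R.one_not_zero])
        fix k :: nat and r
        assume r: "r \<in> {..k} \<rightarrow> carrier R" and 0: "(\<Oplus>\<^bsub>R\<^esub>j\<in>{..k}. ?\<zeta> [^]\<^bsub>R\<^esub> j \<otimes>\<^bsub>R\<^esub> \<psi> (r j)) = \<zero>\<^bsub>R\<^esub>"
        have rc: "r j \<in> carrier R" if "j \<in> {..k}" for j using r that by auto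
        \<comment> \<open>A relation over the image of \<open>\<psi>\<close> is the image under
          \<open>\<chi>\<close> of the combination of powers of \<open>z\<close> with coefficients
          in R whose terms are \<open>?v j\<close>. Since \<open>\<chi>\<close> is injective, that
          combination vanishes already in T'.\<close>
        let ?v = "\<lambda>j. \<iota>' (z [^]\<^bsub>B\<^esub> j) \<otimes>\<^bsub>T'\<^esub> \<kappa>' (r j)"
        have vc: "?v j \<in> carrier T'" if "j \<in> {..k}" for j using rc[OF that] zc by simp
        have "\<chi> (\<Oplus>\<^bsub>T'\<^esub>j\<in>{..k}. ?v j) = (\<Oplus>\<^bsub>T\<^esub>j\<in>{..k}. \<chi> (?v j))"
          using vc by (intro kalg_hom_finsum[OF TB.T.kalg_axioms TA.T.kalg_axioms chi]) auto
        also have "\<dots> = (\<Oplus>\<^bsub>T\<^esub>j\<in>{..k}. \<kappa> (?\<zeta> [^]\<^bsub>R\<^esub> j \<otimes>\<^bsub>R\<^esub> \<psi> (r j)))"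
          using rc zc zeta(1) psi(1)
          by (intro TA.T.finsum_cong') (auto simp: x(1,3) kA(3) psi kz)
        also have "\<dots> = \<kappa> (\<Oplus>\<^bsub>R\<^esub>j\<in>{..k}. ?\<zeta> [^]\<^bsub>R\<^esub> j \<otimes>\<^bsub>R\<^esub> \<psi> (r j))"
          using rc zeta(1) psi(1)
          by (intro kalg_hom_finsum[OF TA.R.kalg_axioms TA.T.kalg_axioms TA.kappa_hom, symmetric]) auto
        finally have c0: "\<chi> (\<Oplus>\<^bsub>T'\<^esub>j\<in>{..k}. ?v j) = \<zero>\<^bsub>T\<^esub>" using 0 k0 by simp
        have "(\<Oplus>\<^bsub>T'\<^esub>j\<in>{..k}. ?v j) \<in> carrier T'" using vc by (intro TB.T.finsum_closed) auto
        then have "(\<Oplus>\<^bsub>T'\<^esub>j\<in>{..k}. ?v j) = \<zero>\<^bsub>T'\<^esub>" using pc p0 c0 by metis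
        then show "\<forall>j\<le>k. r j = \<zero>\<^bsub>R\<^esub>"
          using TB.lin_indep_over_R[of "\<lambda>j. z [^]\<^bsub>B\<^esub> j" k r] True r zc by auto
      qed
      then show ?thesis ..
    next
      case False
      then obtain k where k: "\<not> TB.A.lin_indep (\<lambda>j. z [^]\<^bsub>B\<^esub> j) {..k::nat}" by blast
      have "\<not> (\<forall>c. TB.A.lincomb (\<lambda>j. z [^]\<^bsub>B\<^esub> j) c {..k} = \<zero>\<^bsub>B\<^esub> \<longrightarrow> (\<forall>j\<in>{..k}. c j = 0))"
        using k TB.A.lin_indepI_finite[of "{..k}" "\<lambda>j. z [^]\<^bsub>B\<^esub> j"] zc by auto
      then obtain c j where c: "TB.A.lincomb (\<lambda>j. z [^]\<^bsub>B\<^esub> j) c {..k} = \<zero>\<^bsub>B\<^esub>" "j \<le> k" "c j \<noteq> 0" by auto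
      let ?s = "TA.R.lincomb (\<lambda>j. ?\<zeta> [^]\<^bsub>R\<^esub> j) c {..k}"
      have "\<kappa> ?s = (\<Oplus>\<^bsub>T\<^esub>j\<in>{..k}. \<kappa> (c j \<odot>\<^bsub>R\<^esub> ?\<zeta> [^]\<^bsub>R\<^esub> j))"
        unfolding TA.R.lincomb_def using zeta(1)
        by (intro kalg_hom_finsum[OF TA.R.kalg_axioms TA.T.kalg_axioms TA.kappa_hom]) auto
      also have "\<dots> = (\<Oplus>\<^bsub>T\<^esub>j\<in>{..k}. \<chi> (\<iota>' (c j \<odot>\<^bsub>B\<^esub> z [^]\<^bsub>B\<^esub> j)))"
        using zeta(1) zc by (intro TA.T.finsum_cong') (auto simp: kA(5) kz iB(5) x(5) x(1))
      also have "\<dots> = \<chi> (\<iota>' (TB.A.lincomb (\<lambda>j. z [^]\<^bsub>B\<^esub> j) c {..k}))"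
        unfolding TB.A.lincomb_def using zc
        by (intro kalg_hom_finsum[OF TB.A.kalg_axioms TA.T.kalg_axioms kalg_hom_comp[OF TB.iota_hom chi], symmetric]) auto
      finally have "\<kappa> ?s = \<kappa> \<zero>\<^bsub>R\<^esub>" using c(1) x0 k0 by simp
      moreover have "?s \<in> carrier R" using zeta(1) by (intro TA.R.lincomb_closed) auto
      ultimately have "?s = \<zero>\<^bsub>R\<^esub>" using TA.kappa_inj[OF A1] by simp
      then have "?\<zeta> = \<zero>\<^bsub>R\<^esub>"
        using TA.R.augmented_domain_algebraic_eq_zero[OF dom eps zeta(1) ez] c(2,3) by blast
      then have "\<chi> (\<iota>' z) = \<zero>\<^bsub>T\<^esub>" using zeta(2) k0 by simp
      then have "\<iota>' z = \<zero>\<^bsub>T'\<^esub>" using pc[of "\<iota>' z"] p0 zc by simp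
      then show ?thesis using TB.iota_eq_zeroD R.one_not_zero zc by blast
    qed
  qed
  have cB: "central_kalg B" unfolding central_kalg_def
  proof (intro conjI B1 ballI)
    fix z assume z: "z \<in> kcenter B"
    then have zc: "z \<in> carrier B" by (simp add: kcenter_def)
    have zeta: "\<theta> (\<iota>' z) \<in> carrier R" "\<kappa> (\<theta> (\<iota>' z)) = \<chi> (\<iota>' z)" using theta[OF TB.iota_central[OF z]] by auto
    \<comment> \<open>Subtracting this scalar brings the augmentation to 0, so that
      \<open>key\<close> applies to the difference.\<close>
    let ?c = "\<epsilon> (\<theta> (\<iota>' z))"
    let ?z = "z \<ominus>\<^bsub>B\<^esub> ?c \<odot>\<^bsub>B\<^esub> \<one>\<^bsub>B\<^esub>"
    have z': "?z \<in> kcenter B" unfolding kcenter_def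
    proof (intro CollectI conjI ballI)
      fix b assume b: "b \<in> carrier B"
      have "z \<otimes>\<^bsub>B\<^esub> b = b \<otimes>\<^bsub>B\<^esub> z" using z b by (simp add: kcenter_def)
      then show "?z \<otimes>\<^bsub>B\<^esub> b = b \<otimes>\<^bsub>B\<^esub> ?z" using zc b
        by (simp add: a_minus_def TB.A.l_distr TB.A.r_distr TB.A.l_minus TB.A.r_minus
            TB.A.smult_one_mult TB.A.mult_smult_one)
    qed (use zc in simp)
    have "\<theta> (\<iota>' ?z) = \<theta> (\<iota>' z) \<ominus>\<^bsub>R\<^esub> ?c \<odot>\<^bsub>R\<^esub> \<one>\<^bsub>R\<^esub>"
    proof (rule thetaI)
      show "\<iota>' ?z \<in> kcenter T'" by (rule TB.iota_central[OF z'])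
      show "\<theta> (\<iota>' z) \<ominus>\<^bsub>R\<^esub> ?c \<odot>\<^bsub>R\<^esub> \<one>\<^bsub>R\<^esub> \<in> carrier R" using zeta by simp
      show "\<kappa> (\<theta> (\<iota>' z) \<ominus>\<^bsub>R\<^esub> ?c \<odot>\<^bsub>R\<^esub> \<one>\<^bsub>R\<^esub>) = \<chi> (\<iota>' ?z)"
        using zeta zc by (simp add: TA.kappa_minus TB.iota_minus kA iB x
            kalg_hom_minus[OF TB.T.kalg_axioms TA.T.kalg_axioms chi])
    qed
    then have "\<epsilon> (\<theta> (\<iota>' ?z)) = 0" using zeta(1)
      by (simp add: kalg_hom_minus[OF TA.R.kalg_axioms kalg_K_alg eps] e)
    then have "?z = \<zero>\<^bsub>B\<^esub>" by (rule key[OF z'])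
    then have "z = ?c \<odot>\<^bsub>B\<^esub> \<one>\<^bsub>B\<^esub>" using TB.A.eq_if_minus_eq_zero[OF zc] by simp
    then show "\<exists>c. z = c \<odot>\<^bsub>B\<^esub> \<one>\<^bsub>B\<^esub>" ..
  qed
  \<comment> \<open>With the center of B known to be K, the center of T' is the copy of R, and the
    inverse direction of the isomorphism restricts as well.\<close>
  have surj: "\<exists>s\<in>carrier R. \<phi> (\<kappa> r) = \<kappa>' s \<and> \<psi> s = r" if r: "r \<in> carrier R" for r
  proof -
    have "\<phi> (\<kappa> r) \<in> kcenter T'" unfolding kcenter_def
    proof (intro CollectI conjI ballI)
      show "\<phi> (\<kappa> r) \<in> carrier T'" using r p(1) by simp
      fix v assume v: "v \<in> carrier T'"
      have "\<phi> (\<kappa> r \<otimes>\<^bsub>T\<^esub> \<chi> v) = \<phi> (\<chi> v \<otimes>\<^bsub>T\<^esub> \<kappa> r)"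
        using TA.kappa_central[OF r] x(1)[OF v] by (simp add: kcenter_def)
      then show "\<phi> (\<kappa> r) \<otimes>\<^bsub>T'\<^esub> v = v \<otimes>\<^bsub>T'\<^esub> \<phi> (\<kappa> r)" using r v by (simp add: p(3) x(1) pc)
    qed
    then obtain s where s: "s \<in> carrier R" "\<phi> (\<kappa> r) = \<kappa>' s" using TB.center_subset_kappa[OF cB] by blast
    have "\<psi> s = r" using s r cp[of "\<kappa> r"] by (intro psiI) auto
    then show ?thesis using s by blast
  qed
  \<comment> \<open>This augmentation on the B side makes \<open>\<pi>'\<close> after
    \<open>\<phi>\<close> agree with \<open>\<epsilon>\<close> on the copy of R in T: the element
    corresponding to \<open>r\<close> is \<open>\<kappa>' s\<close> with
    \<open>\<psi> s = r\<close>.\<close>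
  have eps': "(\<lambda>r. \<epsilon> (\<psi> r)) \<in> kalg_hom R K_alg" by (rule kalg_hom_comp[OF psi_hom eps])
  obtain \<pi> where pi: "\<pi> \<in> kalg_hom T A" "\<And>a. a \<in> carrier A \<Longrightarrow> \<pi> (\<iota> a) = a"
    "\<And>r. r \<in> carrier R \<Longrightarrow> \<pi> (\<kappa> r) = \<epsilon> r \<odot>\<^bsub>A\<^esub> \<one>\<^bsub>A\<^esub>" by (rule TA.specialize[OF eps]) blast
  obtain \<pi>' where pi': "\<pi>' \<in> kalg_hom T' B" "\<And>b. b \<in> carrier B \<Longrightarrow> \<pi>' (\<iota>' b) = b"
    "\<And>r. r \<in> carrier R \<Longrightarrow> \<pi>' (\<kappa>' r) = \<epsilon> (\<psi> r) \<odot>\<^bsub>B\<^esub> \<one>\<^bsub>B\<^esub>" by (rule TB.specialize[OF eps']) blast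
  have hB: "(\<lambda>u. \<pi>' (\<phi> u)) \<in> kalg_hom T B" by (rule kalg_hom_comp[OF phi pi'(1)])
  have hA: "(\<lambda>u. \<pi> (\<chi> u)) \<in> kalg_hom T' A" by (rule kalg_hom_comp[OF chi pi(1)])
  have fB: "\<pi>' (\<phi> u) = \<pi>' (\<phi> (\<iota> (\<pi> u)))" if "u \<in> carrier T" for u
  proof (rule TA.hom_factors_through_specialization[OF TB.A.kalg_axioms hB pi _ that])
    show "\<pi>' (\<phi> (\<kappa> r)) = \<epsilon> r \<odot>\<^bsub>B\<^esub> \<one>\<^bsub>B\<^esub>" if "r \<in> carrier R" for r
      using surj[OF that] pi'(3) by auto
  qed
  have fA: "\<pi> (\<chi> u) = \<pi> (\<chi> (\<iota>' (\<pi>' u)))" if "u \<in> carrier T'" for u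
  proof (rule TB.hom_factors_through_specialization[OF TA.A.kalg_axioms hA pi' _ that])
    show "\<pi> (\<chi> (\<kappa>' r)) = \<epsilon> (\<psi> r) \<odot>\<^bsub>A\<^esub> \<one>\<^bsub>A\<^esub>" if "r \<in> carrier R" for r
      using psi[OF that] pi(3) by metis
  qed
  show ?thesis
  proof (rule kalg_isomorphicI)
    show "(\<lambda>a. \<pi>' (\<phi> (\<iota> a))) \<in> kalg_hom A B" by (rule kalg_hom_comp[OF TA.iota_hom hB])
    show "(\<lambda>b. \<pi> (\<chi> (\<iota>' b))) \<in> kalg_hom B A" by (rule kalg_hom_comp[OF TB.iota_hom hA])
    show "\<pi> (\<chi> (\<iota>' (\<pi>' (\<phi> (\<iota> a))))) = a" if "a \<in> carrier A" for a
      using fA[of "\<phi> (\<iota> a)"] that by (simp add: p cp pi(2))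
    show "\<pi>' (\<phi> (\<iota> (\<pi> (\<chi> (\<iota>' b))))) = b" if "b \<in> carrier B" for b
      using fB[of "\<chi> (\<iota>' b)"] that by (simp add: x pc pi'(2))
  qed
qed

section \<open>The tensor product\<close>

lemma (in abelian_group) minus_minus_eq:
  assumes "x \<in> carrier G" "y \<in> carrier G" "z \<in> carrier G"
  shows "x \<ominus> y \<ominus> z = x \<ominus> (y \<oplus> z)"
  using assms by (simp add: a_minus_def minus_add a_assoc)

text \<open>The values outside \<open>carrier R\<close> are fixed to zero so that pointwise
  operations on total functions form a vector space; product and unit are placeholders demanded by
  the record type.\<close>

definition lin_maps :: "('k::field, 'r) module \<Rightarrow> ('k, 'a) module \<Rightarrow> ('k, 'r \<Rightarrow> 'a) module" where
  "lin_maps R A = \<lparr>carrier = {w. (\<forall>s\<in>carrier R. w s \<in> carrier A) \<and> (\<forall>s. s \<notin> carrier R \<longrightarrow> w s = \<zero>\<^bsub>A\<^esub>)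
      \<and> (\<forall>s\<in>carrier R. \<forall>t\<in>carrier R. w (s \<oplus>\<^bsub>R\<^esub> t) = w s \<oplus>\<^bsub>A\<^esub> w t)
      \<and> (\<forall>c. \<forall>s\<in>carrier R. w (c \<odot>\<^bsub>R\<^esub> s) = c \<odot>\<^bsub>A\<^esub> w s)},
     monoid.mult = (\<lambda>f g. f), one = (\<lambda>_. \<zero>\<^bsub>A\<^esub>), ring.zero = (\<lambda>_. \<zero>\<^bsub>A\<^esub>),
     ring.add = (\<lambda>f g s. f s \<oplus>\<^bsub>A\<^esub> g s), smult = (\<lambda>c f s. c \<odot>\<^bsub>A\<^esub> f s)\<rparr>"

text \<open>Multiplying values by \<open>a\<close> and arguments by \<open>r\<close> makes the monoid algebra act on the linear
  maps from \<open>R\<close> to \<open>A\<close>. The bilinearity relations act as zero, hence so does the ideal they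
  generate, which is how pure tensors are seen to be independent.\<close>

definition tensor_rho :: "('k::field, 'a) module \<Rightarrow> ('k, 'r) module \<Rightarrow> 'a \<times> 'r \<Rightarrow> ('r \<Rightarrow> 'a) \<Rightarrow> 'r \<Rightarrow> 'a" where
  "tensor_rho A R p w = (\<lambda>s. if s \<in> carrier R then fst p \<otimes>\<^bsub>A\<^esub> w (s \<otimes>\<^bsub>R\<^esub> snd p) else \<zero>\<^bsub>A\<^esub>)"

locale two_kalgs = A: kalg A + R: kalg R
  for A :: "('k::field, 'a) module" and R :: "('k, 'r) module"
begin

abbreviation "pair_op \<equiv> (\<lambda>(a, r) (b, s). (a \<otimes>\<^bsub>A\<^esub> b, r \<otimes>\<^bsub>R\<^esub> s))"
abbreviation "N \<equiv> lin_maps R A"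
abbreviation "TP \<equiv> tensor_pre A R"

lemma lin_maps_simps:
  "\<zero>\<^bsub>N\<^esub> = (\<lambda>_. \<zero>\<^bsub>A\<^esub>)" "f \<oplus>\<^bsub>N\<^esub> g = (\<lambda>s. f s \<oplus>\<^bsub>A\<^esub> g s)" "c \<odot>\<^bsub>N\<^esub> f = (\<lambda>s. c \<odot>\<^bsub>A\<^esub> f s)"
  by (simp_all add: lin_maps_def)

lemma lin_mapsD:
  assumes "w \<in> carrier N"
  shows "w s \<in> carrier A" "s \<notin> carrier R \<Longrightarrow> w s = \<zero>\<^bsub>A\<^esub>"
    "s \<in> carrier R \<Longrightarrow> t \<in> carrier R \<Longrightarrow> w (s \<oplus>\<^bsub>R\<^esub> t) = w s \<oplus>\<^bsub>A\<^esub> w t"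
    "s \<in> carrier R \<Longrightarrow> w (c \<odot>\<^bsub>R\<^esub> s) = c \<odot>\<^bsub>A\<^esub> w s"
  using assms by (cases "s \<in> carrier R"; simp add: lin_maps_def)+

lemma lin_mapsI:
  assumes "\<And>s. s \<in> carrier R \<Longrightarrow> w s \<in> carrier A" "\<And>s. s \<notin> carrier R \<Longrightarrow> w s = \<zero>\<^bsub>A\<^esub>"
    "\<And>s t. s \<in> carrier R \<Longrightarrow> t \<in> carrier R \<Longrightarrow> w (s \<oplus>\<^bsub>R\<^esub> t) = w s \<oplus>\<^bsub>A\<^esub> w t"
    "\<And>c s. s \<in> carrier R \<Longrightarrow> w (c \<odot>\<^bsub>R\<^esub> s) = c \<odot>\<^bsub>A\<^esub> w s"
  shows "w \<in> carrier N"
  using assms by (simp add: lin_maps_def)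

lemma kmod_lin_maps: "kmod N"
proof -
  have "abelian_group N"
  proof (rule abelian_groupI)
    fix x assume x: "x \<in> carrier N"
    show "\<exists>y\<in>carrier N. y \<oplus>\<^bsub>N\<^esub> x = \<zero>\<^bsub>N\<^esub>"
    proof (rule bexI)
      show "(\<lambda>s. \<ominus>\<^bsub>A\<^esub> x s) \<oplus>\<^bsub>N\<^esub> x = \<zero>\<^bsub>N\<^esub>"
        by (simp add: lin_maps_simps lin_mapsD[OF x] A.l_neg)
      show "(\<lambda>s. \<ominus>\<^bsub>A\<^esub> x s) \<in> carrier N"
        by (rule lin_mapsI) (simp_all add: lin_mapsD[OF x] A.minus_add A.smult_r_minus)
    qed
    fix y assume y: "y \<in> carrier N"
    show "x \<oplus>\<^bsub>N\<^esub> y \<in> carrier N" unfolding lin_maps_simps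
      by (rule lin_mapsI) (simp_all add: lin_mapsD[OF x] lin_mapsD[OF y] A.a_ac A.smult_r_distr)
  qed (auto simp: lin_maps_simps lin_mapsD A.a_ac intro!: lin_mapsI)
  then show ?thesis
  proof (intro kmod.intro kmod_axioms.intro)
    fix c x assume x: "x \<in> carrier N"
    show "c \<odot>\<^bsub>N\<^esub> x \<in> carrier N" unfolding lin_maps_simps
      by (rule lin_mapsI) (simp_all add: lin_mapsD[OF x] A.smult_r_distr A.smult_smult mult.commute)
  qed (simp_all add: lin_maps_simps lin_mapsD A.smult_l_distr A.smult_r_distr A.smult_smult)
qed

lemma tensor_rho_closed:
  assumes "a \<in> carrier A" "r \<in> carrier R" "w \<in> carrier N"
  shows "tensor_rho A R (a, r) w \<in> carrier N"
  unfolding tensor_rho_def using assms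
  by (intro lin_mapsI)
     (simp_all add: lin_mapsD R.l_distr A.r_distr R.smult_mult_l A.smult_mult_r)

sublocale rep: monoid_rep "carrier A \<times> carrier R" pair_op "(\<one>\<^bsub>A\<^esub>, \<one>\<^bsub>R\<^esub>)" N "tensor_rho A R"
proof (intro monoid_rep.intro monoid_alg.intro kalg_K_alg kmod_lin_maps monoid_alg_axioms.intro monoid_rep_axioms.intro)
  fix m w assume m: "m \<in> carrier A \<times> carrier R" and w: "w \<in> carrier N"
  then show "tensor_rho A R m w \<in> carrier N" using tensor_rho_closed by (cases m) auto
  show "tensor_rho A R m (c \<odot>\<^bsub>N\<^esub> w) = c \<odot>\<^bsub>N\<^esub> tensor_rho A R m w" for c
    using m by (auto simp: tensor_rho_def lin_maps_simps lin_mapsD[OF w] A.smult_mult_r)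
  \<comment> \<open>The arguments are multiplied from the right: precomposition reverses the order
    of composition, and right multiplication reverses it once more, so a left action
    results.\<close>
  show "tensor_rho A R (pair_op u v) w = tensor_rho A R u (tensor_rho A R v w)"
    if "u \<in> carrier A \<times> carrier R" "v \<in> carrier A \<times> carrier R" for u v
    using that by (auto simp: tensor_rho_def lin_mapsD[OF w] R.m_assoc A.m_assoc)
  fix w' assume w': "w' \<in> carrier N"
  show "tensor_rho A R m (w \<oplus>\<^bsub>N\<^esub> w') = tensor_rho A R m w \<oplus>\<^bsub>N\<^esub> tensor_rho A R m w'"
    using m by (auto simp: tensor_rho_def lin_maps_simps lin_mapsD[OF w] lin_mapsD[OF w'] A.r_distr)
qed (auto simp: A.m_assoc R.m_assoc)

lemma TP_eq: "TP = rep.MR" by (simp add: tensor_pre_def)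

sublocale TP: kalg TP unfolding TP_eq by (rule rep.kalg_mring)

lemma delta_closed [simp]: "a \<in> carrier A \<Longrightarrow> r \<in> carrier R \<Longrightarrow> (delta (a, r) :: _ \<Rightarrow> 'k) \<in> carrier TP"
  unfolding TP_eq rep.delta_eq_mono by (rule rep.mono_closed) auto

lemma delta_mult:
  "a \<in> carrier A \<Longrightarrow> r \<in> carrier R \<Longrightarrow> b \<in> carrier A \<Longrightarrow> s \<in> carrier R \<Longrightarrow>
    (delta (a, r) :: _ \<Rightarrow> 'k) \<otimes>\<^bsub>TP\<^esub> delta (b, s) = delta (a \<otimes>\<^bsub>A\<^esub> b, r \<otimes>\<^bsub>R\<^esub> s)"
  unfolding TP_eq rep.delta_eq_mono by (subst rep.mono_mult) auto

abbreviation "I \<equiv> genideal TP (tensor_rels A R)"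

lemma tensor_rels_closed: "tensor_rels A R \<subseteq> carrier TP"
  unfolding tensor_rels_def by auto

lemma ideal_I: "ideal I TP"
  by (rule TP.genideal_ideal[OF tensor_rels_closed])

lemma rels_in_I: "x \<in> tensor_rels A R \<Longrightarrow> x \<in> I"
  using TP.genideal_self[OF tensor_rels_closed] by blast

lemma act_I:
  assumes "f \<in> I" "w \<in> carrier N"
  shows "rep.act f w = \<zero>\<^bsub>N\<^esub>"
proof -
  let ?J = "{f \<in> carrier TP. \<forall>w\<in>carrier N. rep.act f w = \<zero>\<^bsub>N\<^esub>}"
  have min: "rep.act (x \<ominus>\<^bsub>TP\<^esub> y) w = rep.act x w \<ominus>\<^bsub>N\<^esub> rep.act y w"
    if "x \<in> carrier TP" "y \<in> carrier TP" "w \<in> carrier N" for x y w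
    using that unfolding TP_eq by (rule rep.act_minus)
  have del: "rep.act (delta (a, r)) w = tensor_rho A R (a, r) w"
    if "a \<in> carrier A" "r \<in> carrier R" "w \<in> carrier N" for a r w
    using that by (intro rep.act_delta) auto
  have sm: "rep.act (c \<odot>\<^bsub>TP\<^esub> x) w = c \<odot>\<^bsub>N\<^esub> rep.act x w"
    if "x \<in> carrier TP" "w \<in> carrier N" for c x w
    using that unfolding TP_eq by (rule rep.act_smult)
  have 3: "x \<ominus>\<^bsub>N\<^esub> y \<ominus>\<^bsub>N\<^esub> z = \<zero>\<^bsub>N\<^esub>" if "x = y \<oplus>\<^bsub>N\<^esub> z" "y \<in> carrier N" "z \<in> carrier N" for x y z
    using that by (simp add: rep.N.minus_minus_eq) (simp add: a_minus_def rep.N.r_neg)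
  have 2: "x \<ominus>\<^bsub>N\<^esub> y = \<zero>\<^bsub>N\<^esub>" if "x = y" "y \<in> carrier N" for x y
    using that by (simp add: a_minus_def rep.N.r_neg)
  have "tensor_rels A R \<subseteq> ?J"
  proof
    fix x assume x: "x \<in> tensor_rels A R"
    then have xc: "x \<in> carrier TP" using tensor_rels_closed by blast
    have "rep.act x w = \<zero>\<^bsub>N\<^esub>" if w: "w \<in> carrier N" for w
      using x unfolding tensor_rels_def
    proof (elim UnE CollectE exE conjE)
      fix a a' r assume *: "x = delta (a \<oplus>\<^bsub>A\<^esub> a', r) \<ominus>\<^bsub>TP\<^esub> delta (a, r) \<ominus>\<^bsub>TP\<^esub> delta (a', r)"
        "a \<in> carrier A" "a' \<in> carrier A" "r \<in> carrier R"
      have eq: "tensor_rho A R (a \<oplus>\<^bsub>A\<^esub> a', r) w = tensor_rho A R (a, r) w \<oplus>\<^bsub>N\<^esub> tensor_rho A R (a', r) w"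
        using * by (auto simp: tensor_rho_def lin_maps_simps lin_mapsD[OF w] A.l_distr)
      show ?thesis unfolding *(1) using 3[OF eq] * w tensor_rho_closed[OF _ _ w]
        by (simp add: min del)
    next
      fix a r r' assume *: "x = delta (a, r \<oplus>\<^bsub>R\<^esub> r') \<ominus>\<^bsub>TP\<^esub> delta (a, r) \<ominus>\<^bsub>TP\<^esub> delta (a, r')"
        "a \<in> carrier A" "r \<in> carrier R" "r' \<in> carrier R"
      have eq: "tensor_rho A R (a, r \<oplus>\<^bsub>R\<^esub> r') w = tensor_rho A R (a, r) w \<oplus>\<^bsub>N\<^esub> tensor_rho A R (a, r') w"
        using * by (auto simp: tensor_rho_def lin_maps_simps lin_mapsD[OF w] R.r_distr A.r_distr)
      show ?thesis unfolding *(1) using 3[OF eq] * w tensor_rho_closed[OF _ _ w]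
        by (simp add: min del)
    next
      fix c a r assume *: "x = delta (c \<odot>\<^bsub>A\<^esub> a, r) \<ominus>\<^bsub>TP\<^esub> c \<odot>\<^bsub>TP\<^esub> delta (a, r)"
        "a \<in> carrier A" "r \<in> carrier R"
      have eq: "tensor_rho A R (c \<odot>\<^bsub>A\<^esub> a, r) w = c \<odot>\<^bsub>N\<^esub> tensor_rho A R (a, r) w"
        using * by (auto simp: tensor_rho_def lin_maps_simps lin_mapsD[OF w] A.smult_mult_l)
      show ?thesis unfolding *(1) using 2[OF eq] * w tensor_rho_closed[OF _ _ w]
        by (simp add: min del sm)
    next
      fix c a r assume *: "x = delta (a, c \<odot>\<^bsub>R\<^esub> r) \<ominus>\<^bsub>TP\<^esub> c \<odot>\<^bsub>TP\<^esub> delta (a, r)"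
        "a \<in> carrier A" "r \<in> carrier R"
      have eq: "tensor_rho A R (a, c \<odot>\<^bsub>R\<^esub> r) w = c \<odot>\<^bsub>N\<^esub> tensor_rho A R (a, r) w"
        using * by (auto simp: tensor_rho_def lin_maps_simps lin_mapsD[OF w] R.smult_mult_r A.smult_mult_r)
      show ?thesis unfolding *(1) using 2[OF eq] * w tensor_rho_closed[OF _ _ w]
        by (simp add: min del sm)
    qed
    then show "x \<in> ?J" using xc by simp
  qed
  moreover have "ideal ?J TP" unfolding TP_eq by (rule rep.act_kernel_ideal)
  ultimately have "I \<subseteq> ?J" by (intro TP.genideal_minimal)
  then show ?thesis using assms by blast
qed

sublocale Q: kalg_quotient TP I
  by (intro kalg_quotient.intro ideal_I TP.kalg_axioms)

definition pure :: "'a \<Rightarrow> 'r \<Rightarrow> ('a \<times> 'r \<Rightarrow> 'k) set" where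
  "pure a r = Q.proj (delta (a, r))"

lemma tensor_eq: "tensor A R = kquot TP I" by (simp add: tensor_def)

sublocale T: kalg "tensor A R" unfolding tensor_eq by (rule Q.kalg_kquot)

lemmas proj = kalg_homD(2-6)[OF Q.proj_hom, folded tensor_eq]

lemma pure_closed [simp]: "a \<in> carrier A \<Longrightarrow> r \<in> carrier R \<Longrightarrow> pure a r \<in> carrier (tensor A R)"
  unfolding pure_def by (intro proj) auto

lemma pure_add_l:
  assumes "a \<in> carrier A" "a' \<in> carrier A" "r \<in> carrier R"
  shows "pure (a \<oplus>\<^bsub>A\<^esub> a') r = pure a r \<oplus>\<^bsub>tensor A R\<^esub> pure a' r"
proof -
  have "delta (a \<oplus>\<^bsub>A\<^esub> a', r) \<ominus>\<^bsub>TP\<^esub> delta (a, r) \<ominus>\<^bsub>TP\<^esub> delta (a', r) \<in> I"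
    by (rule rels_in_I) (use assms in \<open>auto simp: tensor_rels_def\<close>)
  then show ?thesis unfolding pure_def using assms
    by (simp add: TP.minus_minus_eq Q.proj_eq_iff flip: proj(2))
qed

lemma pure_add_r:
  assumes "a \<in> carrier A" "r \<in> carrier R" "r' \<in> carrier R"
  shows "pure a (r \<oplus>\<^bsub>R\<^esub> r') = pure a r \<oplus>\<^bsub>tensor A R\<^esub> pure a r'"
proof -
  have "delta (a, r \<oplus>\<^bsub>R\<^esub> r') \<ominus>\<^bsub>TP\<^esub> delta (a, r) \<ominus>\<^bsub>TP\<^esub> delta (a, r') \<in> I"
    by (rule rels_in_I) (use assms in \<open>auto simp: tensor_rels_def\<close>)
  then show ?thesis unfolding pure_def using assms
    by (simp add: TP.minus_minus_eq Q.proj_eq_iff flip: proj(2))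
qed

lemma pure_smult_l:
  assumes "a \<in> carrier A" "r \<in> carrier R"
  shows "pure (c \<odot>\<^bsub>A\<^esub> a) r = c \<odot>\<^bsub>tensor A R\<^esub> pure a r"
proof -
  have "delta (c \<odot>\<^bsub>A\<^esub> a, r) \<ominus>\<^bsub>TP\<^esub> c \<odot>\<^bsub>TP\<^esub> delta (a, r) \<in> I"
    by (rule rels_in_I) (use assms in \<open>auto simp: tensor_rels_def\<close>)
  then show ?thesis unfolding pure_def using assms
    by (simp add: Q.proj_eq_iff flip: proj(5))
qed

lemma pure_smult_r:
  assumes "a \<in> carrier A" "r \<in> carrier R"
  shows "pure a (c \<odot>\<^bsub>R\<^esub> r) = c \<odot>\<^bsub>tensor A R\<^esub> pure a r"
proof -
  have "delta (a, c \<odot>\<^bsub>R\<^esub> r) \<ominus>\<^bsub>TP\<^esub> c \<odot>\<^bsub>TP\<^esub> delta (a, r) \<in> I"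
    by (rule rels_in_I) (use assms in \<open>auto simp: tensor_rels_def\<close>)
  then show ?thesis unfolding pure_def using assms
    by (simp add: Q.proj_eq_iff flip: proj(5))
qed

lemma pure_mult:
  "a \<in> carrier A \<Longrightarrow> r \<in> carrier R \<Longrightarrow> b \<in> carrier A \<Longrightarrow> s \<in> carrier R \<Longrightarrow>
    pure a r \<otimes>\<^bsub>tensor A R\<^esub> pure b s = pure (a \<otimes>\<^bsub>A\<^esub> b) (r \<otimes>\<^bsub>R\<^esub> s)"
  unfolding pure_def by (simp add: delta_mult flip: proj(3))

lemma pure_one: "pure \<one>\<^bsub>A\<^esub> \<one>\<^bsub>R\<^esub> = \<one>\<^bsub>tensor A R\<^esub>"
proof -
  have "(delta (\<one>\<^bsub>A\<^esub>, \<one>\<^bsub>R\<^esub>) :: _ \<Rightarrow> 'k) = \<one>\<^bsub>TP\<^esub>"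
    unfolding TP_eq rep.delta_eq_mono by (simp add: rep.mring_simps)
  then show ?thesis unfolding pure_def by (simp add: proj)
qed

text \<open>Sums of pure tensors exhaust the quotient, because a scalar in front of a generator can
  be absorbed into its first component.\<close>

lemma tensor_induct:
  assumes "u \<in> carrier (tensor A R)" "\<And>a r. a \<in> carrier A \<Longrightarrow> r \<in> carrier R \<Longrightarrow> P (pure a r)"
    "\<And>u v. u \<in> carrier (tensor A R) \<Longrightarrow> v \<in> carrier (tensor A R) \<Longrightarrow> P u \<Longrightarrow> P v \<Longrightarrow>
      P (u \<oplus>\<^bsub>tensor A R\<^esub> v)"
  shows "P u"
proof -
  obtain f where f: "f \<in> carrier TP" "u = Q.proj f"
    using assms(1) unfolding tensor_eq Q.carrier_kquot by blast
  have "P (Q.proj f)" using f(1) unfolding TP_eq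
  proof (induction f rule: rep.mring_induct)
    case (mono c m)
    then obtain a r where m: "m = (a, r)" "a \<in> carrier A" "r \<in> carrier R" by auto
    have "rep.mono c m = c \<odot>\<^bsub>TP\<^esub> delta (a, r)"
      unfolding TP_eq rep.delta_eq_mono m(1) by (simp add: rep.mono_smult)
    then have "Q.proj (rep.mono c m) = pure (c \<odot>\<^bsub>A\<^esub> a) r"
      using m by (simp add: proj(5) pure_smult_l) (simp add: pure_def)
    then show ?case using assms(2) m unfolding TP_eq by simp
  next
    case (add f g)
    then show ?case using assms(3)[of "Q.proj f" "Q.proj g"] proj(1,2) unfolding TP_eq by simp
  qed
  then show ?thesis using f(2) by simp
qed

text \<open>The functional defines the linear map \<open>w\<close> sending \<open>s\<close> to
  \<open>\<rho> s\<close> times the unit of A. Acting on \<open>w\<close> by the pair (a, r) and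
  evaluating at the unit of R gives \<open>a\<close> times \<open>w r\<close>, which is
  \<open>\<rho> r\<close> times \<open>a\<close>.\<close>

lemma tensor_slice:
  assumes rho: "linear_functional R \<rho>"
  shows "\<exists>L. additive_map (tensor A R) A L \<and>
    (\<forall>a\<in>carrier A. \<forall>r\<in>carrier R. L (pure a r) = \<rho> r \<odot>\<^bsub>A\<^esub> a)"
proof -
  define w where "w = (\<lambda>s. if s \<in> carrier R then \<rho> s \<odot>\<^bsub>A\<^esub> \<one>\<^bsub>A\<^esub> else \<zero>\<^bsub>A\<^esub>)"
  have w: "w \<in> carrier N" unfolding w_def using rho
    by (intro lin_mapsI) (simp_all add: linear_functional_def A.smult_l_distr A.smult_smult)
  \<comment> \<open>A representative of the class is chosen; \<open>act_I\<close> makes the outcome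
    independent of it.\<close>
  define L where "L u = rep.act (SOME f. f \<in> carrier TP \<and> Q.proj f = u) w \<one>\<^bsub>R\<^esub>" for u
  have Lp: "L (Q.proj f) = rep.act f w \<one>\<^bsub>R\<^esub>" if f: "f \<in> carrier TP" for f
  proof -
    define g where "g = (SOME g. g \<in> carrier TP \<and> Q.proj g = Q.proj f)"
    have g: "g \<in> carrier TP \<and> Q.proj g = Q.proj f" unfolding g_def
      by (rule someI[of "\<lambda>g. g \<in> carrier TP \<and> Q.proj g = Q.proj f" f]) (simp add: f)
    then have "g \<ominus>\<^bsub>TP\<^esub> f \<in> I" using f Q.proj_eq_iff by blast
    then have "rep.act (g \<ominus>\<^bsub>TP\<^esub> f) w = \<zero>\<^bsub>N\<^esub>" using w by (rule act_I)
    then have "rep.act g w \<ominus>\<^bsub>N\<^esub> rep.act f w = \<zero>\<^bsub>N\<^esub>"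
      using f g w rep.act_minus[of g f w] unfolding TP_eq by simp
    then have "rep.act g w = rep.act f w"
      using rep.N.eq_if_minus_eq_zero[of "rep.act g w" "rep.act f w"] f g w unfolding TP_eq by simp
    then show ?thesis unfolding L_def g_def by simp
  qed
  have "additive_map (tensor A R) A L" unfolding additive_map_def
  proof (intro conjI ballI Pi_I)
    fix u assume "u \<in> carrier (tensor A R)"
    then obtain f where f: "f \<in> carrier TP" "u = Q.proj f" unfolding tensor_eq Q.carrier_kquot by blast
    then have "rep.act f w \<in> carrier N" using w unfolding TP_eq by simp
    then show "L u \<in> carrier A" using f by (simp add: Lp lin_mapsD)
    fix v assume "v \<in> carrier (tensor A R)"
    then obtain g where g: "g \<in> carrier TP" "v = Q.proj g" unfolding tensor_eq Q.carrier_kquot by blast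
    have "L (u \<oplus>\<^bsub>tensor A R\<^esub> v) = rep.act (f \<oplus>\<^bsub>TP\<^esub> g) w \<one>\<^bsub>R\<^esub>"
      using f g by (simp add: Lp flip: proj(2))
    also have "rep.act (f \<oplus>\<^bsub>TP\<^esub> g) w = rep.act f w \<oplus>\<^bsub>N\<^esub> rep.act g w"
      using f g w unfolding TP_eq by (intro rep.act_add)
    finally show "L (u \<oplus>\<^bsub>tensor A R\<^esub> v) = L u \<oplus>\<^bsub>A\<^esub> L v"
      using f g by (simp add: Lp lin_maps_simps)
  qed
  moreover have "L (pure a r) = \<rho> r \<odot>\<^bsub>A\<^esub> a" if "a \<in> carrier A" "r \<in> carrier R" for a r
  proof -
    have "L (pure a r) = tensor_rho A R (a, r) w \<one>\<^bsub>R\<^esub>"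
      using that w by (simp add: pure_def Lp rep.act_delta)
    then show ?thesis using that by (simp add: tensor_rho_def w_def A.mult_smult_one)
  qed
  ultimately show ?thesis by blast
qed

end

lemma tens_tensor:
  assumes "kalg A" "comm_kalg R"
  shows "\<exists>\<iota> \<kappa>. tens A R (tensor A R) \<iota> \<kappa>"
proof -
  interpret A: kalg A by fact
  interpret R: comm_kalg R by fact
  interpret two_kalgs A R by (intro two_kalgs.intro A.kalg_axioms R.kalg_axioms)
  have "tens A R (tensor A R) (\<lambda>a. pure a \<one>\<^bsub>R\<^esub>) (\<lambda>r. pure \<one>\<^bsub>A\<^esub> r)"
  proof (intro tens.intro tens_axioms.intro assms T.kalg_axioms)
    show "(\<lambda>a. pure a \<one>\<^bsub>R\<^esub>) \<in> kalg_hom A (tensor A R)"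
      by (rule kalg_homI) (simp_all add: pure_add_l pure_mult pure_one pure_smult_l)
    show "(\<lambda>r. pure \<one>\<^bsub>A\<^esub> r) \<in> kalg_hom R (tensor A R)"
      by (rule kalg_homI) (simp_all add: pure_add_r pure_mult pure_one pure_smult_r)
    fix a r assume ar: "a \<in> carrier A" "r \<in> carrier R"
    then show "pure \<one>\<^bsub>A\<^esub> r \<otimes>\<^bsub>tensor A R\<^esub> pure a \<one>\<^bsub>R\<^esub> = pure a \<one>\<^bsub>R\<^esub> \<otimes>\<^bsub>tensor A R\<^esub> pure \<one>\<^bsub>A\<^esub> r"
      by (simp add: pure_mult)
  next
    fix u and P :: "_ \<Rightarrow> bool"
    assume *: "u \<in> carrier (tensor A R)"
      "\<And>a r. a \<in> carrier A \<Longrightarrow> r \<in> carrier R \<Longrightarrow> P (pure a \<one>\<^bsub>R\<^esub> \<otimes>\<^bsub>tensor A R\<^esub> pure \<one>\<^bsub>A\<^esub> r)"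
      "\<And>u v. u \<in> carrier (tensor A R) \<Longrightarrow> v \<in> carrier (tensor A R) \<Longrightarrow> P u \<Longrightarrow> P v \<Longrightarrow> P (u \<oplus>\<^bsub>tensor A R\<^esub> v)"
    show "P u"
    proof (rule tensor_induct[OF *(1)])
      show "P (pure a r)" if "a \<in> carrier A" "r \<in> carrier R" for a r
        using *(2)[OF that] that by (simp add: pure_mult)
    qed (rule *(3))
  next
    fix \<rho> assume "linear_functional R \<rho>"
    then show "\<exists>L. additive_map (tensor A R) A L \<and>
      (\<forall>a\<in>carrier A. \<forall>r\<in>carrier R. L (pure a \<one>\<^bsub>R\<^esub> \<otimes>\<^bsub>tensor A R\<^esub> pure \<one>\<^bsub>A\<^esub> r) = \<rho> r \<odot>\<^bsub>A\<^esub> a)"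
      using tensor_slice by (simp add: pure_mult)
  qed
  then show ?thesis by blast
qed

section \<open>Polynomial rings\<close>

abbreviation exps :: "nat \<Rightarrow> (nat \<Rightarrow> nat) set" where "exps d \<equiv> {e. \<forall>i\<ge>d. e i = 0}"
abbreviation exp_add :: "(nat \<Rightarrow> nat) \<Rightarrow> (nat \<Rightarrow> nat) \<Rightarrow> nat \<Rightarrow> nat" where
  "exp_add \<equiv> (\<lambda>e f i. e i + f i)"
abbreviation exp_zero :: "nat \<Rightarrow> nat" where "exp_zero \<equiv> (\<lambda>i. 0)"

lemma monoid_alg_exps: "kalg C \<Longrightarrow> monoid_alg C (exps d) exp_add exp_zero"
  by (intro monoid_alg.intro monoid_alg_axioms.intro) (auto simp: add.assoc)

text \<open>Uniqueness of base-N digits, here for exponent vectors encoded as single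
  numbers.\<close>

lemma base_expansion_unique:
  fixes e f :: "nat \<Rightarrow> nat"
  assumes "\<And>i. i < d \<Longrightarrow> e i < N" "\<And>i. i < d \<Longrightarrow> f i < N"
    "(\<Sum>i<d. e i * N ^ i) = (\<Sum>i<d. f i * N ^ i)" "i < d"
  shows "e i = f i"
  using assms
proof (induction d arbitrary: e f i)
  case (Suc d)
  have sh: "(\<Sum>i<Suc d. g i * N ^ i) = g 0 + N * (\<Sum>i<d. g (Suc i) * N ^ i)" for g :: "nat \<Rightarrow> nat"
    by (subst sum.lessThan_Suc_shift) (simp add: sum_distrib_left algebra_simps)
  have b: "e 0 < N" "f 0 < N" using Suc.prems(1,2)[of 0] by auto
  have eq: "e 0 + N * (\<Sum>i<d. e (Suc i) * N ^ i) = f 0 + N * (\<Sum>i<d. f (Suc i) * N ^ i)"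
    using Suc.prems(3) unfolding sh .
  from arg_cong[OF eq, of "\<lambda>x. x mod N"] have 0: "e 0 = f 0" using b by simp
  then have s: "(\<Sum>i<d. e (Suc i) * N ^ i) = (\<Sum>i<d. f (Suc i) * N ^ i)" using eq b by simp
  show ?case
  proof (cases i)
    case (Suc j)
    then show ?thesis using Suc.IH[of "\<lambda>i. e (Suc i)" "\<lambda>i. f (Suc i)" j] Suc.prems(1,2,4) s by simp
  qed (use 0 in simp)
qed simp

lemma comm_kalg_polyring_K: "comm_kalg (polyring (K_alg :: ('k::field, 'k) module) d)"
proof -
  interpret PK: monoid_alg "K_alg :: ('k, 'k) module" "exps d" exp_add exp_zero
    by (intro monoid_alg_exps kalg_K_alg)
  have polyring_K: "polyring (K_alg :: ('k, 'k) module) d = PK.MR" by (simp add: polyring_def)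
  interpret kalg PK.MR by (rule PK.kalg_mring)
  have "comm_monoid PK.MR"
    by (rule monoid_comm_monoidI) (auto intro!: PK.mult_comm simp: mult.commute add.commute)
  then have "cring PK.MR" by (intro cring.intro ring_axioms)
  then show ?thesis unfolding polyring_K by (intro comm_kalg.intro kalg_axioms)
qed

text \<open>Kronecker substitution: \<open>wt\<close> encodes an exponent vector as a number in base
  \<open>N\<close>, additively and injectively on the two supports. The terms of largest weight
  multiply to a term that nothing can cancel.\<close>

lemma domain_polyring_K: "domain (polyring (K_alg :: ('k::field, 'k) module) d)"
proof -
  interpret PK: monoid_alg "K_alg :: ('k, 'k) module" "exps d" exp_add exp_zero
    by (intro monoid_alg_exps kalg_K_alg)
  have polyring_K: "polyring (K_alg :: ('k, 'k) module) d = PK.MR" by (simp add: polyring_def)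
  interpret comm_kalg PK.MR unfolding polyring_K[symmetric] by (rule comm_kalg_polyring_K)
  have "domain PK.MR"
  proof (intro domain.intro domain_axioms.intro cring_axioms)
    show "\<one>\<^bsub>PK.MR\<^esub> \<noteq> (\<zero>\<^bsub>PK.MR\<^esub> :: (nat \<Rightarrow> nat) \<Rightarrow> 'k)"
    proof
      assume "\<one>\<^bsub>PK.MR\<^esub> = (\<zero>\<^bsub>PK.MR\<^esub> :: (nat \<Rightarrow> nat) \<Rightarrow> 'k)"
      from fun_cong[OF this, of exp_zero] show False by (simp add: PK.mring_simps PK.mono_def)
    qed
    fix f g :: "(nat \<Rightarrow> nat) \<Rightarrow> 'k" assume fg: "f \<otimes>\<^bsub>PK.MR\<^esub> g = \<zero>\<^bsub>PK.MR\<^esub>" and fc: "f \<in> carrier PK.MR" and gc: "g \<in> carrier PK.MR"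
    show "f = \<zero>\<^bsub>PK.MR\<^esub> \<or> g = \<zero>\<^bsub>PK.MR\<^esub>"
    proof (rule ccontr)
      assume "\<not> ?thesis"
      then have ne: "PK.supp f \<noteq> {}" "PK.supp g \<noteq> {}" by (auto simp: PK.mring_simps PK.supp_def)
      note f = PK.carrierD[OF fc] note g = PK.carrierD[OF gc]
      let ?S = "PK.supp f \<union> PK.supp g"
      \<comment> \<open>One more than the sum of all exponents occurring, hence larger than each of
        them.\<close>
      define N where "N = Suc (\<Sum>e\<in>?S. \<Sum>i<d. e i)"
      define wt where "wt e = (\<Sum>i<d. e i * N ^ i)" for e
      have wt_add: "wt (exp_add u v) = wt u + wt v" for u v
        by (simp add: wt_def sum.distrib add_mult_distrib)
      have less: "e i < N" if "e \<in> ?S" "i < d" for e i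
      proof -
        have "e i \<le> (\<Sum>i<d. e i)" using that by (intro member_le_sum) auto
        also have "\<dots> \<le> (\<Sum>e\<in>?S. \<Sum>i<d. e i)"
          using that f(3) g(3) by (intro member_le_sum[of e ?S "\<lambda>e. \<Sum>i<d. e i"]) auto
        finally show ?thesis by (simp add: N_def)
      qed
      have inj: "e = e'" if "e \<in> ?S" "e' \<in> ?S" "wt e = wt e'" for e e'
      proof
        fix i
        show "e i = e' i"
        proof (cases "i < d")
          case True
          then show ?thesis
            using base_expansion_unique[of d e N e' i] less that by (simp add: wt_def)
        next
          case False
          have "e \<in> exps d" "e' \<in> exps d" using that(1,2) f(2) g(2) by blast+
          then show ?thesis using False by simp
        qed
      qed
      have mx: "\<exists>u\<in>S. \<forall>x\<in>S. wt x \<le> wt u" if S: "finite S" "S \<noteq> {}" for S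
      proof -
        have "Max (wt ` S) \<in> wt ` S" using S by (intro Max_in) auto
        then obtain u where "u \<in> S" "wt u = Max (wt ` S)" by auto
        then show ?thesis using S(1) by (metis Max_ge finite_imageI imageI)
      qed
      obtain u where u: "u \<in> PK.supp f" "\<And>x. x \<in> PK.supp f \<Longrightarrow> wt x \<le> wt u"
        using mx[OF f(3) ne(1)] by blast
      obtain v where v: "v \<in> PK.supp g" "\<And>x. x \<in> PK.supp g \<Longrightarrow> wt x \<le> wt v"
        using mx[OF g(3) ne(2)] by blast
      let ?h = "\<lambda>(x, y). if exp_add x y = exp_add u v then f x \<otimes>\<^bsub>K_alg\<^esub> g y else \<zero>\<^bsub>K_alg\<^esub>"
      have "(f \<otimes>\<^bsub>PK.MR\<^esub> g) (exp_add u v) = finsum K_alg ?h (PK.supp f \<times> PK.supp g)"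
        by (rule PK.mult_eval[OF fc gc f(3) g(3) order_refl order_refl])
      also have "\<dots> = ?h (u, v)"
      proof (rule PK.C.finsum_single_support)
        show "?h p = \<zero>\<^bsub>K_alg\<^esub>" if p: "p \<in> PK.supp f \<times> PK.supp g" "p \<noteq> (u, v)" for p
        proof -
          obtain x y where xy: "p = (x, y)" "x \<in> PK.supp f" "y \<in> PK.supp g" using p(1) by auto
          have "exp_add x y \<noteq> exp_add u v"
          proof
            assume "exp_add x y = exp_add u v"
            then have "wt x + wt y = wt u + wt v" using wt_add by metis
            then have "wt x = wt u" "wt y = wt v" using u(2)[OF xy(2)] v(2)[OF xy(3)] by auto
            then have "x = u" "y = v" using inj[of x u] inj[of y v] xy u(1) v(1) by auto
            then show False using p(2) xy(1) by simp
          qed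
          then show ?thesis using xy(1) by simp
        qed
      qed (use f(3) g(3) u(1) v(1) in auto)
      finally have "f u * g v = 0" using fg by (simp add: PK.mring_simps)
      then show False using u(1) v(1) by (simp add: PK.supp_def)
    qed
  qed
  then show ?thesis unfolding polyring_K .
qed

text \<open>The variables generate: a monomial of positive degree is a variable times a monomial of
  lower degree.\<close>

lemma fin_gen_polyring_K: "kalg_fin_gen (polyring (K_alg :: ('k::field, 'k) module) d)"
proof -
  interpret PK: monoid_alg "K_alg :: ('k, 'k) module" "exps d" exp_add exp_zero
    by (intro monoid_alg_exps kalg_K_alg)
  have polyring_K: "polyring (K_alg :: ('k, 'k) module) d = PK.MR" by (simp add: polyring_def)
  interpret kalg PK.MR by (rule PK.kalg_mring)
  let ?unit = "\<lambda>i j. if j = i then 1 else 0 :: nat"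
  let ?S = "(\<lambda>i. PK.mono (1 :: 'k) (?unit i)) ` {..<d}"
  have "T = carrier PK.MR" if T: "?S \<subseteq> T" "T \<subseteq> carrier PK.MR" "\<one>\<^bsub>PK.MR\<^esub> \<in> T"
    "\<And>x y. x \<in> T \<Longrightarrow> y \<in> T \<Longrightarrow> x \<oplus>\<^bsub>PK.MR\<^esub> y \<in> T" "\<And>x y. x \<in> T \<Longrightarrow> y \<in> T \<Longrightarrow> x \<otimes>\<^bsub>PK.MR\<^esub> y \<in> T"
    "\<And>c x. x \<in> T \<Longrightarrow> c \<odot>\<^bsub>PK.MR\<^esub> x \<in> T" for T
  proof -
    have m1: "PK.mono 1 m \<in> T" if "m \<in> exps d" for m
      using that
    proof (induction "\<Sum>i<d. m i" arbitrary: m)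
      case 0
      have "m i = 0" for i using 0 by (cases "i < d") auto
      then have "m = exp_zero" by auto
      then show ?case using T(3) by (simp add: PK.mring_simps)
    next
      case (Suc k)
      then obtain i where i: "i < d" "m i \<noteq> 0"
        by (metis lessThan_iff nat.distinct(1) sum.neutral)
      let ?m = "m(i := m i - 1)"
      have m: "m = exp_add (?unit i) ?m" using i by auto
      have mM: "?m \<in> exps d" "?unit i \<in> exps d" using Suc.prems i(1) by auto
      have "Suc k = (\<Sum>j<d. ?unit i j) + (\<Sum>j<d. ?m j)"
        unfolding Suc.hyps(2) by (subst m) (simp only: sum.distrib)
      then have "k = (\<Sum>j<d. ?m j)" using i(1) by simp
      then have "PK.mono 1 ?m \<in> T" using Suc.hyps(1) mM by blast
      moreover have "PK.mono 1 (?unit i) \<in> T" using T(1) i(1) by auto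
      ultimately have "PK.mono 1 (?unit i) \<otimes>\<^bsub>PK.MR\<^esub> PK.mono 1 ?m \<in> T" using T(5) by blast
      moreover have "PK.mono 1 (?unit i) \<otimes>\<^bsub>PK.MR\<^esub> PK.mono 1 ?m = PK.mono 1 m"
      proof -
        have "PK.mono 1 (?unit i) \<otimes>\<^bsub>PK.MR\<^esub> PK.mono 1 ?m = PK.mono (1 * 1) (exp_add (?unit i) ?m)"
          using PK.mono_mult[of 1 1 "?unit i" ?m] mM by (simp only: K_alg_simps UNIV_I)
        also have "\<dots> = PK.mono (1 * 1) m" by (rule arg_cong[OF m[symmetric]])
        finally show ?thesis by simp
      qed
      ultimately show ?case by simp
    qed
    have "f \<in> T" if "f \<in> carrier PK.MR" for f using that
    proof (induction f rule: PK.mring_induct)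
      case (mono c m)
      then have "c \<odot>\<^bsub>PK.MR\<^esub> PK.mono 1 m \<in> T" using m1 T(6) by blast
      then show ?case by (simp add: PK.mono_smult)
    qed (rule T(4))
    then show ?thesis using T(2) by blast
  qed
  moreover have "?S \<subseteq> carrier PK.MR" by auto
  ultimately show ?thesis unfolding kalg_fin_gen_def polyring_K
    by (intro exI[of _ ?S] conjI allI impI) (auto simp del: image_subset_iff)
qed

lemma augmentation_polyring_K:
  "(\<lambda>f. f exp_zero) \<in> kalg_hom (polyring (K_alg :: ('k::field, 'k) module) d) K_alg"
proof -
  interpret PK: monoid_alg "K_alg :: ('k, 'k) module" "exps d" exp_add exp_zero
    by (intro monoid_alg_exps kalg_K_alg)
  have polyring_K: "polyring (K_alg :: ('k, 'k) module) d = PK.MR" by (simp add: polyring_def)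
  interpret kalg PK.MR by (rule PK.kalg_mring)
  show ?thesis unfolding polyring_K
  proof (rule kalg_homI)
    fix f g :: "(nat \<Rightarrow> nat) \<Rightarrow> 'k" assume f: "f \<in> carrier PK.MR" and g: "g \<in> carrier PK.MR"
    show "(f \<otimes>\<^bsub>PK.MR\<^esub> g) exp_zero = f exp_zero \<otimes>\<^bsub>K_alg\<^esub> g exp_zero" using f
    proof (induction f rule: PK.mring_induct)
      case f: (mono a u)
      show ?case using g
      proof (induction g rule: PK.mring_induct)
        case (mono b v)
        \<comment> \<open>Exponents are natural numbers, so a product of monomials is constant only
          when both factors are; this is why taking constant terms is multiplicative.\<close>
        have "exp_zero = exp_add u v \<longleftrightarrow> exp_zero = u \<and> exp_zero = v" by (auto simp: fun_eq_iff)
        then show ?case using f mono by (simp add: PK.mono_mult) (simp add: PK.mono_def)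
      next
        case (add g g')
        then show ?case using f by (simp add: r_distr) (simp add: PK.mring_simps distrib_left)
      qed
    next
      case (add f f')
      then show ?case using g by (simp add: l_distr) (simp add: PK.mring_simps distrib_right)
    qed
  qed (simp_all add: PK.mring_simps PK.mono_def)
qed

lemma tens_polyring:
  fixes A :: "('k::field, 'a) module"
  assumes "kalg A"
  shows "\<exists>\<iota> \<kappa>. tens A (polyring (K_alg :: ('k, 'k) module) d) (polyring A d) \<iota> \<kappa>"
proof -
  interpret PK: monoid_alg "K_alg :: ('k, 'k) module" "exps d" exp_add exp_zero
    by (intro monoid_alg_exps kalg_K_alg)
  have polyring_K: "polyring (K_alg :: ('k, 'k) module) d = PK.MR" by (simp add: polyring_def)
  interpret A: kalg A by fact
  interpret PA: monoid_alg A "exps d" exp_add exp_zero by (intro monoid_alg_exps assms)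
  interpret PQ: kalg PA.MR by (rule PA.kalg_mring)
  interpret P: comm_kalg PK.MR unfolding polyring_K[symmetric] by (rule comm_kalg_polyring_K)
  \<comment> \<open>Scalar coefficients become multiples of the unit of A.\<close>
  define \<kappa> :: "((nat \<Rightarrow> nat) \<Rightarrow> 'k) \<Rightarrow> (nat \<Rightarrow> nat) \<Rightarrow> 'a" where "\<kappa> r = (\<lambda>m. r m \<odot>\<^bsub>A\<^esub> \<one>\<^bsub>A\<^esub>)" for r
  define \<iota> where "\<iota> a = PA.mono a exp_zero" for a
  have kc: "\<kappa> r \<in> carrier PA.MR" if "r \<in> carrier PK.MR" for r
  proof (rule PA.carrierI[of _ "PK.supp r"])
    show "\<kappa> r m \<in> carrier A" for m by (simp add: \<kappa>_def)
    show "\<kappa> r m = \<zero>\<^bsub>A\<^esub>" if "m \<notin> PK.supp r" for m using that by (simp add: \<kappa>_def PK.supp_def)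
  qed (use PK.carrierD[OF that] in auto)
  have km: "\<kappa> (PK.mono c m) = PA.mono (c \<odot>\<^bsub>A\<^esub> \<one>\<^bsub>A\<^esub>) m" for c m
    by (auto simp: \<kappa>_def PK.mono_def PA.mono_def)
  have ka: "\<kappa> (r \<oplus>\<^bsub>PK.MR\<^esub> s) = \<kappa> r \<oplus>\<^bsub>PA.MR\<^esub> \<kappa> s" for r s
    by (auto simp: \<kappa>_def PK.mring_simps PA.mring_simps A.smult_l_distr)
  have ic: "\<iota> a \<in> carrier PA.MR" if "a \<in> carrier A" for a using that by (auto simp: \<iota>_def)
  have ikm: "\<iota> a \<otimes>\<^bsub>PA.MR\<^esub> \<kappa> (PK.mono c m) = PA.mono (c \<odot>\<^bsub>A\<^esub> a) m"
    "\<kappa> (PK.mono c m) \<otimes>\<^bsub>PA.MR\<^esub> \<iota> a = PA.mono (c \<odot>\<^bsub>A\<^esub> a) m" if "a \<in> carrier A" "m \<in> exps d" for a c m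
    using that unfolding \<iota>_def km by (subst PA.mono_mult, auto simp: A.mult_smult_one A.smult_one_mult)+
  have "tens A PK.MR PA.MR \<iota> \<kappa>"
  proof (intro tens.intro tens_axioms.intro assms P.comm_kalg_axioms PQ.kalg_axioms)
    show "\<iota> \<in> kalg_hom A PA.MR"
    proof (rule kalg_homI)
      show "\<iota> (x \<otimes>\<^bsub>A\<^esub> y) = \<iota> x \<otimes>\<^bsub>PA.MR\<^esub> \<iota> y" if "x \<in> carrier A" "y \<in> carrier A" for x y
        unfolding \<iota>_def using that by (subst PA.mono_mult) auto
    qed (auto simp: \<iota>_def PA.mono_add PA.mono_smult PA.mring_simps(2))
    show "\<kappa> \<in> kalg_hom PK.MR PA.MR"
    proof (rule kalg_homI)
      show "\<kappa> (f \<otimes>\<^bsub>PK.MR\<^esub> g) = \<kappa> f \<otimes>\<^bsub>PA.MR\<^esub> \<kappa> g" if f: "f \<in> carrier PK.MR" and g: "g \<in> carrier PK.MR" for f g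
        using f
      proof (induction f rule: PK.mring_induct)
        case f: (mono a u)
        show ?case using g
        proof (induction g rule: PK.mring_induct)
          case (mono b v)
          have "PK.mono a u \<otimes>\<^bsub>PK.MR\<^esub> PK.mono b v = PK.mono (a * b) (exp_add u v)"
            using f mono by (subst PK.mono_mult) auto
          moreover have "\<kappa> (PK.mono a u) \<otimes>\<^bsub>PA.MR\<^esub> \<kappa> (PK.mono b v) = PA.mono ((a * b) \<odot>\<^bsub>A\<^esub> \<one>\<^bsub>A\<^esub>) (exp_add u v)"
            unfolding km using f mono by (subst PA.mono_mult) (auto simp: A.smult_one_mult A.smult_smult)
          ultimately show ?case by (simp add: km)
        qed (use f in \<open>simp_all add: P.r_distr PQ.r_distr ka kc\<close>)
      qed (use g in \<open>simp_all add: P.l_distr PQ.l_distr ka kc\<close>)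
      show "\<kappa> \<one>\<^bsub>PK.MR\<^esub> = \<one>\<^bsub>PA.MR\<^esub>" by (simp add: PK.mring_simps(2) PA.mring_simps(2) km)
      show "\<kappa> (c \<odot>\<^bsub>PK.MR\<^esub> f) = c \<odot>\<^bsub>PA.MR\<^esub> \<kappa> f" for c f
        by (simp add: \<kappa>_def PK.mring_simps PA.mring_simps A.smult_smult)
    qed (simp_all add: kc ka)
    fix a r assume a: "a \<in> carrier A" and r: "r \<in> carrier PK.MR"
    show "\<kappa> r \<otimes>\<^bsub>PA.MR\<^esub> \<iota> a = \<iota> a \<otimes>\<^bsub>PA.MR\<^esub> \<kappa> r" using r
    proof (induction r rule: PK.mring_induct)
      case (mono c m)
      then show ?case using a ikm by simp
    qed (use a in \<open>simp_all add: ka kc ic PQ.l_distr PQ.r_distr\<close>)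
  next
    fix u and P :: "_ \<Rightarrow> bool"
    assume *: "u \<in> carrier PA.MR"
      "\<And>a r. a \<in> carrier A \<Longrightarrow> r \<in> carrier PK.MR \<Longrightarrow> P (\<iota> a \<otimes>\<^bsub>PA.MR\<^esub> \<kappa> r)"
      "\<And>u v. u \<in> carrier PA.MR \<Longrightarrow> v \<in> carrier PA.MR \<Longrightarrow> P u \<Longrightarrow> P v \<Longrightarrow> P (u \<oplus>\<^bsub>PA.MR\<^esub> v)"
    show "P u" using *(1)
    proof (induction u rule: PA.mring_induct)
      case (mono a m)
      then show ?case using *(2)[of a "PK.mono 1 m"] ikm(1)[of a m 1] by auto
    qed (rule *(3))
  next
    fix \<rho> assume rho: "linear_functional PK.MR \<rho>"
    \<comment> \<open>The slice replaces each monomial by the value of the functional on it and sums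
      the coefficients accordingly.\<close>
    let ?h = "\<lambda>m a. \<rho> (PK.mono 1 m) \<odot>\<^bsub>A\<^esub> a"
    have h: "additive_map A A (?h m)" for m by (rule A.smult_additive)
    note L = PA.lin_ext_additive[OF A.abelian_group_axioms h] PA.lin_ext_mono[OF A.abelian_group_axioms h]
    let ?L = "PA.lin_ext A ?h"
    have "?L (\<iota> a \<otimes>\<^bsub>PA.MR\<^esub> \<kappa> r) = \<rho> r \<odot>\<^bsub>A\<^esub> a" if a: "a \<in> carrier A" and r: "r \<in> carrier PK.MR" for a r
      using r
    proof (induction r rule: PK.mring_induct)
      case (mono c m)
      have "\<rho> (PK.mono c m) = \<rho> (c \<odot>\<^bsub>PK.MR\<^esub> PK.mono 1 m)" by (simp add: PK.mono_smult)
      also have "\<dots> = c * \<rho> (PK.mono 1 m)"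
        using rho mono PK.mono_closed[of 1 m] unfolding linear_functional_def by simp
      finally show ?case using mono a L(2)[of "c \<odot>\<^bsub>A\<^esub> a" m]
        by (simp add: ikm A.smult_smult mult.commute)
    next
      case (add r s)
      have "?L (\<iota> a \<otimes>\<^bsub>PA.MR\<^esub> \<kappa> r \<oplus>\<^bsub>PA.MR\<^esub> \<iota> a \<otimes>\<^bsub>PA.MR\<^esub> \<kappa> s) =
        ?L (\<iota> a \<otimes>\<^bsub>PA.MR\<^esub> \<kappa> r) \<oplus>\<^bsub>A\<^esub> ?L (\<iota> a \<otimes>\<^bsub>PA.MR\<^esub> \<kappa> s)"
        using L(1) add a ic kc unfolding additive_map_def by simp
      then show ?case using add a rho
        by (simp add: ka kc ic PQ.r_distr A.smult_l_distr linear_functional_def)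
    qed
    then show "\<exists>L. additive_map PA.MR A L \<and>
        (\<forall>a\<in>carrier A. \<forall>r\<in>carrier PK.MR. L (\<iota> a \<otimes>\<^bsub>PA.MR\<^esub> \<kappa> r) = \<rho> r \<odot>\<^bsub>A\<^esub> a)"
      using L(1) by (intro exI[of _ ?L] conjI ballI)
  qed
  then show ?thesis unfolding polyring_def by (intro exI)
qed

section \<open>The center of the quantum Weyl algebra\<close>

definition fun_mod :: "('k::field, 'i \<Rightarrow> 'k) module" where
  "fun_mod = \<lparr>carrier = UNIV, monoid.mult = (\<lambda>f g. f), one = (\<lambda>_. 0), ring.zero = (\<lambda>_. 0),
     ring.add = (\<lambda>f g s. f s + g s), smult = (\<lambda>c f s. c * f s)\<rparr>"

lemma fun_mod_simps [simp]:
  "carrier fun_mod = UNIV" "\<zero>\<^bsub>fun_mod\<^esub> = (\<lambda>_. 0)" "f \<oplus>\<^bsub>fun_mod\<^esub> g = (\<lambda>s. f s + g s)"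
  "c \<odot>\<^bsub>fun_mod\<^esub> f = (\<lambda>s. c * f s)"
  by (simp_all add: fun_mod_def)

lemma kmod_fun_mod: "kmod (fun_mod :: ('k::field, 'i \<Rightarrow> 'k) module)"
proof -
  have "abelian_group (fun_mod :: ('k, 'i \<Rightarrow> 'k) module)"
  proof (rule abelian_groupI)
    show "\<exists>y\<in>carrier fun_mod. y \<oplus>\<^bsub>fun_mod\<^esub> x = \<zero>\<^bsub>fun_mod\<^esub>" for x :: "'i \<Rightarrow> 'k"
      by (rule bexI[of _ "\<lambda>s. - x s"]) simp_all
  qed (simp_all add: add.assoc add.commute add.left_commute)
  then show ?thesis
    by (intro kmod.intro kmod_axioms.intro) (simp_all add: distrib_left distrib_right mult.assoc)
qed

lemma fun_mod_minus: "(f \<ominus>\<^bsub>fun_mod\<^esub> g :: 'i \<Rightarrow> 'k::field) = (\<lambda>s. f s - g s)"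
proof -
  interpret kmod "fun_mod :: ('k, 'i \<Rightarrow> 'k) module" by (rule kmod_fun_mod)
  have "\<ominus>\<^bsub>fun_mod\<^esub> g = (\<lambda>s. - g s)" by (rule minus_equality) simp_all
  then show ?thesis by (simp add: a_minus_def)
qed

locale qw =
  fixes n :: nat and q :: "nat \<Rightarrow> 'k::field" and \<Lambda> :: "nat \<Rightarrow> nat \<Rightarrow> 'k"
  assumes q_nz: "i \<in> {1..n} \<Longrightarrow> q i \<noteq> 0"
    and L_nz: "i \<in> {1..n} \<Longrightarrow> j \<in> {1..n} \<Longrightarrow> \<Lambda> i j \<noteq> 0"
    and L_inv: "i \<in> {1..n} \<Longrightarrow> j \<in> {1..n} \<Longrightarrow> \<Lambda> i j = inverse (\<Lambda> j i)"
    and q_not_root: "i \<in> {1..n} \<Longrightarrow> m \<ge> 1 \<Longrightarrow> q i ^ m \<noteq> 1"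
begin

lemma q_powi_eq_1_iff:
  assumes "i \<in> {1..n}"
  shows "q i powi d = 1 \<longleftrightarrow> d = 0"
proof
  assume *: "q i powi d = 1"
  have pos: False if "e > 0" "q i powi e = 1" for e :: int
    using that q_not_root[OF assms, of "nat e"] by (simp add: power_int_def)
  show "d = 0"
  proof (rule ccontr)
    assume "d \<noteq> 0"
    moreover have "q i powi (- d) = 1" using * by (simp add: power_int_minus)
    ultimately show False using pos[of d] pos[of "- d"] * by linarith
  qed
qed simp

lemma q_powi_inj:
  assumes "i \<in> {1..n}" "q i powi d = q i powi e"
  shows "d = e"
proof -
  have "q i powi (d - e) = 1" using assms q_nz[OF assms(1)] by (simp add: power_int_diff)
  then show ?thesis using q_powi_eq_1_iff[OF assms(1)] by simp
qed

text \<open>The algebra acts on functions on \<open>\<int>\<^sup>n\<close>, thought of as formal combinations of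
  monomials: \<open>y\<^sub>i\<close> is multiplication and \<open>x\<^sub>i\<close> the \<open>q\<^sub>i\<close>-derivative, with the factor \<open>tw i\<close>
  accounting for moving past the variables of smaller index.\<close>

definition tw :: "nat \<Rightarrow> (nat \<Rightarrow> int) \<Rightarrow> 'k" where
  "tw i \<kappa> = (\<Prod>j\<in>{1..<i}. \<Lambda> i j powi \<kappa> j)"

text \<open>The q-integer [m] for q = \<open>q i\<close>, also for negative m.\<close>

definition br :: "nat \<Rightarrow> int \<Rightarrow> 'k" where
  "br i m = (q i powi m - 1) / (q i - 1)"

text \<open>Operators are described by their effect on coefficients: \<open>gs g \<kappa>\<close> is
  a weight and \<open>mv g \<kappa>\<close> the exponent read off. Since \<open>y\<^sub>i\<close>
  raises an exponent, the coefficient at \<open>\<kappa>\<close> comes from \<open>\<kappa>\<close>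
  lowered at i; for \<open>x\<^sub>i\<close> it comes from \<open>\<kappa>\<close> raised at i,
  which explains the \<open>+ 1\<close> in the q-integer.\<close>

fun gs :: "gen \<Rightarrow> (nat \<Rightarrow> int) \<Rightarrow> 'k" where
  "gs (GY i) \<kappa> = tw i \<kappa>"
| "gs (GX i) \<kappa> = inverse (tw i \<kappa>) * br i (\<kappa> i + 1)"

fun mv :: "gen \<Rightarrow> (nat \<Rightarrow> int) \<Rightarrow> nat \<Rightarrow> int" where
  "mv (GY i) \<kappa> = \<kappa>(i := \<kappa> i - 1)"
| "mv (GX i) \<kappa> = \<kappa>(i := \<kappa> i + 1)"

definition opg :: "gen \<Rightarrow> ((nat \<Rightarrow> int) \<Rightarrow> 'k) \<Rightarrow> (nat \<Rightarrow> int) \<Rightarrow> 'k" where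
  "opg g v = (\<lambda>\<kappa>. gs g \<kappa> * v (mv g \<kappa>))"

definition rho :: "gen list \<Rightarrow> ((nat \<Rightarrow> int) \<Rightarrow> 'k) \<Rightarrow> (nat \<Rightarrow> int) \<Rightarrow> 'k" where
  "rho w v = foldr opg w v"

fun sc :: "gen list \<Rightarrow> (nat \<Rightarrow> int) \<Rightarrow> 'k" where
  "sc [] \<kappa> = 1"
| "sc (g # w) \<kappa> = gs g \<kappa> * sc w (mv g \<kappa>)"

fun mvs :: "gen list \<Rightarrow> (nat \<Rightarrow> int) \<Rightarrow> nat \<Rightarrow> int" where
  "mvs [] \<kappa> = \<kappa>"
| "mvs (g # w) \<kappa> = mvs w (mv g \<kappa>)"

lemma rho_Cons: "rho (g # w) v = opg g (rho w v)" and rho_Nil [simp]: "rho [] v = v"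
  by (simp_all add: rho_def)

text \<open>Every word acts as a weighted shift, so its action is governed by one scalar and one
  displacement; the latter depends only on letter counts.\<close>

lemma rho_eq: "rho w v \<kappa> = sc w \<kappa> * v (mvs w \<kappa>)"
  by (induction w arbitrary: \<kappa>) (simp_all add: rho_Cons opg_def)

lemma sc_append: "sc (w @ w') \<kappa> = sc w \<kappa> * sc w' (mvs w \<kappa>)"
  by (induction w arbitrary: \<kappa>) simp_all

lemma mvs_apply: "mvs w \<kappa> i = \<kappa> i - int (count_list w (GY i)) + int (count_list w (GX i))"
proof (induction w arbitrary: \<kappa>)
  case (Cons g w)
  then show ?case by (cases g) auto
qed simp

lemma tw_nz: "i \<in> {1..n} \<Longrightarrow> tw i \<kappa> \<noteq> 0"
  by (auto simp: tw_def L_nz)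

lemma tw_upd_ge [simp]: "j \<ge> i \<Longrightarrow> tw i (\<kappa>(j := x)) = tw i \<kappa>"
  unfolding tw_def by (rule prod.cong) auto

lemma tw_upd_less:
  assumes "j \<in> {1..<i}" "i \<in> {1..n}"
  shows "tw i (\<kappa>(j := \<kappa> j + s)) = tw i \<kappa> * \<Lambda> i j powi s"
proof -
  have L: "\<Lambda> i j \<noteq> 0" using assms by (intro L_nz) auto
  have "tw i (\<kappa>(j := \<kappa> j + s)) = \<Lambda> i j powi (\<kappa> j + s) * (\<Prod>l\<in>{1..<i} - {j}. \<Lambda> i l powi (\<kappa>(j := \<kappa> j + s)) l)"
    unfolding tw_def using assms by (subst prod.remove[of _ j]) auto
  also have "(\<Prod>l\<in>{1..<i} - {j}. \<Lambda> i l powi (\<kappa>(j := \<kappa> j + s)) l) = (\<Prod>l\<in>{1..<i} - {j}. \<Lambda> i l powi \<kappa> l)"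
    by (rule prod.cong) auto
  also have "\<Lambda> i j powi (\<kappa> j + s) * \<dots> = tw i \<kappa> * \<Lambda> i j powi s"
    unfolding tw_def using assms L by (subst (2) prod.remove[of _ j]) (auto simp: power_int_add)
  finally show ?thesis .
qed

lemma tw_plus: "j \<in> {1..<i} \<Longrightarrow> i \<in> {1..n} \<Longrightarrow> tw i (\<kappa>(j := \<kappa> j + 1)) = tw i \<kappa> * \<Lambda> i j"
  using tw_upd_less[of j i \<kappa> 1] by simp

lemma tw_minus: "j \<in> {1..<i} \<Longrightarrow> i \<in> {1..n} \<Longrightarrow> tw i (\<kappa>(j := \<kappa> j - 1)) = tw i \<kappa> * inverse (\<Lambda> i j)"
  using tw_upd_less[of j i \<kappa> "- 1"] by (simp add: power_int_minus)

lemma q_neq_1: "i \<in> {1..n} \<Longrightarrow> q i \<noteq> 1"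
  using q_not_root[of i 1] by simp

lemma br_eq_0_iff: "i \<in> {1..n} \<Longrightarrow> br i m = 0 \<longleftrightarrow> m = 0"
  using q_neq_1[of i] q_powi_eq_1_iff[of i m] by (auto simp: br_def)

text \<open>The first identity is the relation between \<open>x\<^sub>i\<close> and
  \<open>y\<^sub>i\<close> on monomials; the second gives the eigenvalues of their
  commutator.\<close>

lemma br_rec:
  assumes "i \<in> {1..n}"
  shows "br i (m + 1) = q i * br i m + 1" "br i (m + 1) - br i m = q i powi m"
proof -
  have q: "q i - 1 \<noteq> 0" "q i \<noteq> 0" using q_neq_1[OF assms] q_nz[OF assms] by auto
  then show "br i (m + 1) = q i * br i m + 1"
    by (simp add: br_def power_int_add field_simps)
  have "br i (m + 1) - br i m = (q i powi m * (q i - 1)) / (q i - 1)"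
    using q(2) by (simp add: br_def power_int_add algebra_simps flip: diff_divide_distrib)
  then show "br i (m + 1) - br i m = q i powi m" using q(1) by simp
qed

section \<open>The action of the free algebra and of its quotient\<close>

interpretation fa: monoid_rep "lists (gens n)" "(@)" "[]" "fun_mod :: ('k, (nat \<Rightarrow> int) \<Rightarrow> 'k) module" rho
proof (intro monoid_rep.intro monoid_alg.intro kalg_K_alg kmod_fun_mod monoid_alg_axioms.intro monoid_rep_axioms.intro)
  fix u v :: "gen list" and w w' :: "(nat \<Rightarrow> int) \<Rightarrow> 'k" and c :: 'k
  show "rho (u @ v) w = rho u (rho v w)" by (simp add: rho_def)
  show "rho u (w \<oplus>\<^bsub>fun_mod\<^esub> w') = rho u w \<oplus>\<^bsub>fun_mod\<^esub> rho u w'"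
    by (simp add: rho_eq fun_eq_iff distrib_left)
  show "rho u (c \<odot>\<^bsub>fun_mod\<^esub> w) = c \<odot>\<^bsub>fun_mod\<^esub> rho u w"
    by (simp add: rho_eq fun_eq_iff)
qed auto

abbreviation "FA \<equiv> free_alg n :: ('k, gen list \<Rightarrow> 'k) module"

lemma FA_eq: "FA = fa.MR" by (simp add: free_alg_def)

interpretation FA: kalg FA unfolding FA_eq by (rule fa.kalg_mring)

definition act :: "(gen list \<Rightarrow> 'k) \<Rightarrow> ((nat \<Rightarrow> int) \<Rightarrow> 'k) \<Rightarrow> (nat \<Rightarrow> int) \<Rightarrow> 'k" where
  "act = fa.act"

lemma act_add: "f \<in> carrier FA \<Longrightarrow> g \<in> carrier FA \<Longrightarrow> act (f \<oplus>\<^bsub>FA\<^esub> g) v \<kappa> = act f v \<kappa> + act g v \<kappa>"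
  using fa.act_add[of f g v] by (simp add: act_def FA_eq)

lemma act_minus: "f \<in> carrier FA \<Longrightarrow> g \<in> carrier FA \<Longrightarrow> act (f \<ominus>\<^bsub>FA\<^esub> g) v \<kappa> = act f v \<kappa> - act g v \<kappa>"
  using fa.act_minus[of f g v] by (simp add: act_def FA_eq fun_mod_minus)

lemma act_smult: "f \<in> carrier FA \<Longrightarrow> act (c \<odot>\<^bsub>FA\<^esub> f) v \<kappa> = c * act f v \<kappa>"
  using fa.act_smult[of f v c] by (simp add: act_def FA_eq)

lemma act_arg_smult: "f \<in> carrier FA \<Longrightarrow> act f (\<lambda>x. c * v x) \<kappa> = c * act f v \<kappa>"
  using fa.act_arg_smult[of f v c] by (simp add: act_def FA_eq)

lemma act_mult: "f \<in> carrier FA \<Longrightarrow> g \<in> carrier FA \<Longrightarrow> act (f \<otimes>\<^bsub>FA\<^esub> g) v = act f (act g v)"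
  using fa.act_mult[of f g v] by (simp add: act_def FA_eq)

lemma act_delta: "w \<in> lists (gens n) \<Longrightarrow> act (delta w) v \<kappa> = sc w \<kappa> * v (mvs w \<kappa>)"
  using fa.act_delta[of w v] by (simp add: act_def rho_eq)

lemma delta_closed [simp]: "w \<in> lists (gens n) \<Longrightarrow> (delta w :: _ \<Rightarrow> 'k) \<in> carrier FA"
  unfolding FA_eq fa.delta_eq_mono by (rule fa.mono_closed) auto

lemma delta_funcset: "F \<subseteq> lists (gens n) \<Longrightarrow> (delta :: _ \<Rightarrow> _ \<Rightarrow> 'k) \<in> F \<rightarrow> carrier FA"
  by (intro Pi_I delta_closed) (rule subsetD)

lemma delta_mult:
  "w \<in> lists (gens n) \<Longrightarrow> w' \<in> lists (gens n) \<Longrightarrow> (delta w :: _ \<Rightarrow> 'k) \<otimes>\<^bsub>FA\<^esub> delta w' = delta (w @ w')"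
  unfolding FA_eq fa.delta_eq_mono by (subst fa.mono_mult) auto

lemma delta_Nil: "(delta [] :: _ \<Rightarrow> 'k) = \<one>\<^bsub>FA\<^esub>"
  unfolding FA_eq fa.delta_eq_mono by (simp add: fa.mring_simps)

lemma FA_induct [consumes 1, case_names delta add]:
  assumes "f \<in> carrier FA"
    and "\<And>c w. w \<in> lists (gens n) \<Longrightarrow> P (c \<odot>\<^bsub>FA\<^esub> delta w)"
    and "\<And>f g. f \<in> carrier FA \<Longrightarrow> g \<in> carrier FA \<Longrightarrow> P f \<Longrightarrow> P g \<Longrightarrow> P (f \<oplus>\<^bsub>FA\<^esub> g)"
  shows "P f"
  using assms(1) unfolding FA_eq
proof (induction f rule: fa.mring_induct)
  case (mono c w)
  then have "P (c \<odot>\<^bsub>FA\<^esub> delta w)" by (intro assms(2))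
  then show ?case by (simp add: FA_eq fa.delta_eq_mono fa.mono_smult)
next
  case (add f g)
  then show ?case using assms(3)[of f g] unfolding FA_eq by blast
qed

abbreviation "II \<equiv> genideal FA (qw_rels n q \<Lambda>)"

lemma gensI [simp]: "i \<in> {1..n} \<Longrightarrow> GX i \<in> gens n" "i \<in> {1..n} \<Longrightarrow> GY i \<in> gens n"
  by (auto simp: gens_def)

lemma qw_rels_closed: "qw_rels n q \<Lambda> \<subseteq> carrier FA"
  unfolding qw_rels_def by (auto intro!: FA.minus_closed FA.smult_closed delta_closed)

lemma ideal_II: "ideal II FA"
  by (rule FA.genideal_ideal[OF qw_rels_closed])

lemma rels_in_II: "x \<in> qw_rels n q \<Lambda> \<Longrightarrow> x \<in> II"
  using FA.genideal_self[OF qw_rels_closed] by blast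

text \<open>For i < j only \<open>tw j\<close> depends on the i-th exponent, and shifting that
  exponent by one contributes \<open>\<Lambda> j i\<close> or its inverse. The relation within one
  index is the recurrence of q-integers, the twists cancelling.\<close>

lemma act_rels:
  assumes "x \<in> qw_rels n q \<Lambda>"
  shows "act x v \<kappa> = 0"
  using assms unfolding qw_rels_def
proof (elim UnE CollectE exE conjE)
  fix i j assume *: "x = delta [GX i, GX j] \<ominus>\<^bsub>FA\<^esub> \<Lambda> i j \<odot>\<^bsub>FA\<^esub> delta [GX j, GX i]" "1 \<le> i" "i < j" "j \<le> n"
  have ij: "i \<in> {1..n}" "j \<in> {1..n}" "i \<in> {1..<j}" using * by auto
  show ?thesis unfolding *(1) using ij *(3) L_inv[of i j] tw_nz[of i \<kappa>] tw_nz[of j \<kappa>] L_nz[of j i]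
    by (simp add: act_minus act_smult act_delta tw_plus fun_upd_twist)
next
  fix i j assume *: "x = delta [GY j, GY i] \<ominus>\<^bsub>FA\<^esub> \<Lambda> j i \<odot>\<^bsub>FA\<^esub> delta [GY i, GY j]" "1 \<le> i" "i < j" "j \<le> n"
  have ij: "i \<in> {1..n}" "j \<in> {1..n}" "i \<in> {1..<j}" using * by auto
  show ?thesis unfolding *(1) using ij *(3) L_inv[of i j] tw_nz[of i \<kappa>] tw_nz[of j \<kappa>] L_nz[of j i]
    by (simp add: act_minus act_smult act_delta tw_minus fun_upd_twist)
next
  fix i j assume *: "x = delta [GX i, GY j] \<ominus>\<^bsub>FA\<^esub> \<Lambda> j i \<odot>\<^bsub>FA\<^esub> delta [GY j, GX i]" "1 \<le> i" "i < j" "j \<le> n"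
  have ij: "i \<in> {1..n}" "j \<in> {1..n}" "i \<in> {1..<j}" using * by auto
  show ?thesis unfolding *(1) using ij *(3) L_inv[of i j] tw_nz[of i \<kappa>] tw_nz[of j \<kappa>] L_nz[of j i]
    by (simp add: act_minus act_smult act_delta tw_plus fun_upd_twist)
next
  fix i j assume *: "x = delta [GX j, GY i] \<ominus>\<^bsub>FA\<^esub> \<Lambda> i j \<odot>\<^bsub>FA\<^esub> delta [GY i, GX j]" "1 \<le> i" "i < j" "j \<le> n"
  have ij: "i \<in> {1..n}" "j \<in> {1..n}" "i \<in> {1..<j}" using * by auto
  show ?thesis unfolding *(1) using ij *(3) L_inv[of i j] tw_nz[of i \<kappa>] tw_nz[of j \<kappa>] L_nz[of j i]
    by (simp add: act_minus act_smult act_delta tw_minus fun_upd_twist)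
next
  fix i assume *: "x = delta [GX i, GY i] \<ominus>\<^bsub>FA\<^esub> q i \<odot>\<^bsub>FA\<^esub> delta [GY i, GX i] \<ominus>\<^bsub>FA\<^esub> delta []" "1 \<le> i" "i \<le> n"
  have i: "i \<in> {1..n}" using * by auto
  show ?thesis unfolding *(1) using i tw_nz[of i \<kappa>] br_rec(1)[OF i, of "\<kappa> i"]
    by (simp add: act_minus act_smult act_delta algebra_simps)
qed

lemma act_II:
  assumes "f \<in> II"
  shows "act f v \<kappa> = 0"
proof -
  let ?J = "{f \<in> carrier FA. \<forall>w\<in>carrier fun_mod. fa.act f w = \<zero>\<^bsub>fun_mod\<^esub>}"
  have "qw_rels n q \<Lambda> \<subseteq> ?J"
    using act_rels qw_rels_closed by (auto simp: act_def fun_eq_iff)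
  moreover have "ideal ?J FA" unfolding FA_eq by (rule fa.act_kernel_ideal)
  ultimately have "II \<subseteq> ?J" by (intro FA.genideal_minimal)
  then have "fa.act f v = (\<lambda>_. 0)" using assms by auto
  then show ?thesis by (simp add: act_def)
qed

interpretation Q: kalg_quotient FA II
  by (intro kalg_quotient.intro ideal_II FA.kalg_axioms)

abbreviation "AA \<equiv> qweyl n q \<Lambda>"

lemma AA_eq: "AA = kquot FA II" by (simp add: qweyl_def)

lemma kalg_qweyl: "kalg AA" unfolding AA_eq by (rule Q.kalg_kquot)

interpretation AA: kalg AA by (rule kalg_qweyl)

lemmas proj_hom = Q.proj_hom[folded AA_eq]
lemmas proj = kalg_homD(2-6)[OF proj_hom]

section \<open>Words in the quotient and their reduction to normal words\<close>

definition W :: "gen list \<Rightarrow> (gen list \<Rightarrow> 'k) set" where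
  "W w = Q.proj (delta w)"

lemma W_closed [simp]: "w \<in> lists (gens n) \<Longrightarrow> W w \<in> carrier AA"
  unfolding W_def by (intro proj delta_closed)

lemma W_append: "w \<in> lists (gens n) \<Longrightarrow> w' \<in> lists (gens n) \<Longrightarrow> W (w @ w') = W w \<otimes>\<^bsub>AA\<^esub> W w'"
  unfolding W_def by (simp add: delta_mult flip: proj(3))

lemma W_Cons: "g \<in> gens n \<Longrightarrow> w \<in> lists (gens n) \<Longrightarrow> W (g # w) = W [g] \<otimes>\<^bsub>AA\<^esub> W w"
  using W_append[of "[g]" w] by simp

lemma W_Nil: "W [] = \<one>\<^bsub>AA\<^esub>"
  unfolding W_def delta_Nil by (rule proj)

lemma W_rel:
  assumes "delta w \<ominus>\<^bsub>FA\<^esub> c \<odot>\<^bsub>FA\<^esub> delta w' \<in> qw_rels n q \<Lambda>" "w \<in> lists (gens n)" "w' \<in> lists (gens n)"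
  shows "W w = c \<odot>\<^bsub>AA\<^esub> W w'"
  using rels_in_II[OF assms(1)] assms(2,3) unfolding W_def
  by (simp add: Q.proj_eq_iff flip: proj(5))

lemma W_rel_XY:
  assumes "i \<in> {1..n}"
  shows "W [GX i, GY i] = q i \<odot>\<^bsub>AA\<^esub> W [GY i, GX i] \<oplus>\<^bsub>AA\<^esub> W []"
proof -
  have "delta [GX i, GY i] \<ominus>\<^bsub>FA\<^esub> q i \<odot>\<^bsub>FA\<^esub> delta [GY i, GX i] \<ominus>\<^bsub>FA\<^esub> delta [] \<in> II"
    using assms by (intro rels_in_II) (auto simp: qw_rels_def)
  then have "delta [GX i, GY i] \<ominus>\<^bsub>FA\<^esub> (q i \<odot>\<^bsub>FA\<^esub> delta [GY i, GX i] \<oplus>\<^bsub>FA\<^esub> delta []) \<in> II"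
    using assms by (simp add: FA.minus_minus_eq)
  then show ?thesis unfolding W_def using assms
    by (simp add: Q.proj_eq_iff flip: proj(5) proj(2))
qed

fun idx :: "gen \<Rightarrow> nat" where "idx (GX i) = i" | "idx (GY i) = i"

lemma gens_iff: "g \<in> gens n \<longleftrightarrow> idx g \<in> {1..n}"
  by (cases g) (auto simp: gens_def)

text \<open>All four relations between different indices are commutations up to a nonzero scalar.
  Two of them carry the larger index on the left and have to be inverted.\<close>

lemma W_swap_less:
  assumes "idx g < idx h" "g \<in> gens n" "h \<in> gens n"
  shows "\<exists>c. c \<noteq> 0 \<and> W [g, h] = c \<odot>\<^bsub>AA\<^esub> W [h, g]"
proof -
  obtain i j where ij: "idx g = i" "idx h = j" "i < j" "i \<in> {1..n}" "j \<in> {1..n}"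
    using assms by (auto simp: gens_iff)
  have nz: "\<Lambda> i j \<noteq> 0" "\<Lambda> j i \<noteq> 0" using ij L_nz by auto
  have sym: "W w' = inverse c \<odot>\<^bsub>AA\<^esub> W w" if "W w = c \<odot>\<^bsub>AA\<^esub> W w'" "c \<noteq> 0" "w' \<in> lists (gens n)" for w w' c
    using that by (simp add: AA.smult_smult)
  have XX: "W [GX i, GX j] = \<Lambda> i j \<odot>\<^bsub>AA\<^esub> W [GX j, GX i]"
    by (rule W_rel) (use ij in \<open>auto simp: qw_rels_def\<close>)
  have YY: "W [GY j, GY i] = \<Lambda> j i \<odot>\<^bsub>AA\<^esub> W [GY i, GY j]"
    by (rule W_rel) (use ij in \<open>auto simp: qw_rels_def\<close>)
  have XY: "W [GX i, GY j] = \<Lambda> j i \<odot>\<^bsub>AA\<^esub> W [GY j, GX i]"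
    by (rule W_rel) (use ij in \<open>auto simp: qw_rels_def\<close>)
  have YX: "W [GX j, GY i] = \<Lambda> i j \<odot>\<^bsub>AA\<^esub> W [GY i, GX j]"
    by (rule W_rel) (use ij in \<open>auto simp: qw_rels_def\<close>)
  show ?thesis
  proof (cases g; cases h)
    fix i' j' assume "g = GX i'" "h = GX j'"
    then show ?thesis using XX nz ij by auto
  next
    fix i' j' assume "g = GX i'" "h = GY j'"
    then show ?thesis using XY nz ij by auto
  next
    fix i' j' assume "g = GY i'" "h = GX j'"
    then show ?thesis using sym[OF YX] nz ij by (intro exI[of _ "inverse (\<Lambda> i j)"]) auto
  next
    fix i' j' assume "g = GY i'" "h = GY j'"
    then show ?thesis using sym[OF YY] nz ij by (intro exI[of _ "inverse (\<Lambda> j i)"]) auto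
  qed
qed

lemma W_swap:
  assumes "idx g \<noteq> idx h" "g \<in> gens n" "h \<in> gens n"
  shows "\<exists>c. W [g, h] = c \<odot>\<^bsub>AA\<^esub> W [h, g]"
proof (cases "idx g < idx h")
  case True
  then show ?thesis using W_swap_less assms by blast
next
  case False
  then obtain c where "c \<noteq> 0" "W [h, g] = c \<odot>\<^bsub>AA\<^esub> W [g, h]" using W_swap_less[of h g] assms by auto
  then have "W [g, h] = inverse c \<odot>\<^bsub>AA\<^esub> W [h, g]" using assms by (simp add: AA.smult_smult)
  then show ?thesis by blast
qed

lemma W_swap_word:
  assumes "g \<in> gens n" "w \<in> lists (gens n)" "idx g \<notin> idx ` set w"
  shows "\<exists>c. W (g # w) = c \<odot>\<^bsub>AA\<^esub> W (w @ [g])"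
  using assms(2,3)
proof (induction w rule: list.induct)
  case Nil
  then show ?case using assms(1) by (intro exI[of _ 1]) simp
next
  case (Cons h w)
  then have h: "h \<in> gens n" "w \<in> lists (gens n)" by auto
  obtain c where c: "W [g, h] = c \<odot>\<^bsub>AA\<^esub> W [h, g]" using W_swap[of g h] assms(1) h Cons.prems(2) by auto
  obtain d where d: "W (g # w) = d \<odot>\<^bsub>AA\<^esub> W (w @ [g])" using Cons by auto
  have "W (g # h # w) = W [g, h] \<otimes>\<^bsub>AA\<^esub> W w" using W_append[of "[g, h]" w] assms(1) h by simp
  also have "\<dots> = c \<odot>\<^bsub>AA\<^esub> (W [h, g] \<otimes>\<^bsub>AA\<^esub> W w)" using c assms(1) h by (simp add: AA.smult_mult_l)
  also have "W [h, g] \<otimes>\<^bsub>AA\<^esub> W w = W [h] \<otimes>\<^bsub>AA\<^esub> W (g # w)"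
    using W_append[of "[h, g]" w] W_append[of "[h]" "g # w"] assms(1) h by simp
  also have "\<dots> = d \<odot>\<^bsub>AA\<^esub> W (h # w @ [g])"
    using d W_append[of "[h]" "w @ [g]"] assms(1) h by (simp add: AA.smult_mult_r)
  finally have "W (g # h # w) = (c * d) \<odot>\<^bsub>AA\<^esub> W (h # w @ [g])" using assms(1) h by (simp add: AA.smult_smult)
  then show ?case by auto
qed

text \<open>The normal order within one index puts the \<open>y\<close> letters before the
  \<open>x\<close> letters.\<close>

definition block :: "nat \<Rightarrow> nat \<Rightarrow> nat \<Rightarrow> gen list" where
  "block k a b = replicate a (GY k) @ replicate b (GX k)"

lemma replicate_gens [simp]: "g \<in> gens n \<Longrightarrow> replicate a g \<in> lists (gens n)"
  by (induction a) auto

lemma block_lists [simp]: "k \<in> {1..n} \<Longrightarrow> block k a b \<in> lists (gens n)"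
  unfolding block_def using replicate_gens[of "GY k" a] replicate_gens[of "GX k" b] by simp

text \<open>The recursion in the proof gives the (a+1)-st power of \<open>q k\<close> for
  \<open>c\<close> and the q-integer of a + 1 for \<open>d\<close>; membership in a span requires
  only that such scalars exist.\<close>

lemma W_X_Ys:
  assumes k: "k \<in> {1..n}"
  shows "\<exists>c d. W (GX k # replicate (Suc a) (GY k)) =
    c \<odot>\<^bsub>AA\<^esub> W (replicate (Suc a) (GY k) @ [GX k]) \<oplus>\<^bsub>AA\<^esub> d \<odot>\<^bsub>AA\<^esub> W (replicate a (GY k))"
proof (induction a)
  case 0
  then show ?case using W_rel_XY[OF k] k
    by (intro exI[of _ "q k"] exI[of _ 1]) simp
next
  case (Suc a)
  let ?Y = "replicate (Suc a) (GY k)"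
  have Y: "?Y \<in> lists (gens n)" "replicate a (GY k) \<in> lists (gens n)" using k by (auto intro!: replicate_gens simp del: replicate.simps)
  have g: "GX k \<in> gens n" "GY k \<in> gens n" using k by auto
  from Suc obtain c d where cd: "W (GX k # ?Y) = c \<odot>\<^bsub>AA\<^esub> W (?Y @ [GX k]) \<oplus>\<^bsub>AA\<^esub> d \<odot>\<^bsub>AA\<^esub> W (replicate a (GY k))"
    by blast
  have "W (GX k # replicate (Suc (Suc a)) (GY k)) = W [GX k, GY k] \<otimes>\<^bsub>AA\<^esub> W ?Y"
    using W_append[of "[GX k, GY k]" ?Y] Y g by simp
  also have "\<dots> = q k \<odot>\<^bsub>AA\<^esub> (W [GY k, GX k] \<otimes>\<^bsub>AA\<^esub> W ?Y) \<oplus>\<^bsub>AA\<^esub> W ?Y"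
    using Y(1) g by (simp add: W_rel_XY[OF k] W_Nil AA.l_distr AA.smult_mult_l del: replicate.simps)
  also have "W [GY k, GX k] \<otimes>\<^bsub>AA\<^esub> W ?Y = W [GY k] \<otimes>\<^bsub>AA\<^esub> W (GX k # ?Y)"
    using W_append[of "[GY k, GX k]" ?Y] W_append[of "[GY k]" "GX k # ?Y"] Y(1) g by simp
  also have "\<dots> = c \<odot>\<^bsub>AA\<^esub> W (GY k # ?Y @ [GX k]) \<oplus>\<^bsub>AA\<^esub> d \<odot>\<^bsub>AA\<^esub> W ?Y"
  proof -
    have "W [GY k] \<otimes>\<^bsub>AA\<^esub> W (?Y @ [GX k]) = W (GY k # ?Y @ [GX k])"
      using W_append[of "[GY k]" "?Y @ [GX k]"] Y(1) g by simp
    moreover have "W [GY k] \<otimes>\<^bsub>AA\<^esub> W (replicate a (GY k)) = W ?Y"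
      using W_append[of "[GY k]" "replicate a (GY k)"] Y(2) g by simp
    moreover have "W (?Y @ [GX k]) \<in> carrier AA" "W (replicate a (GY k)) \<in> carrier AA" "W [GY k] \<in> carrier AA"
      using Y g by (auto intro!: W_closed simp del: replicate.simps)
    ultimately show ?thesis unfolding cd by (simp add: AA.r_distr AA.smult_mult_r del: replicate.simps)
  qed
  also have "q k \<odot>\<^bsub>AA\<^esub> (c \<odot>\<^bsub>AA\<^esub> W (GY k # ?Y @ [GX k]) \<oplus>\<^bsub>AA\<^esub> d \<odot>\<^bsub>AA\<^esub> W ?Y) \<oplus>\<^bsub>AA\<^esub> W ?Y =
      (q k * c) \<odot>\<^bsub>AA\<^esub> W (GY k # ?Y @ [GX k]) \<oplus>\<^bsub>AA\<^esub> (q k * d + 1) \<odot>\<^bsub>AA\<^esub> W ?Y"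
  proof -
    have "W (GY k # ?Y @ [GX k]) \<in> carrier AA" "W ?Y \<in> carrier AA"
      using Y g by (auto intro!: W_closed simp del: replicate.simps)
    then show ?thesis by (simp add: AA.smult_r_distr AA.smult_smult AA.smult_l_distr AA.a_assoc del: replicate.simps)
  qed
  finally show ?case by auto
qed

lemma W_gen_block:
  assumes k: "k \<in> {1..n}" and g: "g \<in> gens n" "idx g = k"
  shows "W (g # block k a b) \<in> AA.lspan W {block k c d | c d. True}"
proof -
  let ?B = "{block k c d | c d. True}"
  have B: "W \<in> ?B \<rightarrow> carrier AA" using k by auto
  have base: "W (block k c d) \<in> AA.lspan W ?B" for c d
    using k by (intro AA.lspan_base) auto
  show ?thesis
  proof (cases g)
    case (GY i)
    then have "g # block k a b = block k (Suc a) b" using g by (simp add: block_def)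
    then show ?thesis using base by simp
  next
    case (GX i)
    then have gk: "g = GX k" using g by simp
    show ?thesis
    proof (cases a)
      case 0
      then have "g # block k a b = block k 0 (Suc b)" using gk by (simp add: block_def)
      then show ?thesis using base by simp
    next
      case (Suc a')
      let ?Y = "replicate (Suc a') (GY k)" and ?X = "replicate b (GX k)"
      have l: "?Y \<in> lists (gens n)" "?X \<in> lists (gens n)" "replicate a' (GY k) \<in> lists (gens n)" "GX k \<in> gens n"
        using k by (auto intro!: replicate_gens simp del: replicate.simps)
      obtain c d where cd: "W (GX k # ?Y) = c \<odot>\<^bsub>AA\<^esub> W (?Y @ [GX k]) \<oplus>\<^bsub>AA\<^esub> d \<odot>\<^bsub>AA\<^esub> W (replicate a' (GY k))"
        using W_X_Ys[OF k] by blast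
      have 1: "W (?Y @ [GX k]) \<otimes>\<^bsub>AA\<^esub> W ?X = W (block k (Suc a') (Suc b))"
        using W_append[of "?Y @ [GX k]" ?X] l by (simp add: block_def)
      have 2: "W (replicate a' (GY k)) \<otimes>\<^bsub>AA\<^esub> W ?X = W (block k a' b)"
        using W_append[of "replicate a' (GY k)" ?X] l by (simp add: block_def)
      have "W (g # block k a b) = W (GX k # ?Y) \<otimes>\<^bsub>AA\<^esub> W ?X"
        using W_append[of "GX k # ?Y" ?X] l gk Suc by (simp add: block_def)
      also have "\<dots> = c \<odot>\<^bsub>AA\<^esub> W (block k (Suc a') (Suc b)) \<oplus>\<^bsub>AA\<^esub> d \<odot>\<^bsub>AA\<^esub> W (block k a' b)"
      proof -
        have "W (?Y @ [GX k]) \<in> carrier AA" "W (replicate a' (GY k)) \<in> carrier AA" "W ?X \<in> carrier AA"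
          using l by (auto intro!: W_closed simp del: replicate.simps)
        then show ?thesis unfolding cd using 1 2
          by (simp add: AA.l_distr AA.smult_mult_l del: replicate.simps)
      qed
      also have "\<dots> \<in> AA.lspan W ?B"
        by (intro AA.lspan_add AA.lspan_smult base B)
      finally show ?thesis .
    qed
  qed
qed

text \<open>Words made of one block for each index, in increasing order of the index: the candidates
  for a Poincare-Birkhoff-Witt basis.\<close>

fun NW :: "nat \<Rightarrow> gen list set" where
  "NW 0 = {[]}"
| "NW (Suc k) = {w @ block (Suc k) a b | w a b. w \<in> NW k}"

lemma NW_idx: "w \<in> NW k \<Longrightarrow> g \<in> set w \<Longrightarrow> idx g \<in> {1..k}"
proof (induction k arbitrary: w)
  case (Suc k)
  then obtain w' a b where w: "w = w' @ block (Suc k) a b" "w' \<in> NW k" by auto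
  then show ?case using Suc.IH[OF w(2)] Suc.prems(2)
    by (auto simp: block_def)
qed simp

lemma NW_lists: "w \<in> NW k \<Longrightarrow> k \<le> n \<Longrightarrow> w \<in> lists (gens n)"
  using NW_idx[of w k] by (fastforce simp: gens_iff in_lists_conv_set)

lemma W_NW: "k \<le> n \<Longrightarrow> W \<in> NW k \<rightarrow> carrier AA"
  using NW_lists by auto

text \<open>A generator of smaller index is absorbed into the earlier blocks by induction. A
  generator of the last index commutes past all earlier blocks up to a scalar and is reordered
  inside the last one.\<close>

lemma lspan_NW_left:
  assumes "k \<le> n" "g \<in> gens n" "idx g \<le> k" "w \<in> NW k"
  shows "W (g # w) \<in> AA.lspan W (NW k)"
  using assms
proof (induction k arbitrary: w)
  case 0
  then show ?case by (auto simp: gens_iff)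
next
  case (Suc k)
  then obtain w' a b where w: "w = w' @ block (Suc k) a b" "w' \<in> NW k" by auto
  have k: "Suc k \<in> {1..n}" "k \<le> n" using Suc.prems(1) by auto
  have l: "w' \<in> lists (gens n)" "block (Suc k) a b \<in> lists (gens n)"
    using NW_lists[OF w(2) k(2)] block_lists[OF k(1)] by auto
  note f = W_NW[OF Suc.prems(1)]
  have clo: "\<zero>\<^bsub>AA\<^esub> \<in> AA.lspan W (NW (Suc k))"
    "\<And>x y. x \<in> AA.lspan W (NW (Suc k)) \<Longrightarrow> y \<in> AA.lspan W (NW (Suc k)) \<Longrightarrow> x \<oplus>\<^bsub>AA\<^esub> y \<in> AA.lspan W (NW (Suc k))"
    "\<And>c x. x \<in> AA.lspan W (NW (Suc k)) \<Longrightarrow> c \<odot>\<^bsub>AA\<^esub> x \<in> AA.lspan W (NW (Suc k))"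
    using AA.lspan_zero AA.lspan_add[OF _ _ f] AA.lspan_smult[OF _ f] by auto
  have base: "W (u @ block (Suc k) c d) \<in> AA.lspan W (NW (Suc k))" if "u \<in> NW k" for u c d
  proof (rule AA.lspan_base)
    show "u @ block (Suc k) c d \<in> NW (Suc k)" using that by auto
    then show "W (u @ block (Suc k) c d) \<in> carrier AA" using f by blast
  qed
  show ?case
  proof (cases "idx g \<le> k")
    case True
    then have IH: "W (g # w') \<in> AA.lspan W (NW k)" using Suc.IH[OF k(2) Suc.prems(2) _ w(2)] by simp
    have "AA.lspan W (NW k) \<subseteq>
        {x \<in> carrier AA. x \<otimes>\<^bsub>AA\<^esub> W (block (Suc k) a b) \<in> AA.lspan W (NW (Suc k))}"
    proof (rule AA.lspan_subset)
      fix u assume u: "u \<in> NW k"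
      have ul: "u \<in> lists (gens n)" using NW_lists[OF u k(2)] .
      show "W u \<in> {x \<in> carrier AA. x \<otimes>\<^bsub>AA\<^esub> W (block (Suc k) a b) \<in> AA.lspan W (NW (Suc k))}"
        using base[OF u, of a b] W_append[OF ul l(2)] ul by simp
    qed (use l(2) clo in \<open>auto simp: AA.l_distr AA.smult_mult_l\<close>)
    then have "W (g # w') \<otimes>\<^bsub>AA\<^esub> W (block (Suc k) a b) \<in> AA.lspan W (NW (Suc k))" using IH by blast
    then show ?thesis using W_append[of "g # w'" "block (Suc k) a b"] l Suc.prems(2) w(1) by simp
  next
    case False
    then have gk: "idx g = Suc k" using Suc.prems(3) by simp
    have "idx g \<notin> idx ` set w'"
    proof
      assume "idx g \<in> idx ` set w'"
      then obtain x where x: "x \<in> set w'" "idx x = Suc k" using gk by auto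
      then show False using NW_idx[OF w(2), of x] by simp
    qed
    then obtain c where c: "W (g # w') = c \<odot>\<^bsub>AA\<^esub> W (w' @ [g])"
      using W_swap_word[OF Suc.prems(2) l(1)] by blast
    have "W (g # w) = W (g # w') \<otimes>\<^bsub>AA\<^esub> W (block (Suc k) a b)"
      using W_append[of "g # w'" "block (Suc k) a b"] l Suc.prems(2) w(1) by simp
    also have "\<dots> = c \<odot>\<^bsub>AA\<^esub> (W (w' @ [g]) \<otimes>\<^bsub>AA\<^esub> W (block (Suc k) a b))"
      using c l Suc.prems(2) by (simp add: AA.smult_mult_l)
    also have "W (w' @ [g]) \<otimes>\<^bsub>AA\<^esub> W (block (Suc k) a b) = W w' \<otimes>\<^bsub>AA\<^esub> W (g # block (Suc k) a b)"
      using W_append[of "w' @ [g]" "block (Suc k) a b"] W_append[of w' "g # block (Suc k) a b"]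
        l Suc.prems(2) by simp
    finally have eq: "W (g # w) = c \<odot>\<^bsub>AA\<^esub> (W w' \<otimes>\<^bsub>AA\<^esub> W (g # block (Suc k) a b))" .
    have "AA.lspan W {block (Suc k) c d | c d. True} \<subseteq>
        {x \<in> carrier AA. W w' \<otimes>\<^bsub>AA\<^esub> x \<in> AA.lspan W (NW (Suc k))}"
    proof (rule AA.lspan_subset)
      fix u assume "u \<in> {block (Suc k) c d | c d. True}"
      then obtain c d where u: "u = block (Suc k) c d" by blast
      have ul: "u \<in> lists (gens n)" unfolding u using block_lists[OF k(1)] .
      show "W u \<in> {x \<in> carrier AA. W w' \<otimes>\<^bsub>AA\<^esub> x \<in> AA.lspan W (NW (Suc k))}"
        using base[OF w(2), of c d] W_append[OF l(1) ul] ul u by simp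
    qed (use l(1) clo in \<open>auto simp: AA.r_distr AA.smult_mult_r\<close>)
    then have "W w' \<otimes>\<^bsub>AA\<^esub> W (g # block (Suc k) a b) \<in> AA.lspan W (NW (Suc k))"
      using W_gen_block[OF k(1) Suc.prems(2) gk] by blast
    then show ?thesis unfolding eq by (rule clo(3))
  qed
qed

lemma Nil_in_NW: "[] \<in> NW k"
  by (induction k) (auto simp: block_def intro!: exI[of _ "[]"] exI[of _ 0])

text \<open>The span contains the unit and is stable under left multiplication by generators, hence
  contains every word.\<close>

lemma carrier_eq_lspan_NW: "carrier AA = AA.lspan W (NW n)"
proof
  have f: "W \<in> NW n \<rightarrow> carrier AA" by (rule W_NW[OF order_refl])
  show "AA.lspan W (NW n) \<subseteq> carrier AA" by (rule AA.lspan_closed[OF f])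
  have words: "W w \<in> AA.lspan W (NW n)" if "w \<in> lists (gens n)" for w
    using that
  proof (induction w rule: list.induct)
    case Nil
    then show ?case using AA.lspan_base[OF Nil_in_NW, of W n] by simp
  next
    case (Cons g w)
    then have g: "g \<in> gens n" "w \<in> lists (gens n)" by auto
    have "AA.lspan W (NW n) \<subseteq> {x \<in> carrier AA. W [g] \<otimes>\<^bsub>AA\<^esub> x \<in> AA.lspan W (NW n)}"
    proof (rule AA.lspan_subset)
      fix u assume u: "u \<in> NW n"
      then have ul: "u \<in> lists (gens n)" by (rule NW_lists) simp
      have "W (g # u) \<in> AA.lspan W (NW n)"
        using lspan_NW_left[OF order_refl g(1) _ u] g(1) by (simp add: gens_iff)
      then show "W u \<in> {x \<in> carrier AA. W [g] \<otimes>\<^bsub>AA\<^esub> x \<in> AA.lspan W (NW n)}"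
        using ul W_Cons[OF g(1) ul] by simp
    qed (use g AA.lspan_zero AA.lspan_add[OF _ _ f] AA.lspan_smult[OF _ f] in
        \<open>auto simp: AA.r_distr AA.smult_mult_r\<close>)
    then have "W [g] \<otimes>\<^bsub>AA\<^esub> W w \<in> AA.lspan W (NW n)" using Cons.IH[OF g(2)] by blast
    then show ?case using W_Cons[OF g] by simp
  qed
  have "Q.proj f \<in> AA.lspan W (NW n)" if "f \<in> carrier FA" for f
    using that
  proof (induction f rule: FA_induct)
    case (delta c w)
    then show ?case using AA.lspan_smult[OF words W_NW[OF order_refl], of w c] by (simp add: proj(5) flip: W_def)
  next
    case (add f g)
    then show ?case using AA.lspan_add[OF _ _ W_NW[OF order_refl]] by (simp add: proj(2))
  qed
  then show "carrier AA \<subseteq> AA.lspan W (NW n)" unfolding AA_eq Q.carrier_kquot by auto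
qed

section \<open>Independence of the action of normal words\<close>

lemma count_list_replicate: "count_list (replicate a x) y = (if x = y then a else 0)"
  by (induction a) auto

lemma count_list_block:
  "count_list (block k a b) g = (if g = GY k then a else if g = GX k then b else 0)"
  by (auto simp: block_def count_list_replicate)

lemma NW_count_zero: "w \<in> NW k \<Longrightarrow> idx g \<notin> {1..k} \<Longrightarrow> count_list w g = 0"
  using NW_idx[of w k g] by (auto simp: count_list_0_iff)

text \<open>Letter counts give the lengths within each block, and the order of the blocks is
  fixed.\<close>

lemma NW_unique: "w \<in> NW k \<Longrightarrow> w' \<in> NW k \<Longrightarrow> (\<And>g. count_list w g = count_list w' g) \<Longrightarrow> w = w'"
proof (induction k arbitrary: w w')
  case (Suc k)
  obtain u a b where w: "w = u @ block (Suc k) a b" "u \<in> NW k" using Suc.prems(1) by auto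
  obtain u' a' b' where w': "w' = u' @ block (Suc k) a' b'" "u' \<in> NW k" using Suc.prems(2) by auto
  have c: "count_list u g + count_list (block (Suc k) a b) g = count_list u' g + count_list (block (Suc k) a' b') g" for g
    using Suc.prems(3)[of g] w(1) w'(1) by simp
  have z: "count_list u g = 0" "count_list u' g = 0" if "idx g = Suc k" for g
    using NW_count_zero[OF w(2), of g] NW_count_zero[OF w'(2), of g] that by auto
  have ab: "a = a'" "b = b'" using c[of "GY (Suc k)"] c[of "GX (Suc k)"] z[of "GY (Suc k)"] z[of "GX (Suc k)"]
    by (auto simp: count_list_block)
  then have "count_list u g = count_list u' g" for g using c[of g] by simp
  then have "u = u'" using Suc.IH[OF w(2) w'(2)] by blast
  then show ?case using w(1) w'(1) ab by simp
qed simp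

lemma sc_Xs: "k \<in> {1..n} \<Longrightarrow> sc (replicate b (GX k)) \<kappa> \<noteq> 0 \<longleftrightarrow> (\<forall>t\<in>{1..int b}. \<kappa> k + t \<noteq> 0)"
proof (induction b arbitrary: \<kappa>)
  case (Suc b)
  have "sc (replicate (Suc b) (GX k)) \<kappa> \<noteq> 0 \<longleftrightarrow>
      \<kappa> k + 1 \<noteq> 0 \<and> (\<forall>t\<in>{1..int b}. \<kappa> k + 1 + t \<noteq> 0)"
    using Suc tw_nz[of k \<kappa>] br_eq_0_iff[of k "\<kappa> k + 1"] by simp
  also have "\<dots> \<longleftrightarrow> (\<forall>t\<in>{1..int (Suc b)}. \<kappa> k + t \<noteq> 0)"
  proof (intro iffI conjI ballI)
    fix t assume *: "\<kappa> k + 1 \<noteq> 0 \<and> (\<forall>t\<in>{1..int b}. \<kappa> k + 1 + t \<noteq> 0)" "t \<in> {1..int (Suc b)}"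
    show "\<kappa> k + t \<noteq> 0"
    proof (cases "t = 1")
      case False
      then have "t - 1 \<in> {1..int b}" using *(2) by auto
      then have "\<kappa> k + 1 + (t - 1) \<noteq> 0" using *(1) by blast
      then show ?thesis by simp
    qed (use *(1) in simp)
  next
    assume *: "\<forall>t\<in>{1..int (Suc b)}. \<kappa> k + t \<noteq> 0"
    show "\<kappa> k + 1 \<noteq> 0" using * by auto
    show "\<kappa> k + 1 + t \<noteq> 0" if "t \<in> {1..int b}" for t
      using bspec[OF *, of "1 + t"] that by auto
  qed
  finally show ?case .
qed simp

lemma sc_Ys: "k \<in> {1..n} \<Longrightarrow> sc (replicate a (GY k)) \<kappa> \<noteq> 0"
  by (induction a arbitrary: \<kappa>) (auto simp: tw_nz)

lemma sc_block:
  assumes "k \<in> {1..n}"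
  shows "sc (block k a b) \<kappa> \<noteq> 0 \<longleftrightarrow> (\<forall>t\<in>{1..int b}. \<kappa> k - int a + t \<noteq> 0)"
proof -
  have "mvs (replicate a (GY k)) \<kappa> k = \<kappa> k - int a" by (simp add: mvs_apply count_list_replicate)
  then show ?thesis unfolding block_def sc_append using sc_Ys[OF assms] sc_Xs[OF assms] by simp
qed

text \<open>The \<open>y\<close> letters never contribute a zero factor. The \<open>x\<close>
  letters of index i contribute q-integers of consecutive numbers, and a q-integer vanishes only at
  0 because \<open>q i\<close> is not a root of unity.\<close>

lemma sc_NW:
  assumes "k \<le> n" "w \<in> NW k"
  shows "sc w \<kappa> \<noteq> 0 \<longleftrightarrow>
    (\<forall>i\<in>{1..k}. \<forall>t\<in>{1..int (count_list w (GX i))}. \<kappa> i - int (count_list w (GY i)) + t \<noteq> 0)"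
  using assms
proof (induction k arbitrary: w)
  case (Suc k)
  obtain u a b where w: "w = u @ block (Suc k) a b" "u \<in> NW k" using Suc.prems(2) by auto
  have z: "count_list u (GX (Suc k)) = 0" "count_list u (GY (Suc k)) = 0"
    using NW_count_zero[OF w(2)] by auto
  have cw: "count_list w (GX i) = count_list u (GX i)" "count_list w (GY i) = count_list u (GY i)"
    if "i \<in> {1..k}" for i using that w(1) by (auto simp: count_list_block)
  have ck: "count_list w (GX (Suc k)) = b" "count_list w (GY (Suc k)) = a"
    using w(1) z by (auto simp: count_list_block)
  have "mvs u \<kappa> (Suc k) = \<kappa> (Suc k)" using z by (simp add: mvs_apply)
  then have "sc w \<kappa> \<noteq> 0 \<longleftrightarrow> sc u \<kappa> \<noteq> 0 \<and> (\<forall>t\<in>{1..int b}. \<kappa> (Suc k) - int a + t \<noteq> 0)"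
    unfolding w(1) sc_append using sc_block[of "Suc k" a b "mvs u \<kappa>"] Suc.prems(1) by simp
  also have "sc u \<kappa> \<noteq> 0 \<longleftrightarrow>
      (\<forall>i\<in>{1..k}. \<forall>t\<in>{1..int (count_list w (GX i))}. \<kappa> i - int (count_list w (GY i)) + t \<noteq> 0)"
    using Suc.IH[OF _ w(2)] Suc.prems(1) cw by simp
  also have "{1..Suc k} = insert (Suc k) {1..k}" by auto
  ultimately show ?case using ck by auto
qed simp

definition ind :: "(nat \<Rightarrow> int) \<Rightarrow> (nat \<Rightarrow> int) \<Rightarrow> 'k" where
  "ind m = (\<lambda>x. if x = m then 1 else 0)"

lemma act_lincomb:
  assumes "finite F" "F \<subseteq> lists (gens n)"
  shows "act (FA.lincomb delta c F) v \<kappa> = (\<Sum>w\<in>F. c w * (sc w \<kappa> * v (mvs w \<kappa>)))"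
  using assms
proof (induction F rule: finite_induct)
  case empty
  have "act \<zero>\<^bsub>FA\<^esub> v \<kappa> = 0" using act_smult[of "\<zero>\<^bsub>FA\<^esub>" 0 v \<kappa>] by simp
  then show ?case by (simp add: FA.lincomb_def)
next
  case (insert w F)
  have l: "F \<subseteq> lists (gens n)" "w \<in> lists (gens n)" using insert.prems by simp_all
  note cl = delta_funcset[OF l(1)] delta_closed[OF l(2)] l(2)
  then have "FA.lincomb delta c (insert w F) = c w \<odot>\<^bsub>FA\<^esub> delta w \<oplus>\<^bsub>FA\<^esub> FA.lincomb delta c F"
    unfolding FA.lincomb_def using insert by (subst FA.finsum_insert) (auto simp: Pi_def)
  then show ?case using insert cl FA.lincomb_closed[OF cl(1), of c]
    by (simp add: act_add act_smult act_delta)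
qed

text \<open>Among the words with nonzero coefficient, one with the fewest \<open>x\<close> letters
  is tested on the monomial that its \<open>x\<close> letters differentiate exactly down to a
  constant. A word with more \<open>x\<close> letters of some index kills this monomial, and by
  minimality no other word produces the same output monomial.\<close>

lemma normal_words_act_faithfully:
  assumes F: "finite F" "F \<subseteq> NW n"
    and 0: "\<And>(b :: nat \<Rightarrow> nat) \<kappa>. (\<forall>i. i \<notin> {1..n} \<longrightarrow> b i = 0) \<Longrightarrow>
      act (FA.lincomb delta c F) (ind (\<lambda>i. int (b i))) \<kappa> = 0"
  shows "\<forall>w\<in>F. c w = 0"
proof (rule ccontr)
  assume "\<not> ?thesis"
  then have "\<exists>w. w \<in> F \<and> c w \<noteq> 0" by blast
  then obtain w0 where w0: "w0 \<in> F" "c w0 \<noteq> 0"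
    and min: "\<And>w. w \<in> F \<Longrightarrow> c w \<noteq> 0 \<Longrightarrow> (\<Sum>i\<in>{1..n}. count_list w0 (GX i)) \<le> (\<Sum>i\<in>{1..n}. count_list w (GX i))"
    using ex_has_least_nat[of "\<lambda>w. w \<in> F \<and> c w \<noteq> 0" _ "\<lambda>w. \<Sum>i\<in>{1..n}. count_list w (GX i)"] by blast
  have w0N: "w0 \<in> NW n" using w0 F by auto
  \<comment> \<open>The tested input exponents are the \<open>x\<close> counts of \<open>w0\<close>,
    and the output exponents \<open>\<kappa>\<close> are its \<open>y\<close> counts.\<close>
  define m where "m i = int (count_list w0 (GX i))" for i
  define \<kappa> where "\<kappa> i = int (count_list w0 (GY i))" for i
  have m0: "mvs w0 \<kappa> = m" by (auto simp: mvs_apply m_def \<kappa>_def)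
  have s0: "sc w0 \<kappa> \<noteq> 0" unfolding sc_NW[OF order_refl w0N] by (auto simp: \<kappa>_def)
  have other: "c w * (sc w \<kappa> * ind m (mvs w \<kappa>)) = 0" if w: "w \<in> F" "w \<noteq> w0" for w
  proof (rule ccontr)
    assume "\<not> ?thesis"
    then have cw: "c w \<noteq> 0" and sw: "sc w \<kappa> \<noteq> 0" and mw: "mvs w \<kappa> = m" by (auto simp: ind_def split: if_splits)
    have wN: "w \<in> NW n" using w F by auto
    have eq: "int (count_list w0 (GY i)) - int (count_list w (GY i)) + int (count_list w (GX i)) = int (count_list w0 (GX i))" for i
      using fun_cong[OF mw, of i] by (simp add: mvs_apply m_def \<kappa>_def)
    have le: "count_list w (GX i) \<le> count_list w0 (GX i)" if i: "i \<in> {1..n}" for i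
    proof (rule ccontr)
      assume "\<not> ?thesis"
      \<comment> \<open>At this position the q-integer would be that of 0, by the balance of
        exponents in \<open>eq\<close>.\<close>
      then have "int (count_list w (GX i)) - int (count_list w0 (GX i)) \<in> {1..int (count_list w (GX i))}" by auto
      then have "\<kappa> i - int (count_list w (GY i)) + (int (count_list w (GX i)) - int (count_list w0 (GX i))) \<noteq> 0"
        using sw i unfolding sc_NW[OF order_refl wN] by blast
      then show False using eq[of i] by (simp add: \<kappa>_def)
    qed
    have X: "count_list w (GX i) = count_list w0 (GX i)" if i: "i \<in> {1..n}" for i
    proof (rule ccontr)
      assume "\<not> ?thesis"
      then have "count_list w (GX i) < count_list w0 (GX i)" using le[OF i] by simp
      then have "(\<Sum>i\<in>{1..n}. count_list w (GX i)) < (\<Sum>i\<in>{1..n}. count_list w0 (GX i))"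
        using le i by (intro sum_strict_mono_ex1) auto
      then show False using min[OF w(1) cw] by simp
    qed
    have "count_list w g = count_list w0 g" for g
    proof (cases "idx g \<in> {1..n}")
      case True
      then show ?thesis using X[of "idx g"] eq[of "idx g"] by (cases g) auto
    next
      case False
      then show ?thesis using NW_count_zero[OF wN] NW_count_zero[OF w0N] by simp
    qed
    then have "w = w0" using NW_unique[OF wN w0N] by blast
    then show False using w(2) by simp
  qed
  have "act (FA.lincomb delta c F) (ind m) \<kappa> = (\<Sum>w\<in>F. c w * (sc w \<kappa> * ind m (mvs w \<kappa>)))"
    using F NW_lists[OF _ order_refl] by (intro act_lincomb) auto
  also have "\<dots> = (\<Sum>w\<in>{w0}. c w * (sc w \<kappa> * ind m (mvs w \<kappa>)))"
    using F(1) w0(1) other by (intro sum.mono_neutral_right) auto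
  also have "\<dots> = c w0 * sc w0 \<kappa>" using m0 by (simp add: ind_def)
  finally have "act (FA.lincomb delta c F) (ind m) \<kappa> \<noteq> 0" using w0(2) s0 by simp
  moreover have "act (FA.lincomb delta c F) (ind m) \<kappa> = 0"
    unfolding m_def using NW_count_zero[OF w0N] by (intro 0) simp
  ultimately show False by simp
qed

section \<open>The center\<close>

lemma proj_eq_act:
  assumes "Q.proj f = Q.proj g" "f \<in> carrier FA" "g \<in> carrier FA"
  shows "act f v \<kappa> = act g v \<kappa>"
proof -
  have "f \<ominus>\<^bsub>FA\<^esub> g \<in> II" using assms Q.proj_eq_iff by blast
  then show ?thesis using act_II[of "f \<ominus>\<^bsub>FA\<^esub> g" v \<kappa>] act_minus[of f g v \<kappa>] assms by simp
qed

text \<open>Exponent functions are defined on all naturals, but no generator moves an exponent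
  outside the range of indices.\<close>

lemma act_outside:
  assumes "f \<in> carrier FA" "i \<notin> {1..n}" "\<kappa> i \<noteq> m i"
  shows "act f (ind m) \<kappa> = 0"
  using assms(1)
proof (induction f rule: FA_induct)
  case (delta c w)
  have "g \<notin> set w" if "idx g = i" for g
    using delta assms(2) that by (auto simp: gens_iff in_lists_conv_set)
  then have "count_list w (GX i) = 0" "count_list w (GY i) = 0" by (auto simp: count_list_0_iff)
  then have "mvs w \<kappa> i = \<kappa> i" by (simp add: mvs_apply)
  then have "mvs w \<kappa> \<noteq> m" using assms(3) by auto
  then show ?case using delta by (simp add: act_smult act_delta ind_def)
qed (simp add: act_add)

lemma central_qweyl: "central_kalg AA"
  unfolding central_kalg_def
proof (intro conjI ballI)
  show "\<one>\<^bsub>AA\<^esub> \<noteq> \<zero>\<^bsub>AA\<^esub>"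
  proof
    assume "\<one>\<^bsub>AA\<^esub> = \<zero>\<^bsub>AA\<^esub>"
    then have "Q.proj (delta []) = Q.proj \<zero>\<^bsub>FA\<^esub>"
      using kalg_hom_zero[OF FA.kalg_axioms AA.kalg_axioms proj_hom] W_Nil by (simp add: W_def)
    then have "act (delta []) (ind (\<lambda>_. 0)) (\<lambda>_. 0) = act \<zero>\<^bsub>FA\<^esub> (ind (\<lambda>_. 0)) (\<lambda>_. 0)"
      by (rule proj_eq_act) simp_all
    also have "\<dots> = 0" using act_smult[of "\<zero>\<^bsub>FA\<^esub>" 0] by simp
    finally show False by (simp add: act_delta ind_def)
  qed
next
  fix z assume z: "z \<in> kcenter AA"
  then have zc: "z \<in> carrier AA" by (simp add: kcenter_def)
  \<comment> \<open>The action is set up on the free algebra, so the argument works with a preimage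
    \<open>f\<close>; by \<open>proj_eq_act\<close> the choice does not matter.\<close>
  then obtain f where f: "f \<in> carrier FA" "z = Q.proj f" unfolding AA_eq Q.carrier_kquot by blast
  have comm: "act f (act g v) \<kappa> = act g (act f v) \<kappa>" if g: "g \<in> carrier FA" for g v \<kappa>
  proof -
    have "Q.proj (f \<otimes>\<^bsub>FA\<^esub> g) = Q.proj (g \<otimes>\<^bsub>FA\<^esub> f)"
      using z f g proj(1)[OF g] by (simp add: kcenter_def proj(3))
    then have "act (f \<otimes>\<^bsub>FA\<^esub> g) v \<kappa> = act (g \<otimes>\<^bsub>FA\<^esub> f) v \<kappa>"
      using f g by (intro proj_eq_act) auto
    then show ?thesis using f g by (simp add: act_mult)
  qed
  have diag: "act f (ind m) \<kappa> = 0" if "\<kappa> \<noteq> m" for m \<kappa>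
  proof -
    from that obtain i where i: "\<kappa> i \<noteq> m i" by auto
    show ?thesis
    proof (cases "i \<in> {1..n}")
      case True
      let ?z = "delta [GX i, GY i] \<ominus>\<^bsub>FA\<^esub> delta [GY i, GX i]"
      have zc: "?z \<in> carrier FA" using True by simp
      have az: "act ?z v x = q i powi (x i) * v x" for v x
        using True tw_nz[OF True, of x] br_rec(2)[OF True, of "x i"]
        by (simp add: act_minus act_delta algebra_simps flip: left_diff_distrib)
      have "act ?z (ind m) = (\<lambda>x. q i powi (m i) * ind m x)"
        unfolding fun_eq_iff az by (simp add: ind_def)
      then have "q i powi (m i) * act f (ind m) \<kappa> = act f (act ?z (ind m)) \<kappa>"
        using act_arg_smult[OF f(1)] by simp
      also have "\<dots> = q i powi (\<kappa> i) * act f (ind m) \<kappa>" using comm[OF zc] az by simp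
      finally show ?thesis using q_powi_inj[OF True, of "m i" "\<kappa> i"] i by auto
    next
      case False
      then show ?thesis using act_outside[OF f(1)] i by blast
    qed
  qed
  \<comment> \<open>The eigenvalue of \<open>f\<close> on the monomial with exponents
    \<open>m\<close>.\<close>
  define \<chi> where "\<chi> m = act f (ind m) m" for m
  have step: "\<chi> (m(i := m i + 1)) = \<chi> m" if i: "i \<in> {1..n}" for m i
  proof -
    let ?m = "m(i := m i + 1)"
    have y: "delta [GY i] \<in> carrier FA" using i by simp
    have ay: "act (delta [GY i]) v x = tw i x * v (x(i := x i - 1))" for v x
      using i by (simp add: act_delta)
    \<comment> \<open>Raising the i-th exponent leaves \<open>tw i\<close> unchanged, as it involves
      only smaller indices; the nonzero factor thus cancels when both orders of applying
      \<open>f\<close> are compared.\<close>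
    have "act (delta [GY i]) (ind m) = (\<lambda>x. tw i m * ind ?m x)"
    proof
      fix x
      have "x(i := x i - 1) = m \<longleftrightarrow> x = ?m" by (auto simp: fun_eq_iff)
      then show "act (delta [GY i]) (ind m) x = tw i m * ind ?m x"
        unfolding ay by (auto simp: ind_def)
    qed
    then have "tw i m * \<chi> ?m = act f (act (delta [GY i]) (ind m)) ?m"
      unfolding \<chi>_def using act_arg_smult[OF f(1)] by simp
    also have "\<dots> = tw i m * \<chi> m" unfolding comm[OF y] ay \<chi>_def by simp
    finally show ?thesis using tw_nz[OF i] by simp
  qed
  \<comment> \<open>Eigenvalues are compared along paths from 0, which reach all monomials with
    natural exponents; those are the ones tested by
    \<open>normal_words_act_faithfully\<close>.\<close>
  have const: "\<chi> (\<lambda>i. int (b i)) = \<chi> (\<lambda>_. 0)" if "\<forall>i. i \<notin> {1..n} \<longrightarrow> b i = 0" for b :: "nat \<Rightarrow> nat"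
    using that
  proof (induction "\<Sum>i\<in>{1..n}. b i" arbitrary: b)
    case 0
    have "b i = 0" for i using 0 by (cases "i \<in> {1..n}") auto
    then show ?case by simp
  next
    case (Suc k)
    then obtain i where i: "i \<in> {1..n}" "b i \<noteq> 0" by (metis nat.distinct(1) sum.neutral)
    let ?b = "b(i := b i - 1)"
    have "(\<Sum>i\<in>{1..n}. b i) = b i + (\<Sum>j\<in>{1..n} - {i}. b j)" using i(1) by (simp add: sum.remove)
    moreover have "(\<Sum>i\<in>{1..n}. ?b i) = (b i - 1) + (\<Sum>j\<in>{1..n} - {i}. ?b j)" using i(1) by (simp add: sum.remove)
    moreover have "(\<Sum>j\<in>{1..n} - {i}. ?b j) = (\<Sum>j\<in>{1..n} - {i}. b j)" by (rule sum.cong) auto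
    ultimately have "k = (\<Sum>i\<in>{1..n}. ?b i)" using Suc.hyps(2) i(2) by simp
    then have "\<chi> (\<lambda>j. int (?b j)) = \<chi> (\<lambda>_. 0)" using Suc.prems by (intro Suc.hyps(1)) auto
    moreover have "(\<lambda>j. int (b j)) = (\<lambda>j. int (?b j))(i := int (?b i) + 1)" using i(2) by auto
    ultimately show ?case using step[OF i(1), of "\<lambda>j. int (?b j)"] by simp
  qed
  let ?c = "\<chi> (\<lambda>_. 0)"
  let ?f = "f \<ominus>\<^bsub>FA\<^esub> ?c \<odot>\<^bsub>FA\<^esub> delta []"
  have fc: "?f \<in> carrier FA" using f by simp
  have u: "Q.proj ?f = z \<ominus>\<^bsub>AA\<^esub> ?c \<odot>\<^bsub>AA\<^esub> \<one>\<^bsub>AA\<^esub>"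
    using f W_Nil by (simp add: kalg_hom_minus[OF FA.kalg_axioms AA.kalg_axioms proj_hom] proj(5) W_def)
  \<comment> \<open>Faithfulness is known for combinations of normal words only, so the class of
    \<open>?f\<close> is rewritten as such a combination, which acts in the same way.\<close>
  have "Q.proj ?f \<in> AA.lspan W (NW n)" using proj(1)[OF fc] unfolding carrier_eq_lspan_NW .
  then obtain c F where F: "finite F" "F \<subseteq> NW n" "Q.proj ?f = AA.lincomb W c F" by (rule AA.lspanE)
  have Fl: "F \<subseteq> lists (gens n)" using F(2) NW_lists by blast
  have Fc: "delta \<in> F \<rightarrow> carrier FA" using Fl by (rule delta_funcset)
  have "Q.proj (FA.lincomb delta c F) = AA.lincomb W c F"
  proof -
    have "Q.proj (FA.lincomb delta c F) = (\<Oplus>\<^bsub>AA\<^esub>w\<in>F. Q.proj (c w \<odot>\<^bsub>FA\<^esub> delta w))"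
      unfolding FA.lincomb_def using Fc by (intro kalg_hom_finsum[OF FA.kalg_axioms AA.kalg_axioms proj_hom]) auto
    also have "\<dots> = AA.lincomb W c F" unfolding AA.lincomb_def
    proof (rule AA.finsum_cong'[OF refl])
      show "(\<lambda>w. c w \<odot>\<^bsub>AA\<^esub> W w) \<in> F \<rightarrow> carrier AA"
        using subsetD[OF Fl] by (intro Pi_I AA.smult_closed W_closed)
      show "Q.proj (c w \<odot>\<^bsub>FA\<^esub> delta w) = c w \<odot>\<^bsub>AA\<^esub> W w" if "w \<in> F" for w
        using delta_closed[OF subsetD[OF Fl that]] by (simp add: proj(5) W_def)
    qed
    finally show ?thesis .
  qed
  then have eq: "Q.proj (FA.lincomb delta c F) = Q.proj ?f" using F(3) by simp
  have "\<forall>w\<in>F. c w = 0"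
  proof (rule normal_words_act_faithfully[OF F(1,2)])
    fix b :: "nat \<Rightarrow> nat" and \<kappa> assume b: "\<forall>i. i \<notin> {1..n} \<longrightarrow> b i = 0"
    let ?m = "\<lambda>i. int (b i)"
    have "act (FA.lincomb delta c F) (ind ?m) \<kappa> = act ?f (ind ?m) \<kappa>"
      using eq FA.lincomb_closed[OF Fc] fc by (rule proj_eq_act)
    also have "\<dots> = act f (ind ?m) \<kappa> - ?c * ind ?m \<kappa>"
      using f by (simp add: act_minus act_smult act_delta)
    also have "\<dots> = 0"
    proof (cases "\<kappa> = ?m")
      case True
      then show ?thesis using const[OF b] by (simp add: \<chi>_def ind_def)
    next
      case False
      then show ?thesis using diag by (simp add: ind_def)
    qed
    finally show "act (FA.lincomb delta c F) (ind ?m) \<kappa> = 0" .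
  qed
  then have "AA.lincomb W c F = \<zero>\<^bsub>AA\<^esub>" unfolding AA.lincomb_def
    using W_closed[OF subsetD[OF Fl]] by (intro AA.add.finprod_one_eqI) simp
  then have "z \<ominus>\<^bsub>AA\<^esub> ?c \<odot>\<^bsub>AA\<^esub> \<one>\<^bsub>AA\<^esub> = \<zero>\<^bsub>AA\<^esub>" using F(3) u by simp
  then have "z = ?c \<odot>\<^bsub>AA\<^esub> \<one>\<^bsub>AA\<^esub>" using AA.eq_if_minus_eq_zero[OF zc] by simp
  then show "\<exists>c. z = c \<odot>\<^bsub>AA\<^esub> \<one>\<^bsub>AA\<^esub>" ..
qed

end

theorem theorem1p3:
  fixes n :: nat and q :: "nat \<Rightarrow> 'k::field" and \<Lambda> :: "nat \<Rightarrow> nat \<Rightarrow> 'k"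
    and B :: "('k, 'b) module" and R :: "('k, 'r) module"
  assumes n: "n \<ge> 1"
    and q_nz: "\<forall>i\<in>{1..n}. q i \<noteq> 0"
    and L_nz: "\<forall>i\<in>{1..n}. \<forall>j\<in>{1..n}. \<Lambda> i j \<noteq> 0"
    and L_inv: "\<forall>i\<in>{1..n}. \<forall>j\<in>{1..n}. \<Lambda> i j = inverse (\<Lambda> j i)"
    and L_diag: "\<forall>i\<in>{1..n}. \<Lambda> i i = 1"
    and q_not_root: "\<forall>i\<in>{1..n}. \<forall>m::nat. m \<ge> 1 \<longrightarrow> q i ^ m \<noteq> 1"
  shows "universally_cancels_with (qweyl n q \<Lambda>) B R
       \<and> strongly_cancels_with (qweyl n q \<Lambda>) B
       \<and> cancels_with (qweyl n q \<Lambda>) B"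
proof -
  let ?A = "qweyl n q \<Lambda>"
  interpret qw n q \<Lambda>
    by (rule qw.intro) (use q_nz L_nz L_inv q_not_root in \<open>blast+\<close>)
  have univ: "kalg_isomorphic ?A B"
    if asm: "kalgebra R" "domain R" "kalg_fin_gen R" "ideal I R" "kalg_isomorphic (kquot R I) (K_alg :: ('k, 'k) module)"
      "kalgebra B" "kalg_isomorphic (tensor ?A R) (tensor B R)" for I
  proof -
    have R: "comm_kalg R" using asm(1,2) by (simp add: comm_kalg_def kalgebra_iff_kalg domain_def)
    have B: "kalg B" using asm(6) by (simp add: kalgebra_iff_kalg)
    interpret Q: kalg_quotient R I using R asm(4) by (simp add: kalg_quotient_def comm_kalg_def)
    \<comment> \<open>Composed with the projection onto the quotient, this isomorphism is the
      augmentation of R.\<close>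
    obtain h where h: "h \<in> kalg_hom (kquot R I) K_alg" using asm(5) unfolding kalg_isomorphic_def by blast
    obtain \<iota> \<kappa> where T: "tens ?A R (tensor ?A R) \<iota> \<kappa>" using tens_tensor[OF kalg_qweyl R] by (elim exE)
    obtain \<iota>' \<kappa>' where T': "tens B R (tensor B R) \<iota>' \<kappa>'" using tens_tensor[OF B R] by (elim exE)
    show ?thesis
      by (rule cancel_tens[OF T T' asm(7) central_qweyl asm(2,3) kalg_hom_comp[OF Q.proj_hom h]])
  qed
  \<comment> \<open>Polynomial rings are tensor products with the polynomial ring over K, a finitely
    generated domain augmented by constant terms. The case of one variable gives ordinary
    cancellation.\<close>
  have strong: "kalg_isomorphic ?A B"
    if asm: "kalgebra B" "kalg_isomorphic (polyring ?A d) (polyring B d)" for d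
  proof -
    have B: "kalg B" using asm(1) by (simp add: kalgebra_iff_kalg)
    obtain \<iota> \<kappa> where T: "tens ?A (polyring (K_alg :: ('k, 'k) module) d) (polyring ?A d) \<iota> \<kappa>"
      using tens_polyring[OF kalg_qweyl, of d] by (elim exE)
    obtain \<iota>' \<kappa>' where T': "tens B (polyring (K_alg :: ('k, 'k) module) d) (polyring B d) \<iota>' \<kappa>'"
      using tens_polyring[OF B, of d] by (elim exE)
    show ?thesis
      by (rule cancel_tens[OF T T' asm(2) central_qweyl domain_polyring_K fin_gen_polyring_K augmentation_polyring_K])
  qed
  show ?thesis
    unfolding universally_cancels_with_def strongly_cancels_with_def cancels_with_def
    using univ strong by blast
qed

end
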